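(* For each $\varepsilon\in(0,1]$ let $\rho\in H^1(\mathcal{T}\times\mathcal{D})$, $j,w\in H^1(\mathcal{T}\times\mathcal{D}\times\Omega^+)$ be the exact solution of the one-dimensional multiscale parity decomposition system described in the context, and let $\rho_\theta,j_\theta,w_\theta$ be neural network approximations. Then $$\mathcal{R}^\varepsilon_{\mathrm{total}}\le C\big(\mathcal{R}^\varepsilon_{\mathrm{APNN}}+\varepsilon^2\big),$$ where the constant $C>0$ is independent of $\varepsilon$.
   Context: $\varepsilon$ is the Knudsen number, $\mathcal{T}=(0,T)$ is a bounded time interval, $\mathcal{D}=(x_L,x_R)$, $\Omega^+=[0,1]$, $\langle g\rangle=\int_0^1g\,\mathrm{d}v$, and $\lambda_1,\dots,\lambda_4>0$ are fixed penalty weights. The radiative transfer equation is $\varepsilon\partial_t f+v\partial_x f=\frac1\varepsilon(\frac12\int_{-1}^1 f\,\mathrm{d}v'-f)$, $v\in[-1,1]$, with periodic boundary condition $f(t,x_L,v)=f(t,x_R,v)$ and initial condition $f(0,x,v)=f_{\mathrm{IC}}(x,v)$. For $v\in\Omega^+$ set $r=\frac12[f(v)+f(-v)]$, $j=\frac1{2\varepsilon}[f(v)-f(-v)]$, $\rho=\langle r\rangle$, $r=\rho+\varepsilon^2 w$, so that $f=\rho+\varepsilon j+\varepsilon^2 w$ on $\Omega^+$. The multiscale parity decomposition system for $\rho(t,x),j(t,x,v),w(t,x,v)$ is $$\partial_t\rho+\langle v\partial_xj\rangle=0,\quad \varepsilon^2\partial_tj+v\partial_x\rho+\varepsilon^2v\partial_xw+j=0,\quad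 \varepsilon^2\partial_tw+w+v\partial_xj-\langle v\partial_xj\rangle=0,$$ with $\langle w\rangle=0$ and periodicity in $x$. Subscripts $\mathrm{IC}$ and $\mathrm{BC}$ denote the initial data (values at $t=0$) and boundary data (values on $\partial\mathcal{D}$) of the exact solution. Neural network approximations $\rho_\theta(t,x),j_\theta(t,x,v),w_\theta(t,x,v)$ are smooth functions depending on trainable parameters $\theta$; put $f_\theta=\rho_\theta+\varepsilon j_\theta+\varepsilon^2w_\theta$, $d^{(1)}_\theta=\partial_t\rho_\theta+\langle v\partial_xj_\theta\rangle$, $d^{(2)}_\theta=\varepsilon^2\partial_tj_\theta+v\partial_x\rho_\theta+\varepsilon^2v\partial_xw_\theta+j_\theta$, $d^{(3)}_\theta=\varepsilon^2\partial_tw_\theta+w_\theta+v\partial_xj_\theta-\langle v\partial_xj_\theta\rangle$. Then $\mathcal{R}^\varepsilon_{\mathrm{APNN}}=\mathcal{R}^\varepsilon_{\mathrm{residual}}+\mathcal{R}^\varepsilon_{\mathrm{initial}}+\mathcal{R}^\varepsilon_{\mathrm{boundary}}$ with $$\mathcal{R}^\varepsilon_{\mathrm{residual}}=\tfrac{1}{|\mathcal{T}\times\mathcal{D}|}\int_{\mathcal{T}}\int_{\mathcal{D}}|d^{(1)}_\theta|^2\,\mathrm{d}x\mathrm{d}t+\tfrac{1}{|\mathcal{T}\times\mathcal{D}\times\Omega^+|}\int_{\mathcal{T}}\int_{\mathcal{D}}\int_{\Omega^+}(|d^{(2)}_\theta|^2+|d^{(3)}_\theta|^2)\,\mathrm{d}v\mathrm{d}x\mathrm{d}t,$$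 $$\mathcal{R}^\varepsilon_{\mathrm{initial}}=\tfrac{\lambda_1}{|\mathcal{D}|}\int_{\mathcal{D}}|\rho_\theta-\rho_{\mathrm{IC}}|^2\mathrm{d}x+\tfrac{\lambda_2}{|\mathcal{D}\times\Omega^+|}\int_{\mathcal{D}}\int_{\Omega^+}\big(\varepsilon^2|j_\theta-j_{\mathrm{IC}}|^2+\varepsilon^4|w_\theta-w_{\mathrm{IC}}|^2\big)\mathrm{d}v\mathrm{d}x\quad(\text{at }t=0),$$ $$\mathcal{R}^\varepsilon_{\mathrm{boundary}}=\tfrac{\lambda_3}{|\mathcal{T}\times\partial\mathcal{D}|}\int_{\mathcal{T}}\int_{\partial\mathcal{D}}|\rho_\theta-\rho_{\mathrm{BC}}|^2\mathrm{d}s\mathrm{d}t+\tfrac{\lambda_4}{|\mathcal{T}\times\partial\mathcal{D}\times\Omega^+|}\int_{\mathcal{T}}\int_{\partial\mathcal{D}}\int_{\Omega^+}\big(|w_\theta-w_{\mathrm{BC}}|^2+|j_\theta-j_{\mathrm{BC}}|^2\big)\mathrm{d}v\mathrm{d}s\mathrm{d}t,$$ where $\mathrm{d}s$ on $\partial\mathcal{D}=\{x_L,x_R\}$ is counting measure. The total error is $\mathcal{R}^\varepsilon_{\mathrm{total}}=\|f-f_\theta\|^2_{L^2(\mathcal{T}\times\mathcal{D}\times\Omega^+)}$. The exact solution and the networks may depend on $\varepsilon$. *)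

theory Defs
  imports "HOL-Analysis.Analysis"
begin

section \<open>Smooth functions and the Sobolev space \<open>H\<^sup>1\<close>\<close>

definition partial_deriv :: "'a::euclidean_space \<Rightarrow> ('a \<Rightarrow> real) \<Rightarrow> 'a \<Rightarrow> real" where
  "partial_deriv b u z = frechet_derivative u (at z) b"

primrec Ck :: "nat \<Rightarrow> ('a::euclidean_space \<Rightarrow> real) \<Rightarrow> bool" where
  "Ck 0 u \<longleftrightarrow> continuous_on UNIV u"
| "Ck (Suc k) u \<longleftrightarrow> (\<forall>z. u differentiable (at z)) \<and> (\<forall>b\<in>Basis. Ck k (partial_deriv b u))"

definition smooth :: "('a::euclidean_space \<Rightarrow> real) \<Rightarrow> bool" where
  "smooth u \<longleftrightarrow> (\<forall>k. Ck k u)"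

definition test_function :: "'a::euclidean_space set \<Rightarrow> ('a \<Rightarrow> real) \<Rightarrow> bool" where
  "test_function U \<phi> \<longleftrightarrow>
     smooth \<phi> \<and> compact (closure {z. \<phi> z \<noteq> 0}) \<and> closure {z. \<phi> z \<noteq> 0} \<subseteq> U"

text \<open>
  Elements of \<open>L\<^sup>2(U)\<close> are represented by functions whose restriction to \<open>U\<close> is Borel
  measurable; every class contains one. Values outside \<open>U\<close> are irrelevant.
\<close>

definition L2 :: "'a::euclidean_space set \<Rightarrow> ('a \<Rightarrow> real) set" where
  "L2 U = {u. set_borel_measurable lborel U u \<and> set_integrable lborel U (\<lambda>z. (u z)\<^sup>2)}"

text \<open>The nonnegative integral makes a difference outside \<open>L\<^sup>2(U)\<close> have infinite distance.\<close>

definition L2_tendsto ::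
    "'a::euclidean_space set \<Rightarrow> (nat \<Rightarrow> 'a \<Rightarrow> real) \<Rightarrow> ('a \<Rightarrow> real) \<Rightarrow> bool" where
  "L2_tendsto U us u \<longleftrightarrow>
     (\<lambda>n. \<integral>\<^sup>+z\<in>U. ennreal ((us n z - u z)\<^sup>2) \<partial>lborel) \<longlonglongrightarrow> 0"

definition locally_integrable :: "'a::euclidean_space set \<Rightarrow> ('a \<Rightarrow> real) \<Rightarrow> bool" where
  "locally_integrable U u \<longleftrightarrow> (\<forall>K. compact K \<and> K \<subseteq> U \<longrightarrow> set_integrable lborel K u)"

definition has_weak_partial ::
    "'a::euclidean_space set \<Rightarrow> 'a \<Rightarrow> ('a \<Rightarrow> real) \<Rightarrow> ('a \<Rightarrow> real) \<Rightarrow> bool" where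
  "has_weak_partial U b u g \<longleftrightarrow>
     locally_integrable U u \<and> locally_integrable U g \<and>
     (\<forall>\<phi>. test_function U \<phi> \<longrightarrow>
        (LINT z:U|lborel. u z * partial_deriv b \<phi> z) = - (LINT z:U|lborel. g z * \<phi> z))"

text \<open>Weak derivatives are unique only almost everywhere; a representative is chosen.\<close>

definition weak_partial ::
    "'a::euclidean_space set \<Rightarrow> 'a \<Rightarrow> ('a \<Rightarrow> real) \<Rightarrow> 'a \<Rightarrow> real" where
  "weak_partial U b u = (SOME g. has_weak_partial U b u g)"

definition H1 :: "'a::euclidean_space set \<Rightarrow> ('a \<Rightarrow> real) set" where
  "H1 U = {u. u \<in> L2 U \<and>
     (\<forall>b\<in>Basis. has_weak_partial U b u (weak_partial U b u) \<and> weak_partial U b u \<in> L2 U)}"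

text \<open>
  \<open>has_trace U u P \<sigma> g\<close>: the trace of \<open>u \<in> H\<^sup>1(U)\<close> on the flat boundary piece \<open>\<sigma> ` P\<close>, pulled
  back by the isometric parametrization \<open>\<sigma>\<close>, is \<open>g \<in> L\<^sup>2(P)\<close>. This is the usual extension by
  density of the restriction map from functions smooth up to the boundary. On the boxes used
  below, such functions are restrictions of smooth functions on the whole space, they are dense
  in \<open>H\<^sup>1(U)\<close>, and the trace exists and is unique almost everywhere.
\<close>

definition has_trace ::
    "'a::euclidean_space set \<Rightarrow> ('a \<Rightarrow> real) \<Rightarrow>
     'p::euclidean_space set \<Rightarrow> ('p \<Rightarrow> 'a) \<Rightarrow> ('p \<Rightarrow> real) \<Rightarrow> bool" where
  "has_trace U u P \<sigma> g \<longleftrightarrow> g \<in> L2 P \<and>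
     (\<exists>us. (\<forall>n. smooth (us n)) \<and> L2_tendsto U us u \<and>
           (\<forall>b\<in>Basis. L2_tendsto U (\<lambda>n. partial_deriv b (us n)) (weak_partial U b u)) \<and>
           L2_tendsto P (\<lambda>n p. us n (\<sigma> p)) g)"

section \<open>The parity decomposition system\<close>

definition avg :: "(real \<Rightarrow> real) \<Rightarrow> real" where
  "avg g = (LINT v:{0..1}|lborel. g v)"

abbreviation TD :: "real \<Rightarrow> real \<Rightarrow> real \<Rightarrow> (real \<times> real) set" where
  "TD T xL xR \<equiv> {0<..<T} \<times> {xL<..<xR}"

text \<open>Sobolev functions live on the interior of the phase space, a set of full measure in it.\<close>

abbreviation TDV :: "real \<Rightarrow> real \<Rightarrow> real \<Rightarrow> (real \<times> real \<times> real) set" where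
  "TDV T xL xR \<equiv> {0<..<T} \<times> {xL<..<xR} \<times> {0<..<1}"

text \<open>The coordinates are \<open>(t, x)\<close> for \<open>\<rho>\<close> and \<open>(t, x, v)\<close> for \<open>j\<close> and \<open>w\<close>.\<close>

definition solves_parity_system ::
    "real \<Rightarrow> real \<Rightarrow> real \<Rightarrow> real \<Rightarrow> (real \<times> real \<Rightarrow> real) \<Rightarrow>
     (real \<times> real \<times> real \<Rightarrow> real) \<Rightarrow> (real \<times> real \<times> real \<Rightarrow> real) \<Rightarrow> bool" where
  "solves_parity_system T xL xR \<epsilon> \<rho> j w \<longleftrightarrow>
     \<rho> \<in> H1 (TD T xL xR) \<and> j \<in> H1 (TDV T xL xR) \<and> w \<in> H1 (TDV T xL xR) \<and>
     (let \<rho>\<^sub>t = weak_partial (TD T xL xR) (1,0) \<rho>;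
          \<rho>\<^sub>x = weak_partial (TD T xL xR) (0,1) \<rho>;
          j\<^sub>t = weak_partial (TDV T xL xR) (1,0,0) j;
          j\<^sub>x = weak_partial (TDV T xL xR) (0,1,0) j;
          w\<^sub>t = weak_partial (TDV T xL xR) (1,0,0) w;
          w\<^sub>x = weak_partial (TDV T xL xR) (0,1,0) w
      in (AE (t,x) in lborel. (t,x) \<in> TD T xL xR \<longrightarrow>
            \<rho>\<^sub>t (t,x) + avg (\<lambda>v. v * j\<^sub>x (t,x,v)) = 0) \<and>
         (AE (t,x,v) in lborel. (t,x,v) \<in> TDV T xL xR \<longrightarrow>
            \<epsilon>\<^sup>2 * j\<^sub>t (t,x,v) + v * \<rho>\<^sub>x (t,x) + \<epsilon>\<^sup>2 * v * w\<^sub>x (t,x,v) + j (t,x,v) = 0) \<and>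
         (AE (t,x,v) in lborel. (t,x,v) \<in> TDV T xL xR \<longrightarrow>
            \<epsilon>\<^sup>2 * w\<^sub>t (t,x,v) + w (t,x,v) + v * j\<^sub>x (t,x,v)
              - avg (\<lambda>v'. v' * j\<^sub>x (t,x,v')) = 0)) \<and>
     (AE (t,x) in lborel. (t,x) \<in> TD T xL xR \<longrightarrow> avg (\<lambda>v. w (t,x,v)) = 0)"

definition has_initial_data ::
    "real \<Rightarrow> real \<Rightarrow> real \<Rightarrow>
     (real \<times> real \<Rightarrow> real) \<Rightarrow> (real \<times> real \<times> real \<Rightarrow> real) \<Rightarrow> (real \<times> real \<times> real \<Rightarrow> real) \<Rightarrow>
     (real \<Rightarrow> real) \<Rightarrow> (real \<times> real \<Rightarrow> real) \<Rightarrow> (real \<times> real \<Rightarrow> real) \<Rightarrow> bool" where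
  "has_initial_data T xL xR \<rho> j w \<rho>IC jIC wIC \<longleftrightarrow>
     has_trace (TD T xL xR) \<rho> {xL<..<xR} (\<lambda>x. (0,x)) \<rho>IC \<and>
     has_trace (TDV T xL xR) j ({xL<..<xR} \<times> {0<..<1}) (\<lambda>(x,v). (0,x,v)) jIC \<and>
     has_trace (TDV T xL xR) w ({xL<..<xR} \<times> {0<..<1}) (\<lambda>(x,v). (0,x,v)) wIC"

text \<open>Boundary data have coordinates \<open>(t, x)\<close> and \<open>(t, x, v)\<close> with \<open>x \<in> {xL, xR}\<close>.\<close>

definition has_boundary_data ::
    "real \<Rightarrow> real \<Rightarrow> real \<Rightarrow>
     (real \<times> real \<Rightarrow> real) \<Rightarrow> (real \<times> real \<times> real \<Rightarrow> real) \<Rightarrow> (real \<times> real \<times> real \<Rightarrow> real) \<Rightarrow>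
     (real \<times> real \<Rightarrow> real) \<Rightarrow> (real \<times> real \<times> real \<Rightarrow> real) \<Rightarrow> (real \<times> real \<times> real \<Rightarrow> real) \<Rightarrow>
     bool" where
  "has_boundary_data T xL xR \<rho> j w \<rho>BC jBC wBC \<longleftrightarrow>
     (\<forall>x\<in>{xL,xR}.
        has_trace (TD T xL xR) \<rho> {0<..<T} (\<lambda>t. (t,x)) (\<lambda>t. \<rho>BC (t,x)) \<and>
        has_trace (TDV T xL xR) j ({0<..<T} \<times> {0<..<1}) (\<lambda>(t,v). (t,x,v)) (\<lambda>(t,v). jBC (t,x,v)) \<and>
        has_trace (TDV T xL xR) w ({0<..<T} \<times> {0<..<1}) (\<lambda>(t,v). (t,x,v)) (\<lambda>(t,v). wBC (t,x,v)))"

definition periodic_boundary_data ::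
    "real \<Rightarrow> real \<Rightarrow> real \<Rightarrow>
     (real \<times> real \<Rightarrow> real) \<Rightarrow> (real \<times> real \<times> real \<Rightarrow> real) \<Rightarrow> (real \<times> real \<times> real \<Rightarrow> real) \<Rightarrow>
     bool" where
  "periodic_boundary_data T xL xR \<rho>BC jBC wBC \<longleftrightarrow>
     (AE t in lborel. t \<in> {0<..<T} \<longrightarrow> \<rho>BC (t,xL) = \<rho>BC (t,xR)) \<and>
     (AE (t,v) in lborel. (t,v) \<in> {0<..<T} \<times> {0<..<1} \<longrightarrow>
        jBC (t,xL,v) = jBC (t,xR,v) \<and> wBC (t,xL,v) = wBC (t,xR,v))"

section \<open>The loss and the total error\<close>

definition d1 :: "(real \<times> real \<Rightarrow> real) \<Rightarrow> (real \<times> real \<times> real \<Rightarrow> real) \<Rightarrow> real \<Rightarrow> real \<Rightarrow> real" where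
  "d1 \<rho> j t x = partial_deriv (1,0) \<rho> (t,x) + avg (\<lambda>v. v * partial_deriv (0,1,0) j (t,x,v))"

definition d2 ::
    "real \<Rightarrow> (real \<times> real \<Rightarrow> real) \<Rightarrow> (real \<times> real \<times> real \<Rightarrow> real) \<Rightarrow>
     (real \<times> real \<times> real \<Rightarrow> real) \<Rightarrow> real \<Rightarrow> real \<Rightarrow> real \<Rightarrow> real" where
  "d2 \<epsilon> \<rho> j w t x v =
     \<epsilon>\<^sup>2 * partial_deriv (1,0,0) j (t,x,v) + v * partial_deriv (0,1) \<rho> (t,x)
     + \<epsilon>\<^sup>2 * v * partial_deriv (0,1,0) w (t,x,v) + j (t,x,v)"

definition d3 ::
    "real \<Rightarrow> (real \<times> real \<times> real \<Rightarrow> real) \<Rightarrow> (real \<times> real \<times> real \<Rightarrow> real) \<Rightarrow>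
     real \<Rightarrow> real \<Rightarrow> real \<Rightarrow> real" where
  "d3 \<epsilon> j w t x v =
     \<epsilon>\<^sup>2 * partial_deriv (1,0,0) w (t,x,v) + w (t,x,v) + v * partial_deriv (0,1,0) j (t,x,v)
     - avg (\<lambda>v'. v' * partial_deriv (0,1,0) j (t,x,v'))"

definition R_residual ::
    "real \<Rightarrow> real \<Rightarrow> real \<Rightarrow> real \<Rightarrow> (real \<times> real \<Rightarrow> real) \<Rightarrow>
     (real \<times> real \<times> real \<Rightarrow> real) \<Rightarrow> (real \<times> real \<times> real \<Rightarrow> real) \<Rightarrow> real" where
  "R_residual T xL xR \<epsilon> \<rho> j w =
     1 / measure lborel ({0<..<T} \<times> {xL<..<xR}) *
       (LINT t:{0<..<T}|lborel. LINT x:{xL<..<xR}|lborel. \<bar>d1 \<rho> j t x\<bar>\<^sup>2)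
     + 1 / measure lborel ({0<..<T} \<times> {xL<..<xR} \<times> {0..1::real}) *
       (LINT t:{0<..<T}|lborel. LINT x:{xL<..<xR}|lborel. LINT v:{0..1}|lborel.
          (\<bar>d2 \<epsilon> \<rho> j w t x v\<bar>\<^sup>2 + \<bar>d3 \<epsilon> j w t x v\<bar>\<^sup>2))"

definition R_initial ::
    "real \<Rightarrow> real \<Rightarrow> real \<Rightarrow> real \<Rightarrow> real \<Rightarrow>
     (real \<Rightarrow> real) \<Rightarrow> (real \<times> real \<Rightarrow> real) \<Rightarrow> (real \<times> real \<Rightarrow> real) \<Rightarrow>
     (real \<times> real \<Rightarrow> real) \<Rightarrow> (real \<times> real \<times> real \<Rightarrow> real) \<Rightarrow> (real \<times> real \<times> real \<Rightarrow> real) \<Rightarrow>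
     real" where
  "R_initial xL xR lam1 lam2 \<epsilon> \<rho>IC jIC wIC \<rho> j w =
     lam1 / measure lborel {xL<..<xR} *
       (LINT x:{xL<..<xR}|lborel. \<bar>\<rho> (0,x) - \<rho>IC x\<bar>\<^sup>2)
     + lam2 / measure lborel ({xL<..<xR} \<times> {0..1::real}) *
       (LINT x:{xL<..<xR}|lborel. LINT v:{0..1}|lborel.
          (\<epsilon>^2 * \<bar>j (0,x,v) - jIC (x,v)\<bar>\<^sup>2 + \<epsilon>^4 * \<bar>w (0,x,v) - wIC (x,v)\<bar>\<^sup>2))"

text \<open>The two-point boundary carries counting measure: integrals over it are sums.\<close>

definition R_boundary ::
    "real \<Rightarrow> real \<Rightarrow> real \<Rightarrow> real \<Rightarrow> real \<Rightarrow>
     (real \<times> real \<Rightarrow> real) \<Rightarrow> (real \<times> real \<times> real \<Rightarrow> real) \<Rightarrow> (real \<times> real \<times> real \<Rightarrow> real) \<Rightarrow>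
     (real \<times> real \<Rightarrow> real) \<Rightarrow> (real \<times> real \<times> real \<Rightarrow> real) \<Rightarrow> (real \<times> real \<times> real \<Rightarrow> real) \<Rightarrow>
     real" where
  "R_boundary T xL xR lam3 lam4 \<rho>BC jBC wBC \<rho> j w =
     lam3 / (measure lborel {0<..<T} * real (card {xL,xR})) *
       (LINT t:{0<..<T}|lborel. \<Sum>x\<in>{xL,xR}. \<bar>\<rho> (t,x) - \<rho>BC (t,x)\<bar>\<^sup>2)
     + lam4 / (measure lborel {0<..<T} * real (card {xL,xR}) * measure lborel {0..1::real}) *
       (LINT t:{0<..<T}|lborel. \<Sum>x\<in>{xL,xR}. LINT v:{0..1}|lborel.
          (\<bar>w (t,x,v) - wBC (t,x,v)\<bar>\<^sup>2 + \<bar>j (t,x,v) - jBC (t,x,v)\<bar>\<^sup>2))"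

definition R_APNN ::
    "real \<Rightarrow> real \<Rightarrow> real \<Rightarrow> real \<Rightarrow> real \<Rightarrow> real \<Rightarrow> real \<Rightarrow> real \<Rightarrow>
     (real \<Rightarrow> real) \<Rightarrow> (real \<times> real \<Rightarrow> real) \<Rightarrow> (real \<times> real \<Rightarrow> real) \<Rightarrow>
     (real \<times> real \<Rightarrow> real) \<Rightarrow> (real \<times> real \<times> real \<Rightarrow> real) \<Rightarrow> (real \<times> real \<times> real \<Rightarrow> real) \<Rightarrow>
     (real \<times> real \<Rightarrow> real) \<Rightarrow> (real \<times> real \<times> real \<Rightarrow> real) \<Rightarrow> (real \<times> real \<times> real \<Rightarrow> real) \<Rightarrow>
     real" where
  "R_APNN T xL xR lam1 lam2 lam3 lam4 \<epsilon> \<rho>IC jIC wIC \<rho>BC jBC wBC \<rho> j w =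
     R_residual T xL xR \<epsilon> \<rho> j w
     + R_initial xL xR lam1 lam2 \<epsilon> \<rho>IC jIC wIC \<rho> j w
     + R_boundary T xL xR lam3 lam4 \<rho>BC jBC wBC \<rho> j w"

definition kinetic_density ::
    "real \<Rightarrow> (real \<times> real \<Rightarrow> real) \<Rightarrow> (real \<times> real \<times> real \<Rightarrow> real) \<Rightarrow>
     (real \<times> real \<times> real \<Rightarrow> real) \<Rightarrow> real \<Rightarrow> real \<Rightarrow> real \<Rightarrow> real" where
  "kinetic_density \<epsilon> \<rho> j w t x v = \<rho> (t,x) + \<epsilon> * j (t,x,v) + \<epsilon>\<^sup>2 * w (t,x,v)"

definition R_total ::
    "real \<Rightarrow> real \<Rightarrow> real \<Rightarrow> real \<Rightarrow>
     (real \<times> real \<Rightarrow> real) \<Rightarrow> (real \<times> real \<times> real \<Rightarrow> real) \<Rightarrow> (real \<times> real \<times> real \<Rightarrow> real) \<Rightarrow>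
     (real \<times> real \<Rightarrow> real) \<Rightarrow> (real \<times> real \<times> real \<Rightarrow> real) \<Rightarrow> (real \<times> real \<times> real \<Rightarrow> real) \<Rightarrow>
     real" where
  "R_total T xL xR \<epsilon> \<rho> j w \<rho>\<theta> j\<theta> w\<theta> =
     (LINT t:{0<..<T}|lborel. LINT x:{xL<..<xR}|lborel. LINT v:{0..1}|lborel.
        \<bar>kinetic_density \<epsilon> \<rho> j w t x v - kinetic_density \<epsilon> \<rho>\<theta> j\<theta> w\<theta> t x v\<bar>\<^sup>2)"

end

theory Submission
  imports Defs
begin

text \<open>
  Let \<open>R\<close>, \<open>J\<close>, \<open>W\<close> be the errors of \<open>\<rho>\<close>, \<open>j\<close>, \<open>w\<close> and \<open>S = R + \<epsilon>\<^sup>2 W\<close>, so that \<open>f - f\<theta> = S + \<epsilon> J\<close>.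
  Adding the first and third residual equations removes the averages and leaves the pair
  \<open>S\<^sub>t + v J\<^sub>x + W = - (d\<^sub>1 + d\<^sub>3)\<close>, \<open>\<epsilon>\<^sup>2 J\<^sub>t + v S\<^sub>x + J = - d\<^sub>2\<close>, to which the energy method applies. Since
  \<open>avg (W S) \<ge> avg W * avg S\<close>, the only term without a sign comes from \<open>avg W = - avg w\<theta>\<close>, which solves
  the relaxation equation \<open>\<epsilon>\<^sup>2 a' + a = avg d\<^sub>3\<close> for \<open>a = avg w\<theta>\<close>. The initial loss controls only
  \<open>\<epsilon>\<^sup>2 a(0)\<close>, so \<open>a\<close> may be of size \<open>1/\<epsilon>\<^sup>2\<close> on an initial layer of width \<open>\<epsilon>\<^sup>2\<close>; a time weight that
  vanishes at \<open>T\<close> and decays fast enough on this layer absorbs it and replaces Gronwall's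
  inequality as well as the missing trace at \<open>t = T\<close>. The boundary fluxes are bounded by the boundary
  loss on each side separately.
\<close>

section \<open>Square integrable functions\<close>

text \<open>\<open>S\<close> is the error of the even part of \<open>f\<close>, so passing to it
  undoes the splitting into \<open>\<rho>\<close> and \<open>w\<close>. The dangerous product is
  then \<open>a * S\<close>. With e = \<open>\<epsilon>^2\<close>, free relaxation a(0)
  \<open>exp (- t / e)\<close> has a squared time integral of about e a(0)^2 / 2, while the initial
  loss controls only e^2 a(0)^2: one power of e is missing. Young's inequality is therefore used
  with the time-dependent ratio m(t) = 1 + \<open>exp (- t / e) / e\<close>. It leaves a^2 / m, of
  order e a^2 on the layer, which restores the missing power, and it costs m S^2. The weight can pay
  this cost because m has time integral below T + 1 for every e; this is also the origin of the
  constant \<open>exp (- 2 * T - 1)\<close>.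

  A second obstacle is that \<open>has_trace\<close> gives each face its own approximating sequence,
  so no single sequence is known to converge on two opposite faces. Green's formula is therefore
  used only with weights that vanish on the opposite face; in x the weight is split into two such
  pieces.\<close>

abbreviation lborel_on :: "'a::euclidean_space set \<Rightarrow> 'a measure" where
  "lborel_on U \<equiv> restrict_space lborel U"

definition square_integrable :: "'a measure \<Rightarrow> ('a \<Rightarrow> real) \<Rightarrow> bool" where
  "square_integrable M u \<longleftrightarrow> u \<in> borel_measurable M \<and> integrable M (\<lambda>z. (u z)\<^sup>2)"

text \<open>Square integrability is part of the notion because the Bochner integral of a
  non-integrable square is 0, which would make the convergence vacuous.\<close>

definition L2lim :: "'a measure \<Rightarrow> (nat \<Rightarrow> 'a \<Rightarrow> real) \<Rightarrow> ('a \<Rightarrow> real) \<Rightarrow> bool" where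
  "L2lim M us u \<longleftrightarrow> square_integrable M u \<and> (\<forall>n. square_integrable M (us n)) \<and>
     (\<lambda>n. \<integral>z. (us n z - u z)\<^sup>2 \<partial>M) \<longlonglongrightarrow> 0"

lemma square_integrable_measurable [measurable_dest]:
  "square_integrable M u \<Longrightarrow> u \<in> borel_measurable M"
  by (simp add: square_integrable_def)

lemma square_integrable_power2: "square_integrable M u \<Longrightarrow> integrable M (\<lambda>z. (u z)\<^sup>2)"
  by (simp add: square_integrable_def)

lemma square_integrable_mult:
  assumes u: "square_integrable M u" and z: "square_integrable M z"
  shows "integrable M (\<lambda>x. u x * z x)"
proof (rule Bochner_Integration.integrable_bound)
  show "integrable M (\<lambda>x. (u x)\<^sup>2 + (z x)\<^sup>2)"
    using assms by (simp add: square_integrable_def)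
  show "(\<lambda>x. u x * z x) \<in> borel_measurable M"
    using assms by measurable
  have "\<bar>a * b\<bar> \<le> a\<^sup>2 + b\<^sup>2" for a b :: real
    using sum_squares_bound[of "\<bar>a\<bar>" "\<bar>b\<bar>"] zero_le_power2[of a] zero_le_power2[of b]
    unfolding abs_mult power2_abs by linarith
  then show "AE x in M. norm (u x * z x) \<le> norm ((u x)\<^sup>2 + (z x)\<^sup>2)"
    by simp
qed

lemma square_integrable_cmult:
  "square_integrable M u \<Longrightarrow> square_integrable M (\<lambda>x. c * u x)"
  by (auto simp: square_integrable_def power_mult_distrib)

lemma square_integrable_add:
  assumes "square_integrable M u" "square_integrable M z"
  shows "square_integrable M (\<lambda>x. u x + z x)"
  using assms square_integrable_mult[OF assms]
  by (auto simp: square_integrable_def power2_sum mult.assoc)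

lemma square_integrable_diff:
  assumes "square_integrable M u" "square_integrable M z"
  shows "square_integrable M (\<lambda>x. u x - z x)"
  using square_integrable_add[OF assms(1) square_integrable_cmult[OF assms(2), of "-1"]] by simp

lemma square_integrable_bounded_mult:
  assumes u: "square_integrable M u" and \<phi>[measurable]: "\<phi> \<in> borel_measurable M"
    and K: "\<And>x. x \<in> space M \<Longrightarrow> \<bar>\<phi> x\<bar> \<le> K"
  shows "square_integrable M (\<lambda>x. \<phi> x * u x)"
  unfolding square_integrable_def
proof
  show "(\<lambda>x. \<phi> x * u x) \<in> borel_measurable M"
    using u by measurable
  show "integrable M (\<lambda>x. (\<phi> x * u x)\<^sup>2)"
  proof (rule Bochner_Integration.integrable_bound)
    show "integrable M (\<lambda>x. K\<^sup>2 * (u x)\<^sup>2)"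
      using u by (simp add: square_integrable_def)
    show "(\<lambda>x. (\<phi> x * u x)\<^sup>2) \<in> borel_measurable M"
      using u by measurable
    show "AE x in M. norm ((\<phi> x * u x)\<^sup>2) \<le> norm (K\<^sup>2 * (u x)\<^sup>2)"
    proof (rule AE_I2)
      fix x assume "x \<in> space M"
      then have "(\<phi> x)\<^sup>2 \<le> K\<^sup>2"
        using K[of x] by (metis abs_ge_zero power2_abs power_mono)
      then show "norm ((\<phi> x * u x)\<^sup>2) \<le> norm (K\<^sup>2 * (u x)\<^sup>2)"
        by (simp add: power_mult_distrib mult_right_mono)
    qed
  qed
qed

lemma Cauchy_Schwarz_integral:
  assumes u: "square_integrable M u" and z: "square_integrable M z"
  shows "\<bar>\<integral>x. u x * z x \<partial>M\<bar> \<le> sqrt (\<integral>x. (u x)\<^sup>2 \<partial>M) * sqrt (\<integral>x. (z x)\<^sup>2 \<partial>M)"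
proof -
  define A B C where "A = (\<integral>x. (u x)\<^sup>2 \<partial>M)" and "B = (\<integral>x. (z x)\<^sup>2 \<partial>M)"
    and "C = (\<integral>x. u x * z x \<partial>M)"
  note int = square_integrable_power2[OF u] square_integrable_power2[OF z] square_integrable_mult[OF u z]
  have A: "0 \<le> A" and B: "0 \<le> B" by (simp_all add: A_def B_def)
  have "C\<^sup>2 \<le> A * B"
  proof (cases "B = 0")
    case True
    then have "AE x in M. (z x)\<^sup>2 = 0"
      using integral_nonneg_eq_0_iff_AE[OF int(2)] by (simp add: B_def)
    then have "C = 0"
      unfolding C_def by (intro integral_eq_zero_AE) auto
    then show ?thesis using A B by simp
  next
    case False
    have "0 \<le> (\<integral>x. (B * u x - C * z x)\<^sup>2 \<partial>M)" by simp
    also have "\<dots> = (\<integral>x. B\<^sup>2 * (u x)\<^sup>2 - 2 * B * C * (u x * z x) + C\<^sup>2 * (z x)\<^sup>2 \<partial>M)"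
      by (simp add: power2_diff power_mult_distrib algebra_simps)
    also have "\<dots> = B\<^sup>2 * A - 2 * B * C * C + C\<^sup>2 * B"
      using int by (simp add: A_def B_def C_def)
    also have "\<dots> = B * (A * B - C\<^sup>2)" by (simp add: power2_eq_square algebra_simps)
    finally show ?thesis using B False by (simp add: zero_le_mult_iff)
  qed
  then have "sqrt (C\<^sup>2) \<le> sqrt (A * B)" by (rule real_sqrt_le_mono)
  then show ?thesis by (simp add: A_def B_def C_def real_sqrt_mult)
qed

lemma L2lim_const: "square_integrable M u \<Longrightarrow> L2lim M (\<lambda>_. u) u"
  by (simp add: L2lim_def)

lemma L2lim_cmult: "L2lim M us u \<Longrightarrow> L2lim M (\<lambda>n x. c * us n x) (\<lambda>x. c * u x)"
  unfolding L2lim_def right_diff_distrib[symmetric] power_mult_distrib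
  by (auto intro: square_integrable_cmult tendsto_mult_right_zero)

lemma integral_power2_add_le:
  assumes u: "square_integrable M u" and z: "square_integrable M z"
  shows "(\<integral>x. (u x + z x)\<^sup>2 \<partial>M) \<le> 2 * (\<integral>x. (u x)\<^sup>2 \<partial>M) + 2 * (\<integral>x. (z x)\<^sup>2 \<partial>M)"
proof -
  have "(\<integral>x. (u x + z x)\<^sup>2 \<partial>M) \<le> (\<integral>x. 2 * (u x)\<^sup>2 + 2 * (z x)\<^sup>2 \<partial>M)"
  proof (rule integral_mono)
    show "integrable M (\<lambda>x. (u x + z x)\<^sup>2)"
      by (intro square_integrable_power2 square_integrable_add u z)
    show "integrable M (\<lambda>x. 2 * (u x)\<^sup>2 + 2 * (z x)\<^sup>2)"
      using u z by (simp add: square_integrable_def)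
    show "(u x + z x)\<^sup>2 \<le> 2 * (u x)\<^sup>2 + 2 * (z x)\<^sup>2" for x
      using sum_squares_bound[of "u x" "z x"] by (simp add: power2_sum)
  qed
  also have "\<dots> = 2 * (\<integral>x. (u x)\<^sup>2 \<partial>M) + 2 * (\<integral>x. (z x)\<^sup>2 \<partial>M)"
    using u z by (simp add: square_integrable_def)
  finally show ?thesis .
qed

lemma L2lim_add:
  assumes u: "L2lim M us u" and z: "L2lim M zs z"
  shows "L2lim M (\<lambda>n x. us n x + zs n x) (\<lambda>x. u x + z x)"
proof -
  have "(\<lambda>n. \<integral>x. ((us n x - u x) + (zs n x - z x))\<^sup>2 \<partial>M) \<longlonglongrightarrow> 0"
  proof (rule tendsto_sandwich[where f = "\<lambda>_. 0"])
    show "(\<lambda>n. 2 * (\<integral>x. (us n x - u x)\<^sup>2 \<partial>M) + 2 * (\<integral>x. (zs n x - z x)\<^sup>2 \<partial>M)) \<longlonglongrightarrow> 0"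
      using u z unfolding L2lim_def by (auto intro!: tendsto_eq_intros)
    show "\<forall>\<^sub>F n in sequentially. (\<integral>x. ((us n x - u x) + (zs n x - z x))\<^sup>2 \<partial>M)
        \<le> 2 * (\<integral>x. (us n x - u x)\<^sup>2 \<partial>M) + 2 * (\<integral>x. (zs n x - z x)\<^sup>2 \<partial>M)"
      using u z unfolding L2lim_def
      by (intro always_eventually allI integral_power2_add_le square_integrable_diff) auto
  qed auto
  then show ?thesis
    using u z by (auto simp: L2lim_def add_diff_add intro: square_integrable_add)
qed

lemma L2lim_bounded_mult:
  assumes u: "L2lim M us u" and \<phi>: "\<phi> \<in> borel_measurable M"
    and K: "\<And>x. x \<in> space M \<Longrightarrow> \<bar>\<phi> x\<bar> \<le> K"
  shows "L2lim M (\<lambda>n x. \<phi> x * us n x) (\<lambda>x. \<phi> x * u x)"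
proof -
  have "(\<lambda>n. \<integral>x. (\<phi> x * us n x - \<phi> x * u x)\<^sup>2 \<partial>M) \<longlonglongrightarrow> 0"
  proof (rule tendsto_sandwich[where f = "\<lambda>_. 0"])
    show "(\<lambda>n. K\<^sup>2 * (\<integral>x. (us n x - u x)\<^sup>2 \<partial>M)) \<longlonglongrightarrow> 0"
      using u unfolding L2lim_def by (auto intro!: tendsto_eq_intros)
    show "\<forall>\<^sub>F n in sequentially. (\<integral>x. (\<phi> x * us n x - \<phi> x * u x)\<^sup>2 \<partial>M)
        \<le> K\<^sup>2 * (\<integral>x. (us n x - u x)\<^sup>2 \<partial>M)"
    proof (intro always_eventually allI)
      fix n
      have a: "square_integrable M (\<lambda>x. us n x - u x)"
        using u by (auto simp: L2lim_def intro: square_integrable_diff)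
      have "(\<integral>x. (\<phi> x * us n x - \<phi> x * u x)\<^sup>2 \<partial>M) = (\<integral>x. (\<phi> x * (us n x - u x))\<^sup>2 \<partial>M)"
        by (simp add: algebra_simps)
      also have "\<dots> \<le> (\<integral>x. K\<^sup>2 * (us n x - u x)\<^sup>2 \<partial>M)"
      proof (rule integral_mono)
        show "integrable M (\<lambda>x. (\<phi> x * (us n x - u x))\<^sup>2)"
          by (intro square_integrable_power2 square_integrable_bounded_mult[OF a \<phi> K])
        show "integrable M (\<lambda>x. K\<^sup>2 * (us n x - u x)\<^sup>2)"
          using a by (simp add: square_integrable_def)
        show "(\<phi> x * (us n x - u x))\<^sup>2 \<le> K\<^sup>2 * (us n x - u x)\<^sup>2" if "x \<in> space M" for x
          using power_mono[OF K[OF that], of 2] by (simp add: power_mult_distrib mult_right_mono)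
      qed
      finally show "(\<integral>x. (\<phi> x * us n x - \<phi> x * u x)\<^sup>2 \<partial>M) \<le> K\<^sup>2 * (\<integral>x. (us n x - u x)\<^sup>2 \<partial>M)"
        by simp
    qed
  qed auto
  then show ?thesis
    using u square_integrable_bounded_mult[OF _ \<phi> K] by (auto simp: L2lim_def)
qed

text \<open>Expanding around the limits leaves three error integrals, each small by Cauchy-Schwarz.
  This is the limit passage behind the product rule, where both factors are approximated at
  once.\<close>

lemma L2lim_integral_mult:
  assumes u: "L2lim M us u" and z: "L2lim M zs z"
  shows "(\<lambda>n. \<integral>x. us n x * zs n x \<partial>M) \<longlonglongrightarrow> (\<integral>x. u x * z x \<partial>M)"
proof -
  define a b where "a = (\<lambda>n x. us n x - u x)" and "b = (\<lambda>n x. zs n x - z x)"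
  have sq: "square_integrable M u" "square_integrable M z" "square_integrable M (a n)"
      "square_integrable M (b n)" for n
    using u z by (auto simp: L2lim_def a_def b_def intro: square_integrable_diff)
  have a0: "(\<lambda>n. sqrt (\<integral>x. (a n x)\<^sup>2 \<partial>M)) \<longlonglongrightarrow> 0" and b0: "(\<lambda>n. sqrt (\<integral>x. (b n x)\<^sup>2 \<partial>M)) \<longlonglongrightarrow> 0"
    using u z tendsto_real_sqrt[of _ 0] by (auto simp: L2lim_def a_def b_def)
  have lim: "(\<lambda>n. \<integral>x. p n x * q n x \<partial>M) \<longlonglongrightarrow> 0"
    if p: "\<And>n. square_integrable M (p n)" and q: "\<And>n. square_integrable M (q n)"
      and "(\<lambda>n. sqrt (\<integral>x. (p n x)\<^sup>2 \<partial>M) * sqrt (\<integral>x. (q n x)\<^sup>2 \<partial>M)) \<longlonglongrightarrow> 0" for p q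
    by (rule Lim_null_comparison[OF _ that(3)]) (simp add: Cauchy_Schwarz_integral[OF p q])
  have "(\<lambda>n. (\<integral>x. a n x * b n x \<partial>M) + (\<integral>x. u x * b n x \<partial>M) + (\<integral>x. a n x * z x \<partial>M) + (\<integral>x. u x * z x \<partial>M))
      \<longlonglongrightarrow> 0 + 0 + 0 + (\<integral>x. u x * z x \<partial>M)"
    using tendsto_mult[OF a0 b0] tendsto_mult[OF tendsto_const b0] tendsto_mult[OF a0 tendsto_const]
    by (intro tendsto_add lim tendsto_const sq) auto
  moreover have "(\<integral>x. us n x * zs n x \<partial>M) =
      (\<integral>x. a n x * b n x \<partial>M) + (\<integral>x. u x * b n x \<partial>M) + (\<integral>x. a n x * z x \<partial>M) + (\<integral>x. u x * z x \<partial>M)" for n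
  proof -
    have "us n x * zs n x = a n x * b n x + u x * b n x + a n x * z x + u x * z x" for x
      by (simp add: a_def b_def algebra_simps)
    moreover have "integrable M (\<lambda>x. a n x * b n x)" "integrable M (\<lambda>x. u x * b n x)"
        "integrable M (\<lambda>x. a n x * z x)" "integrable M (\<lambda>x. u x * z x)"
      by (intro square_integrable_mult sq)+
    ultimately show ?thesis by simp
  qed
  ultimately show ?thesis by simp
qed

section \<open>Lebesgue measure restricted to products, and square integrability there\<close>

lemma restrict_space_pair:
  fixes A :: "'a::euclidean_space set" and C :: "'b::euclidean_space set"
  assumes [measurable]: "A \<in> sets borel" "C \<in> sets borel"
  shows "lborel_on (A \<times> C) = lborel_on A \<Otimes>\<^sub>M lborel_on C"
proof -
  have "A \<times> C \<in> sets (borel \<Otimes>\<^sub>M borel)" by measurable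
  then have AC': "A \<times> C \<in> sets borel" unfolding borel_prod .
  have "lborel_on A \<Otimes>\<^sub>M lborel_on C = lborel_on (A \<times> C)"
  proof (rule pair_measure_eqI)
    show "sigma_finite_measure (lborel_on A)" "sigma_finite_measure (lborel_on C)"
      using assms lborel.sigma_finite_measure_axioms
      by (auto intro!: sigma_finite_measure_restrict_space)
    show "sets (lborel_on A \<Otimes>\<^sub>M lborel_on C) = sets (lborel_on (A \<times> C))"
    proof
      show "sets (lborel_on A \<Otimes>\<^sub>M lborel_on C) \<subseteq> sets (lborel_on (A \<times> C))"
        using AC' by (intro sets_pair_in_sets)
          (auto simp: sets_restrict_space_iff borel_prod[symmetric])
      show "sets (lborel_on (A \<times> C)) \<subseteq> sets (lborel_on A \<Otimes>\<^sub>M lborel_on C)"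
      proof
        fix X assume "X \<in> sets (lborel_on (A \<times> C))"
        then have X: "X \<subseteq> A \<times> C" "X \<in> sets (borel \<Otimes>\<^sub>M borel)"
          using AC' unfolding borel_prod by (auto simp: sets_restrict_space_iff)
        \<comment> \<open>The identity is measurable because its two coordinates are; the preimage
          of \<open>X\<close> under it is \<open>X\<close> itself.\<close>
        have id: "(\<lambda>z. z) \<in> measurable (lborel_on A \<Otimes>\<^sub>M lborel_on C) (borel \<Otimes>\<^sub>M borel)"
          by (subst measurable_pair_iff)
             (auto simp: comp_def intro!: measurable_compose[OF measurable_fst] measurable_compose[OF measurable_snd]
               measurable_restrict_space1)
        from measurable_sets[OF id X(2)] show "X \<in> sets (lborel_on A \<Otimes>\<^sub>M lborel_on C)"
          using X(1) by (simp add: space_pair_measure space_restrict_space Int_absorb2)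
      qed
    qed
    fix a c assume "a \<in> sets (lborel_on A)" "c \<in> sets (lborel_on C)"
    then have *: "a \<subseteq> A" "c \<subseteq> C" "a \<in> sets lborel" "c \<in> sets lborel"
      by (auto simp: sets_restrict_space_iff)
    then have "emeasure lborel (a \<times> c) = emeasure lborel a * emeasure lborel c"
      by (simp add: lborel_prod[symmetric] lborel.emeasure_pair_measure_Times)
    with * show "emeasure (lborel_on A) a * emeasure (lborel_on C) c = emeasure (lborel_on (A \<times> C)) (a \<times> c)"
      using AC' by (subst (1 2 3) emeasure_restrict_space) auto
  qed
  then show ?thesis by simp
qed

lemma set_lebesgue_integral_eq_restrict:
  "U \<in> sets borel \<Longrightarrow> (LINT z:U|lborel. f z) = integral\<^sup>L (lborel_on U) (f :: 'a::euclidean_space \<Rightarrow> real)"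
  by (simp add: integral_restrict_space set_lebesgue_integral_def)

lemma L2_eq_square_integrable:
  "U \<in> sets borel \<Longrightarrow> u \<in> L2 U \<longleftrightarrow> square_integrable (lborel_on U) u"
  by (simp add: L2_def square_integrable_def set_borel_measurable_def set_integrable_def
      integrable_restrict_space borel_measurable_restrict_space_iff)

text \<open>With both functions square integrable, the nonnegative integral in
  \<open>L2_tendsto\<close> is finite and equals the Bochner integral.\<close>

lemma L2lim_of_L2_tendsto:
  assumes U: "U \<in> sets borel" and "L2_tendsto U us u" and "square_integrable (lborel_on U) u"
    and "\<And>n. square_integrable (lborel_on U) (us n)"
  shows "L2lim (lborel_on U) us u"
proof -
  have "(\<integral>\<^sup>+z\<in>U. ennreal ((us n z - u z)\<^sup>2) \<partial>lborel) = ennreal (\<integral>z. (us n z - u z)\<^sup>2 \<partial>lborel_on U)" for n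
  proof -
    have "(\<integral>\<^sup>+z\<in>U. ennreal ((us n z - u z)\<^sup>2) \<partial>lborel) = (\<integral>\<^sup>+z. ennreal ((us n z - u z)\<^sup>2) \<partial>lborel_on U)"
      using U by (simp add: nn_integral_restrict_space)
    also have "\<dots> = ennreal (\<integral>z. (us n z - u z)\<^sup>2 \<partial>lborel_on U)"
      using assms by (intro nn_integral_eq_integral square_integrable_power2 square_integrable_diff) auto
    finally show ?thesis .
  qed
  then have "(\<lambda>n. ennreal (\<integral>z. (us n z - u z)\<^sup>2 \<partial>lborel_on U)) \<longlonglongrightarrow> ennreal 0"
    using assms(2) by (simp add: L2_tendsto_def)
  then show ?thesis
    using assms by (auto simp: L2lim_def intro: tendsto_ennrealD)
qed

lemma square_integrable_continuous:
  fixes u :: "'a::euclidean_space \<Rightarrow> real"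
  assumes U: "U \<in> sets borel" "bounded U" and u: "continuous_on UNIV u"
  shows "square_integrable (lborel_on U) u"
    and "u \<in> borel_measurable (lborel_on U)" and "integrable (lborel_on U) u"
    and "\<exists>K. \<forall>x\<in>U. \<bar>u x\<bar> \<le> K"
proof -
  show m: "u \<in> borel_measurable (lborel_on U)"
    using borel_measurable_continuous_onI[OF u] by (auto intro: measurable_restrict_space1)
  have "compact (closure U)" using U by simp
  then have "compact (u ` closure U)"
    using u by (intro compact_continuous_image) (auto intro: continuous_on_subset)
  then have "bounded (u ` closure U)" by (rule compact_imp_bounded)
  then have "bounded (u ` U)"
    by (rule bounded_subset) (simp add: closure_subset image_mono)
  then obtain K where K: "\<And>x. x \<in> U \<Longrightarrow> \<bar>u x\<bar> \<le> K"
    by (auto simp: bounded_iff)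
  then show "\<exists>K. \<forall>x\<in>U. \<bar>u x\<bar> \<le> K" by blast
  have "emeasure (lborel_on U) (space (lborel_on U)) \<noteq> \<infinity>"
    using U emeasure_bounded_finite[OF U(2)] by (simp add: emeasure_restrict_space space_restrict_space)
  then interpret finite_measure "lborel_on U" by (rule finite_measureI)
  have b: "integrable (lborel_on U) f" if "f \<in> borel_measurable (lborel_on U)" "\<And>x. x \<in> U \<Longrightarrow> \<bar>f x\<bar> \<le> c"
    for f :: "'a \<Rightarrow> real" and c
    using that by (intro integrable_const_bound[of f c]) (auto simp: space_restrict_space)
  show "integrable (lborel_on U) u" using b[OF m K] .
  have "\<bar>(u x)\<^sup>2\<bar> \<le> K\<^sup>2" if "x \<in> U" for x
    using K[OF that] by (metis abs_ge_zero abs_power2 power2_abs power_mono)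
  then show "square_integrable (lborel_on U) u"
    unfolding square_integrable_def using m by (intro conjI b[of _ "K\<^sup>2"]) auto
qed

section \<open>One-sided traces and the product rule\<close>

text \<open>Differentiability in one direction only: the class then contains time weights,
  pull-backs of functions of (t, x), and velocity averages, and it is closed under products.\<close>

definition C1_along :: "'a::euclidean_space \<Rightarrow> ('a \<Rightarrow> real) \<Rightarrow> ('a \<Rightarrow> real) \<Rightarrow> bool" where
  "C1_along b u u' \<longleftrightarrow> continuous_on UNIV u \<and> continuous_on UNIV u' \<and>
     (\<forall>z. ((\<lambda>s. u (z + s *\<^sub>R b)) has_real_derivative u' z) (at 0))"

lemma C1_along_add:
  "C1_along b u u' \<Longrightarrow> C1_along b z z' \<Longrightarrow> C1_along b (\<lambda>x. u x + z x) (\<lambda>x. u' x + z' x)"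
  by (auto simp: C1_along_def intro!: continuous_intros derivative_intros)

lemma C1_along_cmult:
  "C1_along b u u' \<Longrightarrow> C1_along b (\<lambda>x. c * u x) (\<lambda>x. c * u' x)"
  by (auto simp: C1_along_def intro!: continuous_intros DERIV_cmult)

lemma C1_along_mult:
  assumes "C1_along b u u'" "C1_along b z z'"
  shows "C1_along b (\<lambda>x. u x * z x) (\<lambda>x. u' x * z x + u x * z' x)"
  unfolding C1_along_def
proof (intro conjI allI)
  fix x
  have "((\<lambda>s. u (x + s *\<^sub>R b)) has_real_derivative u' x) (at 0)"
      "((\<lambda>s. z (x + s *\<^sub>R b)) has_real_derivative z' x) (at 0)"
    using assms by (auto simp: C1_along_def)
  from DERIV_mult[OF this] show "((\<lambda>s. u (x + s *\<^sub>R b) * z (x + s *\<^sub>R b)) has_real_derivative u' x * z x + u x * z' x) (at 0)"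
    by (simp add: algebra_simps)
qed (use assms in \<open>auto simp: C1_along_def intro!: continuous_intros\<close>)

lemma C1_along_smooth:
  assumes "smooth u" "b \<in> Basis"
  shows "C1_along b u (partial_deriv b u)"
proof -
  have "Ck (Suc 0) u" using assms(1) by (simp add: smooth_def)
  then have d: "u differentiable (at z)" and c: "continuous_on UNIV (partial_deriv b u)" for z
    using assms(2) by auto
  have "((\<lambda>s. u (z + s *\<^sub>R b)) has_real_derivative partial_deriv b u z) (at 0)" for z
  proof -
    have D: "(u has_derivative frechet_derivative u (at z)) (at z)"
      using d by (simp add: frechet_derivative_works)
    then have lin: "linear (frechet_derivative u (at z))"
      by (simp add: has_derivative_linear)
    have "((\<lambda>s. z + s *\<^sub>R b) has_derivative (\<lambda>s. s *\<^sub>R b)) (at (0::real))"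
      by (auto intro!: derivative_eq_intros)
    from diff_chain_at[OF this, of u] D
    have "((\<lambda>s. u (z + s *\<^sub>R b)) has_derivative (\<lambda>s. frechet_derivative u (at z) (s *\<^sub>R b))) (at 0)"
      by (simp add: comp_def)
    moreover have "(\<lambda>s. frechet_derivative u (at z) (s *\<^sub>R b)) = (*) (partial_deriv b u z)"
      by (auto simp: partial_deriv_def linear_scale[OF lin])
    ultimately show ?thesis by (simp add: has_field_derivative_def)
  qed
  moreover have "continuous_on UNIV u"
    using d by (auto intro!: differentiable_imp_continuous_on simp: differentiable_on_def)
  ultimately show ?thesis using c by (simp add: C1_along_def)
qed

text \<open>
  Only the derivative in the direction \<open>b\<close> transversal to the boundary piece \<open>\<sigma> ` P\<close> is recorded,
  and the approximating functions need not be smooth. This makes the notion stable under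
  lifting functions of \<open>(t, x)\<close> to functions of \<open>(t, x, v)\<close>.
\<close>

definition H1_trace_along ::
    "'a::euclidean_space set \<Rightarrow> 'p::euclidean_space set \<Rightarrow> ('p \<Rightarrow> 'a) \<Rightarrow> 'a \<Rightarrow>
     ('a \<Rightarrow> real) \<Rightarrow> ('a \<Rightarrow> real) \<Rightarrow> ('p \<Rightarrow> real) \<Rightarrow> bool" where
  "H1_trace_along U P \<sigma> b u u' g \<longleftrightarrow>
     (\<exists>us us'. (\<forall>n. C1_along b (us n) (us' n)) \<and> L2lim (lborel_on U) us u \<and>
        L2lim (lborel_on U) us' u' \<and> L2lim (lborel_on P) (\<lambda>n p. us n (\<sigma> p)) g)"

lemma H1_trace_along_square_integrable:
  assumes "H1_trace_along U P \<sigma> b u u' g"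
  shows "square_integrable (lborel_on U) u" "square_integrable (lborel_on U) u'"
    "square_integrable (lborel_on P) g"
  using assms by (auto simp: H1_trace_along_def L2lim_def)

lemma H1_trace_along_add:
  assumes "H1_trace_along U P \<sigma> b u u' g" "H1_trace_along U P \<sigma> b z z' h"
  shows "H1_trace_along U P \<sigma> b (\<lambda>x. u x + z x) (\<lambda>x. u' x + z' x) (\<lambda>p. g p + h p)"
proof -
  obtain us us' zs zs' where
    "\<And>n. C1_along b (us n) (us' n)" "L2lim (lborel_on U) us u" "L2lim (lborel_on U) us' u'"
    "L2lim (lborel_on P) (\<lambda>n p. us n (\<sigma> p)) g"
    "\<And>n. C1_along b (zs n) (zs' n)" "L2lim (lborel_on U) zs z" "L2lim (lborel_on U) zs' z'"
    "L2lim (lborel_on P) (\<lambda>n p. zs n (\<sigma> p)) h"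
    using assms by (auto simp: H1_trace_along_def)
  then show ?thesis
    unfolding H1_trace_along_def
    by (intro exI[of _ "\<lambda>n x. us n x + zs n x"] exI[of _ "\<lambda>n x. us' n x + zs' n x"])
       (auto intro: C1_along_add L2lim_add)
qed

lemma H1_trace_along_cmult:
  assumes "H1_trace_along U P \<sigma> b u u' g"
  shows "H1_trace_along U P \<sigma> b (\<lambda>x. c * u x) (\<lambda>x. c * u' x) (\<lambda>p. c * g p)"
proof -
  obtain us us' where
    "\<And>n. C1_along b (us n) (us' n)" "L2lim (lborel_on U) us u" "L2lim (lborel_on U) us' u'"
    "L2lim (lborel_on P) (\<lambda>n p. us n (\<sigma> p)) g"
    using assms by (auto simp: H1_trace_along_def)
  then show ?thesis
    unfolding H1_trace_along_def
    by (intro exI[of _ "\<lambda>n x. c * us n x"] exI[of _ "\<lambda>n x. c * us' n x"])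
       (auto intro: C1_along_cmult L2lim_cmult)
qed

lemma H1_trace_along_diff:
  assumes "H1_trace_along U P \<sigma> b u u' g" "H1_trace_along U P \<sigma> b z z' h"
  shows "H1_trace_along U P \<sigma> b (\<lambda>x. u x - z x) (\<lambda>x. u' x - z' x) (\<lambda>p. g p - h p)"
  using H1_trace_along_add[OF assms(1) H1_trace_along_cmult[OF assms(2), of "-1"]] by simp

lemma H1_trace_along_C1:
  assumes "C1_along b u u'" and U: "U \<in> sets borel" "bounded U" and P: "P \<in> sets borel" "bounded P"
    and \<sigma>: "continuous_on UNIV \<sigma>"
  shows "H1_trace_along U P \<sigma> b u u' (\<lambda>p. u (\<sigma> p))"
proof -
  have "continuous_on UNIV (\<lambda>p. u (\<sigma> p))"
    using assms(1) by (auto simp: C1_along_def intro!: continuous_on_compose2[OF _ \<sigma>])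
  then show ?thesis
    using assms(1) unfolding H1_trace_along_def
    by (intro exI[of _ "\<lambda>_. u"] exI[of _ "\<lambda>_. u'"])
       (auto simp: C1_along_def intro!: L2lim_const square_integrable_continuous U P)
qed

lemma H1_trace_along_has_trace:
  assumes tr: "has_trace U u P \<sigma> g" and u: "u \<in> H1 U" and b: "b \<in> Basis"
    and U: "U \<in> sets borel" "bounded U" and P: "P \<in> sets borel" "bounded P"
    and \<sigma>: "continuous_on UNIV \<sigma>"
  shows "H1_trace_along U P \<sigma> b u (weak_partial U b u) g"
proof -
  obtain us where us: "\<And>n. smooth (us n)" "L2_tendsto U us u"
      "L2_tendsto U (\<lambda>n. partial_deriv b (us n)) (weak_partial U b u)"
      "L2_tendsto P (\<lambda>n p. us n (\<sigma> p)) g"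
    using tr b by (auto simp: has_trace_def)
  have C1: "C1_along b (us n) (partial_deriv b (us n))" for n
    using us(1) b by (rule C1_along_smooth)
  then have "continuous_on UNIV (us n)" "continuous_on UNIV (partial_deriv b (us n))" for n
    by (auto simp: C1_along_def)
  moreover from this have "continuous_on UNIV (\<lambda>p. us n (\<sigma> p))" for n
    by (auto intro!: continuous_on_compose2[OF _ \<sigma>])
  moreover have "square_integrable (lborel_on U) u" "square_integrable (lborel_on U) (weak_partial U b u)"
      "square_integrable (lborel_on P) g"
    using u b tr U P by (auto simp: H1_def has_trace_def L2_eq_square_integrable)
  ultimately show ?thesis
    using us(2-4) C1 unfolding H1_trace_along_def
    by (intro exI[of _ us] exI[of _ "\<lambda>n. partial_deriv b (us n)"])
       (auto intro!: L2lim_of_L2_tendsto square_integrable_continuous U P)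
qed

text \<open>
  The face \<open>\<tau> ` P\<close> is opposite to \<open>\<sigma> ` P\<close>, and \<open>k\<close> is the outer normal component on \<open>\<sigma> ` P\<close>. Restricting
  to functions that vanish on \<open>\<tau> ` P\<close> allows each trace to have its own approximating sequence.
\<close>

definition one_sided_green ::
    "'a::euclidean_space set \<Rightarrow> 'p::euclidean_space set \<Rightarrow> ('p \<Rightarrow> 'a) \<Rightarrow> ('p \<Rightarrow> 'a) \<Rightarrow> 'a \<Rightarrow> real \<Rightarrow> bool" where
  "one_sided_green U P \<sigma> \<tau> b k \<longleftrightarrow>
     (\<forall>F F'. C1_along b F F' \<and> (\<forall>p\<in>P. F (\<tau> p) = 0) \<longrightarrow>
        integral\<^sup>L (lborel_on U) F' = k * (\<integral>p. F (\<sigma> p) \<partial>lborel_on P))"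

text \<open>Green's formula is applied to \<open>\<phi>\<close> times the product of the two
  approximants, which vanishes on the face \<open>\<tau>\<close> because \<open>\<phi>\<close> does;
  the values of the approximants there are irrelevant. As \<open>\<phi>\<close> and
  \<open>\<phi>'\<close> are bounded on \<open>U\<close>, every integral is a pairing of two
  L2-convergent sequences and passes to the limit.\<close>

lemma one_sided_green_product:
  assumes green: "one_sided_green U P \<sigma> \<tau> b k"
    and U: "U \<in> sets borel" "bounded U" and P: "P \<in> sets borel" "bounded P"
    and \<sigma>: "continuous_on UNIV \<sigma>"
    and \<phi>: "C1_along b \<phi> \<phi>'" and \<phi>0: "\<And>p. p \<in> P \<Longrightarrow> \<phi> (\<tau> p) = 0"
    and u: "H1_trace_along U P \<sigma> b u u' g" and z: "H1_trace_along U P \<sigma> b z z' h"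
  shows "(\<integral>x. \<phi>' x * u x * z x \<partial>lborel_on U) + (\<integral>x. \<phi> x * u' x * z x \<partial>lborel_on U)
       + (\<integral>x. \<phi> x * u x * z' x \<partial>lborel_on U) = k * (\<integral>p. \<phi> (\<sigma> p) * g p * h p \<partial>lborel_on P)"
proof -
  obtain us us' zs zs' where us:
    "\<And>n. C1_along b (us n) (us' n)" "L2lim (lborel_on U) us u" "L2lim (lborel_on U) us' u'"
    "L2lim (lborel_on P) (\<lambda>n p. us n (\<sigma> p)) g" and zs:
    "\<And>n. C1_along b (zs n) (zs' n)" "L2lim (lborel_on U) zs z" "L2lim (lborel_on U) zs' z'"
    "L2lim (lborel_on P) (\<lambda>n p. zs n (\<sigma> p)) h"
    using u z by (auto simp: H1_trace_along_def)
  have c\<phi>: "continuous_on UNIV \<phi>" "continuous_on UNIV \<phi>'" "continuous_on UNIV (\<lambda>p. \<phi> (\<sigma> p))"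
    using \<phi> by (auto simp: C1_along_def intro!: continuous_on_compose2[OF _ \<sigma>])
  obtain K K' L where K: "\<And>x. x \<in> U \<Longrightarrow> \<bar>\<phi> x\<bar> \<le> K" "\<And>x. x \<in> U \<Longrightarrow> \<bar>\<phi>' x\<bar> \<le> K'"
      "\<And>p. p \<in> P \<Longrightarrow> \<bar>\<phi> (\<sigma> p)\<bar> \<le> L"
    using square_integrable_continuous(4)[OF U c\<phi>(1)] square_integrable_continuous(4)[OF U c\<phi>(2)]
      square_integrable_continuous(4)[OF P c\<phi>(3)] by blast
  have bm: "L2lim (lborel_on U) (\<lambda>n x. \<phi> x * fs n x) (\<lambda>x. \<phi> x * f x)"
      "L2lim (lborel_on U) (\<lambda>n x. \<phi>' x * fs n x) (\<lambda>x. \<phi>' x * f x)"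
    if "L2lim (lborel_on U) fs f" for fs f
    using K by (auto intro!: L2lim_bounded_mult[OF that] square_integrable_continuous U c\<phi>
        simp: space_restrict_space)
  have bmP: "L2lim (lborel_on P) (\<lambda>n p. \<phi> (\<sigma> p) * us n (\<sigma> p)) (\<lambda>p. \<phi> (\<sigma> p) * g p)"
    using K(3) by (intro L2lim_bounded_mult[OF us(4)] square_integrable_continuous P c\<phi>)
      (auto simp: space_restrict_space)
  let ?I = "\<lambda>n. (\<integral>x. \<phi>' x * us n x * zs n x \<partial>lborel_on U) + (\<integral>x. \<phi> x * us' n x * zs n x \<partial>lborel_on U)
       + (\<integral>x. \<phi> x * us n x * zs' n x \<partial>lborel_on U)"
  have "?I n = k * (\<integral>p. \<phi> (\<sigma> p) * us n (\<sigma> p) * zs n (\<sigma> p) \<partial>lborel_on P)" for n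
  proof -
    define F F' where "F = (\<lambda>x. \<phi> x * (us n x * zs n x))"
      and "F' = (\<lambda>x. \<phi>' x * (us n x * zs n x) + \<phi> x * (us' n x * zs n x + us n x * zs' n x))"
    have "C1_along b F F'"
      unfolding F_def F'_def by (intro C1_along_mult \<phi> us zs)
    moreover have "\<forall>p\<in>P. F (\<tau> p) = 0" using \<phi>0 by (simp add: F_def)
    ultimately have "integral\<^sup>L (lborel_on U) F' = k * (\<integral>p. F (\<sigma> p) \<partial>lborel_on P)"
      using green unfolding one_sided_green_def by blast
    moreover have "integrable (lborel_on U) (\<lambda>x. \<phi>' x * us n x * zs n x)"
        "integrable (lborel_on U) (\<lambda>x. \<phi> x * us' n x * zs n x)"
        "integrable (lborel_on U) (\<lambda>x. \<phi> x * us n x * zs' n x)"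
      using us(1)[of n] zs(1)[of n] c\<phi>
      by (auto simp: C1_along_def intro!: square_integrable_continuous U continuous_intros)
    moreover have "F' = (\<lambda>x. \<phi>' x * us n x * zs n x + \<phi> x * us' n x * zs n x + \<phi> x * us n x * zs' n x)"
      by (auto simp: F'_def algebra_simps)
    ultimately show ?thesis by (simp add: F_def mult.assoc)
  qed
  moreover have "?I \<longlonglongrightarrow> (\<integral>x. \<phi>' x * u x * z x \<partial>lborel_on U) + (\<integral>x. \<phi> x * u' x * z x \<partial>lborel_on U)
       + (\<integral>x. \<phi> x * u x * z' x \<partial>lborel_on U)"
    by (intro tendsto_add L2lim_integral_mult bm us zs)
  moreover have "(\<lambda>n. k * (\<integral>p. \<phi> (\<sigma> p) * us n (\<sigma> p) * zs n (\<sigma> p) \<partial>lborel_on P))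
      \<longlonglongrightarrow> k * (\<integral>p. \<phi> (\<sigma> p) * g p * h p \<partial>lborel_on P)"
    by (intro tendsto_mult_left L2lim_integral_mult bmP zs)
  ultimately show ?thesis using LIMSEQ_unique by simp
qed

section \<open>Products with the velocity interval\<close>

lemma sigma_finite_lborel_on: "A \<in> sets borel \<Longrightarrow> sigma_finite_measure (lborel_on A)"
  by (auto intro!: sigma_finite_measure_restrict_space lborel.sigma_finite_measure_axioms)

lemma Fubini_lborel_on:
  fixes f :: "'a::euclidean_space \<times> 'b::euclidean_space \<Rightarrow> real"
  assumes "A \<in> sets borel" "C \<in> sets borel" and "integrable (lborel_on (A \<times> C)) f"
  shows "(\<integral>x. \<integral>y. f (x, y) \<partial>lborel_on C \<partial>lborel_on A) = integral\<^sup>L (lborel_on (A \<times> C)) f"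
    and "(\<integral>y. \<integral>x. f (x, y) \<partial>lborel_on A \<partial>lborel_on C) = integral\<^sup>L (lborel_on (A \<times> C)) f"
    and "AE x in lborel_on A. integrable (lborel_on C) (\<lambda>y. f (x, y))"
    and "integrable (lborel_on A) (\<lambda>x. \<integral>y. f (x, y) \<partial>lborel_on C)"
proof -
  interpret A: sigma_finite_measure "lborel_on A" by (rule sigma_finite_lborel_on) fact
  interpret C: sigma_finite_measure "lborel_on C" by (rule sigma_finite_lborel_on) fact
  interpret pair_sigma_finite "lborel_on A" "lborel_on C" ..
  have f: "integrable (lborel_on A \<Otimes>\<^sub>M lborel_on C) f"
    using assms by (simp add: restrict_space_pair)
  show "(\<integral>x. \<integral>y. f (x, y) \<partial>lborel_on C \<partial>lborel_on A) = integral\<^sup>L (lborel_on (A \<times> C)) f"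
    using integral_fst'[OF f] assms by (simp add: restrict_space_pair)
  show "(\<integral>y. \<integral>x. f (x, y) \<partial>lborel_on A \<partial>lborel_on C) = integral\<^sup>L (lborel_on (A \<times> C)) f"
    using integral_snd[of "\<lambda>x y. f (x, y)"] f assms by (simp add: restrict_space_pair)
  show "AE x in lborel_on A. integrable (lborel_on C) (\<lambda>y. f (x, y))"
    using f by (rule AE_integrable_fst')
  show "integrable (lborel_on A) (\<lambda>x. \<integral>y. f (x, y) \<partial>lborel_on C)"
    using f by (rule integrable_fst')
qed

lemma AE_lborel_on_Times:
  fixes A :: "'a::euclidean_space set" and C :: "'b::euclidean_space set"
  assumes "A \<in> sets borel" "C \<in> sets borel" and "AE z in lborel_on (A \<times> C). Q z"
  shows "AE x in lborel_on A. AE y in lborel_on C. Q (x, y)"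
proof -
  interpret A: sigma_finite_measure "lborel_on A" by (rule sigma_finite_lborel_on) fact
  interpret C: sigma_finite_measure "lborel_on C" by (rule sigma_finite_lborel_on) fact
  interpret pair_sigma_finite "lborel_on A" "lborel_on C" ..
  have "AE z in lborel_on A \<Otimes>\<^sub>M lborel_on C. Q z"
    using assms(3) by (subst restrict_space_pair[OF assms(1,2), symmetric])
  then show ?thesis by (rule AE_pair)
qed

lemma integral_FTC_lborel_on:
  assumes "a < b" and F: "\<And>s. (F has_real_derivative f s) (at s)" and f: "continuous_on UNIV f"
  shows "integral\<^sup>L (lborel_on {a<..<b}) f = F b - F a"
proof -
  have "integral\<^sup>L (lborel_on {a<..<b}) f = (LINT s|lborel. indicator {a<..<b} s *\<^sub>R f s)"
    by (simp add: integral_restrict_space)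
  also have "\<dots> = (LINT s|lborel. indicator {a..b} s *\<^sub>R f s)"
    by (rule integral_discrete_difference[of "{a, b}"]) (auto split: split_indicator)
  also have "\<dots> = F b - F a"
    using assms by (intro integral_FTC_atLeastAtMost)
      (auto intro: has_field_derivative_at_within continuous_on_subset
        simp: has_real_derivative_iff_has_vector_derivative[symmetric])
  finally show ?thesis .
qed

text \<open>\<open>avg\<close> integrates over the closed interval, Sobolev functions live on the
  open one; the endpoints form a null set.\<close>

lemma avg_eq: "avg g = integral\<^sup>L (lborel_on {0<..<1}) g"
proof -
  have "integral\<^sup>L (lborel_on {0<..<1}) g = (LINT s|lborel. indicator {0<..<1} s *\<^sub>R g s)"
    by (simp add: integral_restrict_space)
  also have "\<dots> = (LINT s|lborel. indicator {0..1} s *\<^sub>R g s)"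
    by (rule integral_discrete_difference[of "{0, 1}"]) (auto split: split_indicator)
  finally show ?thesis by (simp add: avg_def set_lebesgue_integral_def)
qed

definition measure_preserving :: "'a measure \<Rightarrow> 'b measure \<Rightarrow> ('a \<Rightarrow> 'b) \<Rightarrow> bool" where
  "measure_preserving N M \<pi> \<longleftrightarrow> \<pi> \<in> measurable N M \<and> distr N M \<pi> = M"

lemma
  assumes "measure_preserving N M \<pi>"
  shows measure_preserving_integral:
      "f \<in> borel_measurable M \<Longrightarrow> (\<integral>z. f (\<pi> z) \<partial>N) = integral\<^sup>L M (f :: _ \<Rightarrow> real)"
    and measure_preserving_integrable: "integrable M f \<Longrightarrow> integrable N (\<lambda>z. f (\<pi> z))"
    and measure_preserving_AE: "AE z in M. Q z \<Longrightarrow> AE z in N. Q (\<pi> z)"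
proof -
  have \<pi>: "\<pi> \<in> measurable N M" and d: "distr N M \<pi> = M"
    using assms by (auto simp: measure_preserving_def)
  show "f \<in> borel_measurable M \<Longrightarrow> (\<integral>z. f (\<pi> z) \<partial>N) = integral\<^sup>L M f"
    using integral_distr[OF \<pi>, of f] d by simp
  show "integrable M f \<Longrightarrow> integrable N (\<lambda>z. f (\<pi> z))"
    using integrable_distr_eq[OF \<pi>, of f] d by auto
  show "AE z in N. Q (\<pi> z)" if "AE z in M. Q z"
    by (rule AE_distrD[OF \<pi>]) (subst d, fact that)
qed

lemma measure_preserving_square_integrable:
  "measure_preserving N M \<pi> \<Longrightarrow> square_integrable M u \<Longrightarrow> square_integrable N (\<lambda>z. u (\<pi> z))"
  unfolding square_integrable_def
  by (auto simp: measure_preserving_def measurable_compose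
      intro: measure_preserving_integrable[where f = "\<lambda>z. (u z)\<^sup>2", unfolded measure_preserving_def])

lemma measure_preserving_L2lim:
  assumes m: "measure_preserving N M \<pi>" and u: "L2lim M us u"
  shows "L2lim N (\<lambda>n z. us n (\<pi> z)) (\<lambda>z. u (\<pi> z))"
proof -
  have "(\<integral>z. (us n (\<pi> z) - u (\<pi> z))\<^sup>2 \<partial>N) = (\<integral>z. (us n z - u z)\<^sup>2 \<partial>M)" for n
    using u by (intro measure_preserving_integral[OF m, of "\<lambda>z. (us n z - u z)\<^sup>2"] borel_measurable_power borel_measurable_diff)
      (auto simp: L2lim_def square_integrable_def)
  then show ?thesis
    using u measure_preserving_square_integrable[OF m] by (auto simp: L2lim_def)
qed

text \<open>Pulling back along a measure preserving map keeps all L2 distances. Since the velocity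
  interval has length one, forgetting \<open>v\<close> is such a map, and this turns
  \<open>\<rho>\<close> and its data into functions of (t, x, v) without any constants.\<close>

lemma H1_trace_along_lift:
  assumes \<pi>: "measure_preserving (lborel_on U) (lborel_on U0) \<pi>"
    and \<pi>P: "measure_preserving (lborel_on P) (lborel_on P0) \<pi>P"
    and \<sigma>: "\<And>p. \<pi> (\<sigma> p) = \<sigma>0 (\<pi>P p)" and b: "\<And>z s. \<pi> (z + s *\<^sub>R b) = \<pi> z + s *\<^sub>R b0"
    and cont: "continuous_on UNIV \<pi>"
    and u: "H1_trace_along U0 P0 \<sigma>0 b0 u u' g"
  shows "H1_trace_along U P \<sigma> b (\<lambda>z. u (\<pi> z)) (\<lambda>z. u' (\<pi> z)) (\<lambda>p. g (\<pi>P p))"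
proof -
  obtain us us' where us:
    "\<And>n. C1_along b0 (us n) (us' n)" "L2lim (lborel_on U0) us u" "L2lim (lborel_on U0) us' u'"
    "L2lim (lborel_on P0) (\<lambda>n p. us n (\<sigma>0 p)) g"
    using u by (auto simp: H1_trace_along_def)
  have "C1_along b (\<lambda>z. us n (\<pi> z)) (\<lambda>z. us' n (\<pi> z))" for n
    using us(1)[of n] by (auto simp: C1_along_def b intro!: continuous_on_compose2[OF _ cont])
  then show ?thesis
    unfolding H1_trace_along_def
    using measure_preserving_L2lim[OF \<pi> us(2)] measure_preserving_L2lim[OF \<pi> us(3)]
      measure_preserving_L2lim[OF \<pi>P us(4)]
    by (intro exI[of _ "\<lambda>n z. us n (\<pi> z)"] exI[of _ "\<lambda>n z. us' n (\<pi> z)"]) (auto simp: \<sigma>)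
qed

lemma emeasure_lborel_on_unit: "emeasure (lborel_on {0<..<1::real}) (space (lborel_on {0<..<1})) = 1"
  by (simp add: space_restrict_space emeasure_restrict_space)

lemma measure_preserving_fst:
  fixes A :: "'a::euclidean_space set"
  assumes "A \<in> sets borel"
  shows "measure_preserving (lborel_on (A \<times> {0<..<1::real})) (lborel_on A) fst"
proof -
  let ?V = "lborel_on {0<..<1::real}"
  interpret V: sigma_finite_measure ?V by (rule sigma_finite_lborel_on) simp
  have "distr (lborel_on A \<Otimes>\<^sub>M ?V) (lborel_on A) fst = lborel_on A"
  proof (rule measure_eqI)
    fix a assume "a \<in> sets (distr (lborel_on A \<Otimes>\<^sub>M ?V) (lborel_on A) fst)"
    then have a: "a \<in> sets (lborel_on A)" by simp
    have "fst -` a \<inter> space (lborel_on A \<Otimes>\<^sub>M ?V) = a \<times> space ?V"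
      using sets.sets_into_space[OF a] by (auto simp: space_pair_measure)
    then show "emeasure (distr (lborel_on A \<Otimes>\<^sub>M ?V) (lborel_on A) fst) a = emeasure (lborel_on A) a"
      using a V.emeasure_pair_measure_Times[of a "lborel_on A" "space ?V"]
      by (simp add: emeasure_distr emeasure_lborel_on_unit del: space_restrict_space2)
  qed simp
  then show ?thesis
    using assms by (simp add: measure_preserving_def restrict_space_pair)
qed

text \<open>A product measure is determined by its values on rectangles, and the preimage of a
  rectangle only gains the velocity factor of mass one.\<close>

lemma measure_preserving_fst_fst:
  fixes A :: "'a::euclidean_space set" and C :: "'b::euclidean_space set"
  assumes A: "A \<in> sets borel" and C: "C \<in> sets borel"
  shows "measure_preserving (lborel_on (A \<times> C \<times> {0<..<1::real})) (lborel_on (A \<times> C)) (\<lambda>z. (fst z, fst (snd z)))"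
proof -
  let ?V = "lborel_on {0<..<1::real}" and ?\<pi> = "\<lambda>z. (fst z, fst (snd z))"
  let ?N = "lborel_on A \<Otimes>\<^sub>M (lborel_on C \<Otimes>\<^sub>M ?V)" and ?M = "lborel_on A \<Otimes>\<^sub>M lborel_on C"
  interpret A: sigma_finite_measure "lborel_on A" by (rule sigma_finite_lborel_on) fact
  interpret C: sigma_finite_measure "lborel_on C" by (rule sigma_finite_lborel_on) fact
  interpret V: sigma_finite_measure ?V by (rule sigma_finite_lborel_on) simp
  interpret CV: pair_sigma_finite "lborel_on C" ?V ..
  have \<pi>: "?\<pi> \<in> measurable ?N ?M" by measurable
  have "?M = distr ?N ?M ?\<pi>"
  proof (rule pair_measure_eqI)
    fix a c assume a: "a \<in> sets (lborel_on A)" and c: "c \<in> sets (lborel_on C)"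
    have "?\<pi> -` (a \<times> c) \<inter> space ?N = a \<times> c \<times> space ?V"
      using sets.sets_into_space[OF a] sets.sets_into_space[OF c] by (auto simp: space_pair_measure)
    moreover have "c \<times> space ?V \<in> sets (lborel_on C \<Otimes>\<^sub>M ?V)"
      using c by (intro pair_measureI sets.top)
    ultimately show "emeasure (lborel_on A) a * emeasure (lborel_on C) c = emeasure (distr ?N ?M ?\<pi>) (a \<times> c)"
      using a c V.emeasure_pair_measure_Times[of c "lborel_on C" "space ?V"]
        CV.emeasure_pair_measure_Times[of a "lborel_on A" "c \<times> space ?V"]
      by (simp add: emeasure_distr[OF \<pi>] emeasure_lborel_on_unit del: space_restrict_space2)
  qed (auto intro: A.sigma_finite_measure_axioms C.sigma_finite_measure_axioms)
  moreover have "lborel_on (A \<times> C \<times> {0<..<1::real}) = ?N"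
    using A C by (simp add: restrict_space_pair borel_Times)
  ultimately show ?thesis
    using \<pi> A C by (simp add: measure_preserving_def restrict_space_pair)
qed

section \<open>The space-time slab\<close>

text \<open>\<open>C1_along\<close> asks for the derivative at parameter 0 only, but at every base
  point; moving the base point gives it along the whole line, as the fundamental theorem of calculus
  requires.\<close>

lemma C1_along_line:
  assumes "C1_along b F F'"
  shows "((\<lambda>s. F (z + s *\<^sub>R b)) has_real_derivative F' (z + s0 *\<^sub>R b)) (at s0)"
proof -
  have "((\<lambda>s. F ((z + s0 *\<^sub>R b) + s *\<^sub>R b)) has_real_derivative F' (z + s0 *\<^sub>R b)) (at 0)"
    using assms by (simp add: C1_along_def)
  then have "((\<lambda>s. F (z + (s + s0) *\<^sub>R b)) has_real_derivative F' (z + s0 *\<^sub>R b)) (at 0)"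
    by (simp add: scaleR_add_left ac_simps)
  then show ?thesis
    using DERIV_shift[of "\<lambda>s. F (z + s *\<^sub>R b)" "F' (z + s0 *\<^sub>R b)" 0 s0] by simp
qed

locale slab =
  fixes T xL xR :: real
  assumes T_pos: "0 < T" and xL_less: "xL < xR"
begin

abbreviation "TV \<equiv> {0<..<T} \<times> {0<..<1::real}"
abbreviation "XV \<equiv> {xL<..<xR} \<times> {0<..<1::real}"
abbreviation "B \<equiv> TDV T xL xR"

lemma borel_boxes: "B \<in> sets borel" "TD T xL xR \<in> sets borel" "TV \<in> sets borel" "XV \<in> sets borel"
  by (intro borel_open open_Times open_greaterThanLessThan)+

lemma bounded_boxes: "bounded B" "bounded (TD T xL xR)" "bounded TV" "bounded XV"
  by (intro bounded_Times bounded_Ioo)+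

lemmas integrable_cont = square_integrable_continuous(3)[OF borel_boxes(1) bounded_boxes(1)]

lemma one_sided_green_t:
  "one_sided_green B XV (\<lambda>(x,v). (0,x,v)) (\<lambda>(x,v). (T,x,v)) (1,0,0) (-1)"
  unfolding one_sided_green_def
proof (intro allI impI, elim conjE)
  fix F F' :: "real \<times> real \<times> real \<Rightarrow> real"
  assume F: "C1_along (1,0,0) F F'" and F0: "\<forall>p\<in>XV. F (case p of (x, v) \<Rightarrow> (T, x, v)) = 0"
  have c: "continuous_on UNIV F" "continuous_on UNIV F'" using F by (auto simp: C1_along_def)
  have "integral\<^sup>L (lborel_on B) F' = (\<integral>q. \<integral>t. F' (t, q) \<partial>lborel_on {0<..<T} \<partial>lborel_on XV)"
    using borel_boxes by (intro Fubini_lborel_on(2)[symmetric] integrable_cont c) auto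
  also have "\<dots> = (\<integral>q. - F (0, q) \<partial>lborel_on XV)"
  proof (rule Bochner_Integration.integral_cong[OF refl])
    fix q assume "q \<in> space (lborel_on XV)"
    then have "F (T, q) = 0" using F0 by (auto simp: space_restrict_space)
    moreover have "(\<integral>t. F' (t, q) \<partial>lborel_on {0<..<T}) = F (T, q) - F (0, q)"
    proof (rule integral_FTC_lborel_on[OF T_pos])
      show "((\<lambda>t. F (t, q)) has_real_derivative F' (s, q)) (at s)" for s
        using C1_along_line[OF F, of "(0, q)" s] by (cases q) simp
      show "continuous_on UNIV (\<lambda>t. F' (t, q))"
        by (auto intro!: continuous_on_compose2[OF c(2)] continuous_intros)
    qed
    ultimately show "(\<integral>t. F' (t, q) \<partial>lborel_on {0<..<T}) = - F (0, q)" by simp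
  qed
  finally show "integral\<^sup>L (lborel_on B) F' = - 1 * (\<integral>p. F (case p of (x, v) \<Rightarrow> (0, x, v)) \<partial>lborel_on XV)"
    by (simp add: case_prod_unfold)
qed

lemma integral_C1_along_x:
  assumes F: "C1_along (0,1,0) F F'"
  shows "integral\<^sup>L (lborel_on B) F' =
    (\<integral>p. F (fst p, xR, snd p) \<partial>lborel_on TV) - (\<integral>p. F (fst p, xL, snd p) \<partial>lborel_on TV)"
proof -
  have c: "continuous_on UNIV F" "continuous_on UNIV F'" using F by (auto simp: C1_along_def)
  have c': "continuous_on UNIV (\<lambda>p. F (fst p, x, snd p))" for x
    by (auto intro!: continuous_on_compose2[OF c(1)] continuous_intros)
  have int: "integrable (lborel_on TV) (\<lambda>p. F (fst p, x, snd p))" for x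
    using borel_boxes bounded_boxes by (intro square_integrable_continuous(3) c') auto
  have "integral\<^sup>L (lborel_on B) F' = (\<integral>t. \<integral>q. F' (t, q) \<partial>lborel_on XV \<partial>lborel_on {0<..<T})"
    using borel_boxes by (intro Fubini_lborel_on(1)[symmetric] integrable_cont c) auto
  also have "\<dots> = (\<integral>t. \<integral>v. F (t, xR, v) - F (t, xL, v) \<partial>lborel_on {0<..<1} \<partial>lborel_on {0<..<T})"
  proof (rule Bochner_Integration.integral_cong[OF refl])
    fix t
    have "continuous_on UNIV (\<lambda>q. F' (t, q))"
      by (auto intro!: continuous_on_compose2[OF c(2)] continuous_intros)
    then have "integrable (lborel_on XV) (\<lambda>q. F' (t, q))"
      using borel_boxes bounded_boxes by (intro square_integrable_continuous(3)) auto
    then have "(\<integral>q. F' (t, q) \<partial>lborel_on XV)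
        = (\<integral>v. \<integral>x. F' (t, x, v) \<partial>lborel_on {xL<..<xR} \<partial>lborel_on {0<..<1})"
      by (intro Fubini_lborel_on(2)[symmetric]) auto
    moreover have "(\<integral>x. F' (t, x, v) \<partial>lborel_on {xL<..<xR}) = F (t, xR, v) - F (t, xL, v)" for v
    proof (rule integral_FTC_lborel_on[OF xL_less])
      show "((\<lambda>x. F (t, x, v)) has_real_derivative F' (t, s, v)) (at s)" for s
        using C1_along_line[OF F, of "(t, 0, v)" s] by simp
      show "continuous_on UNIV (\<lambda>x. F' (t, x, v))"
        by (auto intro!: continuous_on_compose2[OF c(2)] continuous_intros)
    qed
    ultimately show "(\<integral>q. F' (t, q) \<partial>lborel_on XV)
        = (\<integral>v. F (t, xR, v) - F (t, xL, v) \<partial>lborel_on {0<..<1})" by simp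
  qed
  also have "\<dots> = (\<integral>p. F (fst p, xR, snd p) - F (fst p, xL, snd p) \<partial>lborel_on TV)"
    using int Fubini_lborel_on(1)[of "{0<..<T}" "{0<..<1}" "\<lambda>p. F (fst p, xR, snd p) - F (fst p, xL, snd p)"]
    by simp
  finally show ?thesis using int by simp
qed

lemma one_sided_green_xL:
  "one_sided_green B TV (\<lambda>(t,v). (t,xL,v)) (\<lambda>(t,v). (t,xR,v)) (0,1,0) (-1)"
  unfolding one_sided_green_def
proof (intro allI impI, elim conjE)
  fix F F' :: "real \<times> real \<times> real \<Rightarrow> real"
  assume F: "C1_along (0,1,0) F F'" and F0: "\<forall>p\<in>TV. F (case p of (t, v) \<Rightarrow> (t, xR, v)) = 0"
  have "(\<integral>p. F (fst p, xR, snd p) \<partial>lborel_on TV) = 0"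
    using F0 borel_boxes by (intro Bochner_Integration.integral_eq_zero_AE AE_I2) (auto simp: space_restrict_space)
  then show "integral\<^sup>L (lborel_on B) F' = - 1 * (\<integral>p. F (case p of (t, v) \<Rightarrow> (t, xL, v)) \<partial>lborel_on TV)"
    using integral_C1_along_x[OF F] by (simp add: case_prod_unfold)
qed

lemma one_sided_green_xR:
  "one_sided_green B TV (\<lambda>(t,v). (t,xR,v)) (\<lambda>(t,v). (t,xL,v)) (0,1,0) 1"
  unfolding one_sided_green_def
proof (intro allI impI, elim conjE)
  fix F F' :: "real \<times> real \<times> real \<Rightarrow> real"
  assume F: "C1_along (0,1,0) F F'" and F0: "\<forall>p\<in>TV. F (case p of (t, v) \<Rightarrow> (t, xL, v)) = 0"
  have "(\<integral>p. F (fst p, xL, snd p) \<partial>lborel_on TV) = 0"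
    using F0 borel_boxes by (intro Bochner_Integration.integral_eq_zero_AE AE_I2) (auto simp: space_restrict_space)
  then show "integral\<^sup>L (lborel_on B) F' = 1 * (\<integral>p. F (case p of (t, v) \<Rightarrow> (t, xR, v)) \<partial>lborel_on TV)"
    using integral_C1_along_x[OF F] by (simp add: case_prod_unfold)
qed

lemma integral_B_iterated:
  assumes f: "integrable (lborel_on B) f"
  shows "integral\<^sup>L (lborel_on B) f =
    (\<integral>t. \<integral>x. avg (\<lambda>v. f (t, x, v)) \<partial>lborel_on {xL<..<xR} \<partial>lborel_on {0<..<T})"
proof -
  interpret V: sigma_finite_measure "lborel_on {0<..<1::real}" by (rule sigma_finite_lborel_on) simp
  interpret X: sigma_finite_measure "lborel_on {xL<..<xR}" by (rule sigma_finite_lborel_on) simp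
  have Bp: "lborel_on B = lborel_on {0<..<T} \<Otimes>\<^sub>M (lborel_on {xL<..<xR} \<Otimes>\<^sub>M lborel_on {0<..<1})"
    using borel_boxes by (simp add: restrict_space_pair)
  have [measurable]: "f \<in> borel_measurable (lborel_on {0<..<T} \<Otimes>\<^sub>M (lborel_on {xL<..<xR} \<Otimes>\<^sub>M lborel_on {0<..<1}))"
    using f unfolding Bp by (rule borel_measurable_integrable)
  have "integral\<^sup>L (lborel_on B) f = (\<integral>t. \<integral>q. f (t, q) \<partial>lborel_on XV \<partial>lborel_on {0<..<T})"
    using borel_boxes by (intro Fubini_lborel_on(1)[symmetric] f) auto
  also have "\<dots> = (\<integral>t. \<integral>x. \<integral>v. f (t, x, v) \<partial>lborel_on {0<..<1} \<partial>lborel_on {xL<..<xR} \<partial>lborel_on {0<..<T})"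
  proof (rule integral_cong_AE)
    show "(\<lambda>t. \<integral>q. f (t, q) \<partial>lborel_on XV) \<in> borel_measurable (lborel_on {0<..<T})"
      using borel_boxes by (intro borel_measurable_integrable Fubini_lborel_on(4) f) auto
    show "(\<lambda>t. \<integral>x. \<integral>v. f (t, x, v) \<partial>lborel_on {0<..<1} \<partial>lborel_on {xL<..<xR}) \<in> borel_measurable (lborel_on {0<..<T})"
      by measurable
    \<comment> \<open>For a null set of times the slice may fail to be integrable, and there the
      integral over the pair and the iterated one may take different values; hence equality only
      almost everywhere.\<close>
    have "AE t in lborel_on {0<..<T}. integrable (lborel_on XV) (\<lambda>q. f (t, q))"
      by (rule Fubini_lborel_on(3)[OF _ borel_boxes(4) f]) simp
    then show "AE t in lborel_on {0<..<T}. (\<integral>q. f (t, q) \<partial>lborel_on XV) =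
        (\<integral>x. \<integral>v. f (t, x, v) \<partial>lborel_on {0<..<1} \<partial>lborel_on {xL<..<xR})"
      by eventually_elim (intro Fubini_lborel_on(1)[symmetric], auto)
  qed
  finally show ?thesis by (simp add: avg_eq)
qed

lemma AE_integrable_slice:
  fixes f :: "real \<times> real \<times> real \<Rightarrow> real"
  assumes f: "integrable (lborel_on B) f"
  shows "AE t in lborel_on {0<..<T}. AE x in lborel_on {xL<..<xR}. integrable (lborel_on {0<..<1}) (\<lambda>v. f (t, x, v))"
proof -
  have "AE t in lborel_on {0<..<T}. integrable (lborel_on XV) (\<lambda>q. f (t, q))"
    by (rule Fubini_lborel_on(3)[OF _ borel_boxes(4) f]) simp
  then show ?thesis
    by eventually_elim (intro Fubini_lborel_on(3), auto)
qed

lemma AE_slice: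
  assumes "AE z in lborel_on B. Q z"
  shows "AE t in lborel_on {0<..<T}. AE x in lborel_on {xL<..<xR}. AE v in lborel_on {0<..<1}. Q (t, x, v)"
proof -
  have "AE t in lborel_on {0<..<T}. AE q in lborel_on XV. Q (t, q)"
    by (rule AE_lborel_on_Times[OF _ borel_boxes(4) assms]) simp
  then show ?thesis
    by eventually_elim (intro AE_lborel_on_Times, auto)
qed

lemma integral_zero_of_avg_zero:
  assumes f: "integrable (lborel_on B) f"
    and "AE t in lborel_on {0<..<T}. AE x in lborel_on {xL<..<xR}. avg (\<lambda>v. f (t, x, v)) = 0"
  shows "integral\<^sup>L (lborel_on B) f = 0"
  unfolding integral_B_iterated[OF f]
proof (rule integral_eq_zero_AE)
  show "AE t in lborel_on {0<..<T}. (\<integral>x. avg (\<lambda>v. f (t, x, v)) \<partial>lborel_on {xL<..<xR}) = 0"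
    using assms(2) by eventually_elim (rule integral_eq_zero_AE)
qed

lemma measure_preserving_TD: "measure_preserving (lborel_on B) (lborel_on (TD T xL xR)) (\<lambda>z. (fst z, fst (snd z)))"
  by (rule measure_preserving_fst_fst) auto

lemma measure_preserving_T: "measure_preserving (lborel_on TV) (lborel_on {0<..<T}) fst"
  by (rule measure_preserving_fst) auto

lemma measure_preserving_X: "measure_preserving (lborel_on XV) (lborel_on {xL<..<xR}) fst"
  by (rule measure_preserving_fst) auto

end

section \<open>Weighted product rules and flux bounds on the slab\<close>

context slab
begin

lemma C1_along_weight_t:
  assumes "\<And>t. (\<psi> has_real_derivative \<psi>' t) (at t)" "continuous_on UNIV \<psi>'"
  shows "C1_along (1,0,0) (\<lambda>z::real \<times> real \<times> real. \<psi> (fst z)) (\<lambda>z. \<psi>' (fst z))"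
  unfolding C1_along_def
proof (intro conjI allI)
  have "continuous_on UNIV \<psi>" using assms(1) by (meson DERIV_continuous_on has_field_derivative_at_within)
  then show "continuous_on UNIV (\<lambda>z::real \<times> real \<times> real. \<psi> (fst z))"
    by (auto intro!: continuous_on_compose2[of UNIV \<psi>] continuous_intros)
  show "continuous_on UNIV (\<lambda>z::real \<times> real \<times> real. \<psi>' (fst z))"
    by (auto intro!: continuous_on_compose2[OF assms(2)] continuous_intros)
  show "((\<lambda>s. \<psi> (fst (z + s *\<^sub>R (1,0,0)))) has_real_derivative \<psi>' (fst z)) (at 0)" for z :: "real \<times> real \<times> real"
    using assms(1)[of "fst z"] DERIV_shift[of \<psi> "\<psi>' (fst z)" 0 "fst z"] by (simp add: add.commute)
qed

lemma integrable_weighted: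
  assumes "continuous_on UNIV c" and f: "square_integrable (lborel_on B) f" and g: "square_integrable (lborel_on B) g"
  shows "integrable (lborel_on B) (\<lambda>z. c z * f z * g z)"
proof -
  obtain K where K: "\<And>x. x \<in> B \<Longrightarrow> \<bar>c x\<bar> \<le> K"
    using square_integrable_continuous(4)[OF borel_boxes(1) bounded_boxes(1) assms(1)] by blast
  have "square_integrable (lborel_on B) (\<lambda>z. c z * f z)"
    by (rule square_integrable_bounded_mult[OF f])
       (use K assms(1) borel_boxes bounded_boxes in \<open>auto intro: square_integrable_continuous simp: space_restrict_space\<close>)
  then show ?thesis using g by (rule square_integrable_mult)
qed

abbreviation "\<sigma>\<^sub>0 \<equiv> \<lambda>(x::real, v::real). (0::real, x, v)"
abbreviation "\<sigma>\<^sub>L \<equiv> \<lambda>(t::real, v::real). (t, xL, v)"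
abbreviation "\<sigma>\<^sub>R \<equiv> \<lambda>(t::real, v::real). (t, xR, v)"

lemma continuous_faces: "continuous_on UNIV \<sigma>\<^sub>0" "continuous_on UNIV \<sigma>\<^sub>L" "continuous_on UNIV \<sigma>\<^sub>R"
  by (auto simp: case_prod_unfold intro!: continuous_intros)

lemma product_rule_t:
  assumes \<psi>: "\<And>t. (\<psi> has_real_derivative \<psi>' t) (at t)" "continuous_on UNIV \<psi>'" "\<psi> T = 0"
    and u: "H1_trace_along B XV \<sigma>\<^sub>0 (1,0,0) u u' g" and z: "H1_trace_along B XV \<sigma>\<^sub>0 (1,0,0) z z' h"
  shows "(\<integral>y. \<psi>' (fst y) * u y * z y \<partial>lborel_on B) + (\<integral>y. \<psi> (fst y) * u' y * z y \<partial>lborel_on B)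
     + (\<integral>y. \<psi> (fst y) * u y * z' y \<partial>lborel_on B) = - \<psi> 0 * (\<integral>p. g p * h p \<partial>lborel_on XV)"
  using one_sided_green_product[OF one_sided_green_t borel_boxes(1) bounded_boxes(1) borel_boxes(4)
      bounded_boxes(4) continuous_faces(1) C1_along_weight_t[OF \<psi>(1,2)] _ u z] \<psi>(3)
  by (simp add: case_prod_unfold mult.assoc)

lemma product_rule_x:
  assumes \<psi>: "\<And>t. (\<psi> has_real_derivative \<psi>' t) (at t)"
    and uL: "H1_trace_along B TV \<sigma>\<^sub>L (0,1,0) u u' gL" and uR: "H1_trace_along B TV \<sigma>\<^sub>R (0,1,0) u u' gR"
    and zL: "H1_trace_along B TV \<sigma>\<^sub>L (0,1,0) z z' hL" and zR: "H1_trace_along B TV \<sigma>\<^sub>R (0,1,0) z z' hR"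
  shows "(\<integral>y. (\<psi> (fst y) * snd (snd y)) * u' y * z y \<partial>lborel_on B)
     + (\<integral>y. (\<psi> (fst y) * snd (snd y)) * u y * z' y \<partial>lborel_on B) =
    (\<integral>p. \<psi> (fst p) * snd p * gR p * hR p \<partial>lborel_on TV) - (\<integral>p. \<psi> (fst p) * snd p * gL p * hL p \<partial>lborel_on TV)"
proof -
  \<comment> \<open>The weight is split by the linear partition of unity on \<open>{xL..xR}\<close>:
    \<open>cL\<close> vanishes at \<open>xR\<close> and \<open>cR\<close> at \<open>xL\<close>, so
    each piece meets only one trace. Their x-derivatives are opposite, so the terms with
    \<open>c'\<close> cancel on adding.\<close>
  define l where "l = xR - xL"
  have l: "l > 0" using xL_less by (simp add: l_def)
  have "continuous_on UNIV \<psi>" using \<psi> by (meson DERIV_continuous_on has_field_derivative_at_within)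
  then have c: "continuous_on UNIV (\<lambda>y::real \<times> real \<times> real. \<psi> (fst y))"
    by (auto intro!: continuous_on_compose2[of UNIV \<psi>] continuous_intros)
  define cL cR c' where "cL = (\<lambda>y::real \<times> real \<times> real. \<psi> (fst y) * snd (snd y) * ((xR - fst (snd y)) / l))"
    and "cR = (\<lambda>y::real \<times> real \<times> real. \<psi> (fst y) * snd (snd y) * ((fst (snd y) - xL) / l))"
    and "c' = (\<lambda>y::real \<times> real \<times> real. \<psi> (fst y) * snd (snd y) / l)"
  have CL: "C1_along (0,1,0) cL (\<lambda>y. - c' y)" and CR: "C1_along (0,1,0) cR c'"
    using l unfolding C1_along_def cL_def cR_def c'_def
    by (auto intro!: continuous_intros c derivative_eq_intros simp: field_simps)
  have sq: "square_integrable (lborel_on B) u" "square_integrable (lborel_on B) u'"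
      "square_integrable (lborel_on B) z" "square_integrable (lborel_on B) z'"
    using uL zL by (auto dest: H1_trace_along_square_integrable)
  have cc: "continuous_on UNIV cL" "continuous_on UNIV cR" "continuous_on UNIV c'"
    using CL CR by (auto simp: C1_along_def)
  have sum1: "\<psi> (fst y) * snd (snd y) = cL y + cR y" for y
  proof -
    have "(xR - fst (snd y)) / l + (fst (snd y) - xL) / l = 1"
      using l by (simp add: add_divide_distrib[symmetric] l_def)
    then show ?thesis
      by (simp only: cL_def cR_def distrib_left[symmetric] mult_1_right)
  qed
  have "(\<integral>y. - c' y * u y * z y \<partial>lborel_on B) + (\<integral>y. cL y * u' y * z y \<partial>lborel_on B)
     + (\<integral>y. cL y * u y * z' y \<partial>lborel_on B) = - 1 * (\<integral>p. cL (\<sigma>\<^sub>L p) * gL p * hL p \<partial>lborel_on TV)"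
    by (rule one_sided_green_product[OF one_sided_green_xL borel_boxes(1) bounded_boxes(1) borel_boxes(3)
      bounded_boxes(3) continuous_faces(2) CL _ uL zL]) (auto simp: cL_def)
  moreover have "(\<integral>y. c' y * u y * z y \<partial>lborel_on B) + (\<integral>y. cR y * u' y * z y \<partial>lborel_on B)
     + (\<integral>y. cR y * u y * z' y \<partial>lborel_on B) = 1 * (\<integral>p. cR (\<sigma>\<^sub>R p) * gR p * hR p \<partial>lborel_on TV)"
    by (rule one_sided_green_product[OF one_sided_green_xR borel_boxes(1) bounded_boxes(1) borel_boxes(3)
      bounded_boxes(3) continuous_faces(3) CR _ uR zR]) (auto simp: cR_def)
  moreover have "cL (\<sigma>\<^sub>L p) = \<psi> (fst p) * snd p" "cR (\<sigma>\<^sub>R p) = \<psi> (fst p) * snd p" for p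
    using l by (auto simp: cL_def cR_def l_def case_prod_unfold)
  moreover have "(\<integral>y. (\<psi> (fst y) * snd (snd y)) * u' y * z y \<partial>lborel_on B)
     = (\<integral>y. cL y * u' y * z y \<partial>lborel_on B) + (\<integral>y. cR y * u' y * z y \<partial>lborel_on B)"
    unfolding sum1 using sq cc by (simp add: distrib_right integrable_weighted)
  moreover have "(\<integral>y. (\<psi> (fst y) * snd (snd y)) * u y * z' y \<partial>lborel_on B)
     = (\<integral>y. cL y * u y * z' y \<partial>lborel_on B) + (\<integral>y. cR y * u y * z' y \<partial>lborel_on B)"
    unfolding sum1 using sq cc by (simp add: distrib_right integrable_weighted)
  moreover have "(\<integral>y. - c' y * u y * z y \<partial>lborel_on B) = - (\<integral>y. c' y * u y * z y \<partial>lborel_on B)"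
    by simp
  ultimately show ?thesis by simp
qed

text \<open>The velocity is at most 1 and the weight at most \<open>T\<close>; Young's inequality
  then splits the flux into the squares that the boundary loss contains.\<close>

lemma boundary_flux_bound:
  assumes \<psi>: "continuous_on UNIV \<psi>" "\<And>t. 0 < t \<Longrightarrow> t < T \<Longrightarrow> 0 \<le> \<psi> t \<and> \<psi> t \<le> T"
    and g: "square_integrable (lborel_on TV) g" and h: "square_integrable (lborel_on TV) h"
  shows "\<bar>\<integral>p. \<psi> (fst p) * snd p * g p * h p \<partial>lborel_on TV\<bar>
    \<le> T / 2 * ((\<integral>p. (g p)\<^sup>2 \<partial>lborel_on TV) + (\<integral>p. (h p)\<^sup>2 \<partial>lborel_on TV))"
proof -
  have c: "continuous_on UNIV (\<lambda>p::real \<times> real. \<psi> (fst p) * snd p)"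
    by (auto intro!: continuous_on_compose2[OF \<psi>(1)] continuous_intros)
  have b: "\<bar>\<psi> (fst p) * snd p\<bar> \<le> T" if "p \<in> TV" for p
    using mult_mono[of "\<psi> (fst p)" T "snd p" 1] \<psi>(2)[of "fst p"] that T_pos by (auto simp: abs_mult)
  have sq: "square_integrable (lborel_on TV) (\<lambda>p. \<psi> (fst p) * snd p * g p)"
    using b borel_boxes bounded_boxes
    by (intro square_integrable_bounded_mult[OF g, of _ T] square_integrable_continuous c)
       (auto simp: space_restrict_space)
  have i1: "integrable (lborel_on TV) (\<lambda>p. \<psi> (fst p) * snd p * g p * h p)"
    using sq h by (rule square_integrable_mult)
  have i2: "integrable (lborel_on TV) (\<lambda>p. T / 2 * ((g p)\<^sup>2 + (h p)\<^sup>2))"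
    using g h by (simp add: square_integrable_def)
  have "\<bar>\<integral>p. \<psi> (fst p) * snd p * g p * h p \<partial>lborel_on TV\<bar>
      \<le> (\<integral>p. \<bar>\<psi> (fst p) * snd p * g p * h p\<bar> \<partial>lborel_on TV)"
    by (rule integral_abs_bound)
  also have "\<dots> \<le> (\<integral>p. T / 2 * ((g p)\<^sup>2 + (h p)\<^sup>2) \<partial>lborel_on TV)"
  proof (rule integral_mono[OF integrable_abs[OF i1] i2])
    fix p assume "p \<in> space (lborel_on TV)"
    then have "\<bar>\<psi> (fst p) * snd p\<bar> * \<bar>g p * h p\<bar> \<le> T * (((g p)\<^sup>2 + (h p)\<^sup>2) / 2)"
      using b T_pos sum_squares_bound[of "\<bar>g p\<bar>" "\<bar>h p\<bar>"]
      by (intro mult_mono) (auto simp: space_restrict_space abs_mult)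
    then show "\<bar>\<psi> (fst p) * snd p * g p * h p\<bar> \<le> T / 2 * ((g p)\<^sup>2 + (h p)\<^sup>2)"
      by (simp add: abs_mult mult.assoc)
  qed
  also have "\<dots> = T / 2 * ((\<integral>p. (g p)\<^sup>2 \<partial>lborel_on TV) + (\<integral>p. (h p)\<^sup>2 \<partial>lborel_on TV))"
    using g h by (simp add: square_integrable_def)
  finally show ?thesis .
qed

end

section \<open>The weighted energy inequality\<close>

text \<open>After eliminating \<open>St\<close> and \<open>e * Jt\<close>, three completed squares
  remain. \<open>p * (D + S)^2\<close> costs \<open>p * S^2\<close> and
  \<open>p / m * (a - m * S)^2\<close> costs \<open>m * p * S^2\<close>; together they require the
  decay rate \<open>1 + m\<close>. The square in \<open>D2 + 2 * J\<close> is paid by the damping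
  term \<open>J\<close>, so \<open>D2\<close> needs no decay of the weight. The subtracted terms are
  the ones that integrate to boundary contributions or, for \<open>W + a\<close>, to something
  nonnegative.\<close>

lemma energy_density_bound:
  fixes p p' m e \<kappa> :: real
  assumes p: "0 \<le> p" and m: "0 < m" and e: "0 \<le> e" and dec: "\<kappa> + (1 + m) * p \<le> - p'"
    and St: "St + v * Jx + W = - D" and Jt: "e * Jt + v * Sx + J = - D2"
  shows "\<kappa> * (S\<^sup>2 + e * J\<^sup>2) \<le> - (p' * S * S) - e * (p' * J * J) + p * D * D + p / m * a * a + 1/2 * (p * D2 * D2)
     - 2 * (p * (W + a) * S) - 2 * (p * St * S) - 2 * e * (p * Jt * J)
     - 2 * (p * v * Jx * S) - 2 * (p * v * J * Sx)"
proof -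
  have "(\<kappa> + (1 + m) * p) * (S\<^sup>2 + e * J\<^sup>2) \<le> - p' * (S\<^sup>2 + e * J\<^sup>2)"
    using e by (intro mult_right_mono dec) auto
  moreover have "0 \<le> (1 + m) * p * (e * J\<^sup>2)" using p m e by simp
  moreover have "0 \<le> p * (D + S)\<^sup>2" "0 \<le> p / 2 * (D2 + 2 * J)\<^sup>2" "0 \<le> p / m * (a - m * S)\<^sup>2"
    using p m by auto
  moreover have "p / m * (a - m * S)\<^sup>2 = p / m * a * a - 2 * p * a * S + p * m * S\<^sup>2"
    using m by (simp add: power2_eq_square field_simps)
  moreover have St': "St = - D - v * Jx - W" using St by simp
  then have "p * St * S = p * (- D - v * Jx - W) * S" by (simp only: St')
  moreover have "e * Jt = - D2 - v * Sx - J" using Jt by simp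
  then have "e * (p * Jt * J) = p * (- D2 - v * Sx - J) * J"
    by (metis (no_types) mult.assoc mult.left_commute)
  ultimately show ?thesis
    by (simp add: power2_eq_square algebra_simps)
qed

context slab
begin

text \<open>The pointwise bound is integrated over the slab. In time the product rule with equal
  factors turns the derivative terms into the initial traces, since \<open>\<psi>\<close> vanishes
  at \<open>T\<close>; in x it turns the transport terms into the two fluxes. The ratio
  \<open>\<mu>\<close> in Young's inequality stays free, so that it can later be fitted to the
  initial layer.\<close>

lemma weighted_energy_inequality:
  assumes e: "0 \<le> e"
    and \<psi>: "\<And>t. (\<psi> has_real_derivative \<psi>' t) (at t)" "continuous_on UNIV \<psi>'" "\<psi> T = 0"
      "\<And>t. 0 < t \<Longrightarrow> t < T \<Longrightarrow> 0 \<le> \<psi> t \<and> \<psi> t \<le> T"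
    and \<mu>: "continuous_on UNIV \<mu>" "\<And>t. 0 < \<mu> t"
    and dec: "\<And>t. 0 < t \<Longrightarrow> t < T \<Longrightarrow> \<kappa> + (1 + \<mu> t) * \<psi> t \<le> - \<psi>' t"
    and S0: "H1_trace_along B XV \<sigma>\<^sub>0 (1,0,0) S St S0" and J0: "H1_trace_along B XV \<sigma>\<^sub>0 (1,0,0) J Jt J0"
    and SL: "H1_trace_along B TV \<sigma>\<^sub>L (0,1,0) S Sx SL" and SR: "H1_trace_along B TV \<sigma>\<^sub>R (0,1,0) S Sx SR"
    and JL: "H1_trace_along B TV \<sigma>\<^sub>L (0,1,0) J Jx JL" and JR: "H1_trace_along B TV \<sigma>\<^sub>R (0,1,0) J Jx JR"
    and W: "square_integrable (lborel_on B) W" and a: "square_integrable (lborel_on B) a"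
    and D: "square_integrable (lborel_on B) D" and D2: "square_integrable (lborel_on B) D2"
    and eqS: "AE y in lborel_on B. St y + snd (snd y) * Jx y + W y = - D y"
    and eqJ: "AE y in lborel_on B. e * Jt y + snd (snd y) * Sx y + J y = - D2 y"
    and coercive: "0 \<le> (\<integral>y. \<psi> (fst y) * (W y + a y) * S y \<partial>lborel_on B)"
  shows "\<kappa> * ((\<integral>y. (S y)\<^sup>2 \<partial>lborel_on B) + e * (\<integral>y. (J y)\<^sup>2 \<partial>lborel_on B))
    \<le> \<psi> 0 * ((\<integral>p. (S0 p)\<^sup>2 \<partial>lborel_on XV) + e * (\<integral>p. (J0 p)\<^sup>2 \<partial>lborel_on XV))
      + T * ((\<integral>p. (SL p)\<^sup>2 \<partial>lborel_on TV) + (\<integral>p. (JL p)\<^sup>2 \<partial>lborel_on TV)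
           + (\<integral>p. (SR p)\<^sup>2 \<partial>lborel_on TV) + (\<integral>p. (JR p)\<^sup>2 \<partial>lborel_on TV))
      + (\<integral>y. \<psi> (fst y) / \<mu> (fst y) * a y * a y \<partial>lborel_on B)
      + T * ((\<integral>y. (D y)\<^sup>2 \<partial>lborel_on B) + 1/2 * (\<integral>y. (D2 y)\<^sup>2 \<partial>lborel_on B))"
proof -
  let ?I = "\<lambda>f. \<integral>y. f y \<partial>lborel_on B"
  let ?p = "\<lambda>y::real \<times> real \<times> real. \<psi> (fst y)" and ?p' = "\<lambda>y::real \<times> real \<times> real. \<psi>' (fst y)"
  have sq: "square_integrable (lborel_on B) S" "square_integrable (lborel_on B) St" "square_integrable (lborel_on B) Sx"
     "square_integrable (lborel_on B) J" "square_integrable (lborel_on B) Jt" "square_integrable (lborel_on B) Jx"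
     "square_integrable (lborel_on B) (\<lambda>y. W y + a y)"
     "square_integrable (lborel_on TV) SL" "square_integrable (lborel_on TV) SR"
     "square_integrable (lborel_on TV) JL" "square_integrable (lborel_on TV) JR"
    using S0 J0 SL SR JL JR W a by (auto dest: H1_trace_along_square_integrable intro: square_integrable_add)
  have cont: "continuous_on UNIV \<psi>" using \<psi>(1) by (meson DERIV_continuous_on has_field_derivative_at_within)
  have c: "continuous_on UNIV ?p" "continuous_on UNIV ?p'" "continuous_on UNIV (\<lambda>y. ?p y * snd (snd y))"
      "continuous_on UNIV (\<lambda>y. ?p y / \<mu> (fst y))"
    using \<mu>(2) by (auto intro!: continuous_on_compose2[OF cont] continuous_on_compose2[OF \<psi>(2)]
        continuous_on_compose2[OF \<mu>(1)] continuous_intros simp: less_imp_neq[symmetric])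
  note int = integrable_weighted[OF c(1)] integrable_weighted[OF c(2)] integrable_weighted[OF c(3)]
    integrable_weighted[OF c(4)]
  have ints: "integrable (lborel_on B) (\<lambda>y. (S y)\<^sup>2)" "integrable (lborel_on B) (\<lambda>y. (J y)\<^sup>2)"
      "integrable (lborel_on B) (\<lambda>y. ?p' y * S y * S y)" "integrable (lborel_on B) (\<lambda>y. ?p' y * J y * J y)"
      "integrable (lborel_on B) (\<lambda>y. ?p y * D y * D y)" "integrable (lborel_on B) (\<lambda>y. ?p y / \<mu> (fst y) * a y * a y)"
      "integrable (lborel_on B) (\<lambda>y. ?p y * D2 y * D2 y)" "integrable (lborel_on B) (\<lambda>y. ?p y * (W y + a y) * S y)"
      "integrable (lborel_on B) (\<lambda>y. ?p y * St y * S y)" "integrable (lborel_on B) (\<lambda>y. ?p y * Jt y * J y)"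
      "integrable (lborel_on B) (\<lambda>y. ?p y * snd (snd y) * Jx y * S y)"
      "integrable (lborel_on B) (\<lambda>y. ?p y * snd (snd y) * J y * Sx y)"
    by (intro int sq a D D2 square_integrable_power2)+
  have lhs: "\<kappa> * (?I (\<lambda>y. (S y)\<^sup>2) + e * ?I (\<lambda>y. (J y)\<^sup>2)) = ?I (\<lambda>y. \<kappa> * ((S y)\<^sup>2 + e * (J y)\<^sup>2))"
    using ints(1,2) by simp
  define rhs where "rhs = (\<lambda>y. - (?p' y * S y * S y) - e * (?p' y * J y * J y) + ?p y * D y * D y + ?p y / \<mu> (fst y) * a y * a y
        + 1/2 * (?p y * D2 y * D2 y) - 2 * (?p y * (W y + a y) * S y) - 2 * (?p y * St y * S y)
        - 2 * e * (?p y * Jt y * J y) - 2 * (?p y * snd (snd y) * Jx y * S y) - 2 * (?p y * snd (snd y) * J y * Sx y))"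
  have "?I (\<lambda>y. \<kappa> * ((S y)\<^sup>2 + e * (J y)\<^sup>2)) \<le> ?I rhs"
  proof (rule integral_mono_AE)
    show "integrable (lborel_on B) (\<lambda>y. \<kappa> * ((S y)\<^sup>2 + e * (J y)\<^sup>2))" using ints(1,2) by simp
    show "integrable (lborel_on B) rhs"
      unfolding rhs_def by (intro Bochner_Integration.integrable_diff Bochner_Integration.integrable_add
          Bochner_Integration.integrable_minus integrable_mult_right ints)
    show "AE y in lborel_on B. \<kappa> * ((S y)\<^sup>2 + e * (J y)\<^sup>2) \<le> rhs y"
      using AE_space eqS eqJ
    proof eventually_elim
      case (elim y)
      then have "0 < fst y" "fst y < T" by (auto simp: space_restrict_space)
      then show ?case
        using \<psi>(4) dec \<mu>(2) e elim(2,3) unfolding rhs_def by (intro energy_density_bound) auto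
    qed
  qed
  also have "?I rhs = - ?I (\<lambda>y. ?p' y * S y * S y) - e * ?I (\<lambda>y. ?p' y * J y * J y) + ?I (\<lambda>y. ?p y * D y * D y)
        + ?I (\<lambda>y. ?p y / \<mu> (fst y) * a y * a y) + 1/2 * ?I (\<lambda>y. ?p y * D2 y * D2 y)
        - 2 * ?I (\<lambda>y. ?p y * (W y + a y) * S y) - 2 * ?I (\<lambda>y. ?p y * St y * S y) - 2 * e * ?I (\<lambda>y. ?p y * Jt y * J y)
        - 2 * ?I (\<lambda>y. ?p y * snd (snd y) * Jx y * S y) - 2 * ?I (\<lambda>y. ?p y * snd (snd y) * J y * Sx y)"
    unfolding rhs_def using ints by (simp del: times_divide_eq_left times_divide_eq_right)
  finally have main: "\<kappa> * (?I (\<lambda>y. (S y)\<^sup>2) + e * ?I (\<lambda>y. (J y)\<^sup>2)) \<le> \<dots>" unfolding lhs .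
  have comm: "?I (\<lambda>y. ?p y * S y * St y) = ?I (\<lambda>y. ?p y * St y * S y)" "?I (\<lambda>y. ?p y * J y * Jt y) = ?I (\<lambda>y. ?p y * Jt y * J y)"
    by (simp_all add: mult.commute mult.left_commute)
  have t1: "?I (\<lambda>y. ?p' y * S y * S y) + 2 * ?I (\<lambda>y. ?p y * St y * S y) = - \<psi> 0 * (\<integral>p. (S0 p)\<^sup>2 \<partial>lborel_on XV)"
    using product_rule_t[OF \<psi>(1-3) S0 S0] comm by (simp add: power2_eq_square)
  have t2: "?I (\<lambda>y. ?p' y * J y * J y) + 2 * ?I (\<lambda>y. ?p y * Jt y * J y) = - \<psi> 0 * (\<integral>p. (J0 p)\<^sup>2 \<partial>lborel_on XV)"
    using product_rule_t[OF \<psi>(1-3) J0 J0] comm by (simp add: power2_eq_square)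
  have x: "?I (\<lambda>y. ?p y * snd (snd y) * Jx y * S y) + ?I (\<lambda>y. ?p y * snd (snd y) * J y * Sx y)
      = (\<integral>p. \<psi> (fst p) * snd p * JR p * SR p \<partial>lborel_on TV) - (\<integral>p. \<psi> (fst p) * snd p * JL p * SL p \<partial>lborel_on TV)"
    by (rule product_rule_x[OF \<psi>(1) JL JR SL SR])
  have fl: "\<bar>\<integral>p. \<psi> (fst p) * snd p * JR p * SR p \<partial>lborel_on TV\<bar>
      \<le> T / 2 * ((\<integral>p. (JR p)\<^sup>2 \<partial>lborel_on TV) + (\<integral>p. (SR p)\<^sup>2 \<partial>lborel_on TV))"
    "\<bar>\<integral>p. \<psi> (fst p) * snd p * JL p * SL p \<partial>lborel_on TV\<bar>
      \<le> T / 2 * ((\<integral>p. (JL p)\<^sup>2 \<partial>lborel_on TV) + (\<integral>p. (SL p)\<^sup>2 \<partial>lborel_on TV))"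
    by (intro boundary_flux_bound cont \<psi>(4) sq; assumption)+
  have pT: "?I (\<lambda>y. ?p y * f y * f y) \<le> T * ?I (\<lambda>y. (f y)\<^sup>2)" if f: "square_integrable (lborel_on B) f" for f
  proof -
    have "?I (\<lambda>y. ?p y * f y * f y) \<le> ?I (\<lambda>y. T * (f y)\<^sup>2)"
    proof (rule integral_mono)
      show "integrable (lborel_on B) (\<lambda>y. ?p y * f y * f y)" by (intro int f)
      show "integrable (lborel_on B) (\<lambda>y. T * (f y)\<^sup>2)" using f by (simp add: square_integrable_def)
      show "?p y * f y * f y \<le> T * (f y)\<^sup>2" if "y \<in> space (lborel_on B)" for y
        using \<psi>(4)[of "fst y"] that
        by (auto simp: space_restrict_space power2_eq_square mult.assoc intro!: mult_right_mono)
    qed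
    then show ?thesis by simp
  qed
  \<comment> \<open>The identity \<open>t2\<close> in the form, multiplied by \<open>e\<close>, in
    which it occurs in \<open>main\<close>.\<close>
  have "e * ?I (\<lambda>y. ?p' y * J y * J y) + 2 * e * ?I (\<lambda>y. ?p y * Jt y * J y) = - \<psi> 0 * (e * (\<integral>p. (J0 p)\<^sup>2 \<partial>lborel_on XV))"
    using arg_cong[OF t2, of "\<lambda>x. e * x"] by (simp add: algebra_simps)
  with main t1 x fl pT[OF D] pT[OF D2] coercive show ?thesis
    by (simp add: abs_le_iff algebra_simps)
qed

end

section \<open>Velocity averages and time weights\<close>

lemma avg_continuous_eq:
  assumes "continuous_on UNIV g"
  shows "avg g = integral {0..1} g"
proof -
  have "set_integrable lborel {0..1} g"
    using assms by (intro borel_integrable_atLeastAtMost') (auto intro: continuous_on_subset)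
  then show ?thesis
    unfolding avg_def by (rule set_borel_integral_eq_integral)
qed

lemma integrable_unit_continuous:
  "continuous_on UNIV g \<Longrightarrow> integrable (lborel_on {0<..<1::real}) (g :: real \<Rightarrow> real)"
  by (intro square_integrable_continuous(3)) auto

lemma measure_lborel_on_unit: "measure (lborel_on {0<..<1::real}) {0<..<1} = 1"
  by (simp add: measure_restrict_space)

lemma avg_add:
  assumes "integrable (lborel_on {0<..<1}) f" "integrable (lborel_on {0<..<1}) h"
  shows "avg (\<lambda>v. f v + h v) = avg f + avg h"
  using assms by (simp add: avg_eq)

lemma avg_const: "avg (\<lambda>_. c) = c"
  by (simp add: avg_eq measure_lborel_on_unit)

lemma avg_cmult: "avg (\<lambda>v. c * f v) = c * avg f"
  by (simp add: avg_eq)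

text \<open>
  No integrability is needed: if \<open>f\<close> is not integrable, then neither is \<open>f - avg f\<close>, and both
  averages have the junk value 0.
\<close>

lemma avg_diff_avg: "avg (\<lambda>v. f v - avg f) = 0"
proof (cases "integrable (lborel_on {0<..<1}) f")
  case True
  then show ?thesis
    using integrable_unit_continuous[OF continuous_on_const, of "avg f"]
    by (simp add: avg_eq measure_lborel_on_unit)
next
  case False
  then have "avg f = 0" by (simp add: avg_eq not_integrable_integral_eq)
  then show ?thesis by simp
qed

lemma continuous_on_avg:
  assumes u: "continuous_on UNIV (u :: real \<times> real \<times> real \<Rightarrow> real)"
  shows "continuous_on UNIV (\<lambda>z::real \<times> real \<times> real. avg (\<lambda>s. u (fst z, fst (snd z), s)))"
proof -
  have "continuous_on UNIV (\<lambda>z::real \<times> real \<times> real. integral (cbox 0 1) (\<lambda>s. u (fst z, fst (snd z), s)))"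
    by (rule integral_continuous_on_param)
       (auto simp: case_prod_unfold intro!: continuous_on_compose2[OF u] continuous_intros)
  moreover have "avg (\<lambda>s. u (t, x, s)) = integral {0..1} (\<lambda>s. u (t, x, s))" for t x
    by (intro avg_continuous_eq continuous_on_compose2[OF u] continuous_intros) auto
  ultimately show ?thesis by (simp add: cbox_interval)
qed

text \<open>Differentiation under the integral sign, carried out for the gauge integral, with which
  \<open>avg\<close> agrees on continuous functions. The average is kept as a function of (t, x, v),
  constant in v, so that the product rule on the slab applies to it.\<close>

lemma C1_along_avg:
  assumes u: "C1_along (1,0,0) u u'"
  shows "C1_along (1,0,0) (\<lambda>z::real \<times> real \<times> real. avg (\<lambda>s. u (fst z, fst (snd z), s)))
     (\<lambda>z. avg (\<lambda>s. u' (fst z, fst (snd z), s)))"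
  unfolding C1_along_def
proof (intro conjI allI)
  have c: "continuous_on UNIV u" "continuous_on UNIV u'" using u by (auto simp: C1_along_def)
  show "continuous_on UNIV (\<lambda>z::real \<times> real \<times> real. avg (\<lambda>s. u (fst z, fst (snd z), s)))"
    "continuous_on UNIV (\<lambda>z::real \<times> real \<times> real. avg (\<lambda>s. u' (fst z, fst (snd z), s)))"
    by (intro continuous_on_avg c)+
  fix z :: "real \<times> real \<times> real"
  obtain t x v where z: "z = (t, x, v)" by (cases z)
  have av: "avg (\<lambda>s. u (t, x, s)) = integral (cbox 0 1) (\<lambda>s. u (t, x, s))"
      "avg (\<lambda>s. u' (t, x, s)) = integral (cbox 0 1) (\<lambda>s. u' (t, x, s))" for t
    unfolding cbox_interval
    by (intro avg_continuous_eq continuous_on_compose2[OF c(1)] continuous_on_compose2[OF c(2)] continuous_intros; simp)+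
  have "((\<lambda>r. integral (cbox 0 1) (\<lambda>s. u (t + r, x, s))) has_real_derivative
      integral (cbox 0 1) (\<lambda>s. u' (t + 0, x, s))) (at 0 within UNIV)"
  proof (rule leibniz_rule_field_derivative)
    show "((\<lambda>r. u (t + r, x, s)) has_real_derivative u' (t + r, x, s)) (at r within UNIV)" for r s
      using C1_along_line[OF u, of "(t, x, s)" r] by simp
    show "(\<lambda>s. u (t + r, x, s)) integrable_on cbox 0 1" for r
      by (intro integrable_continuous continuous_on_compose2[OF c(1)] continuous_intros) auto
    show "continuous_on (UNIV \<times> cbox 0 1) (\<lambda>(r, s). u' (t + r, x, s))"
      by (auto simp: case_prod_unfold intro!: continuous_on_compose2[OF c(2)] continuous_intros)
  qed auto
  then show "((\<lambda>r. avg (\<lambda>s. u (fst (z + r *\<^sub>R (1,0,0)), fst (snd (z + r *\<^sub>R (1,0,0))), s)))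
      has_real_derivative avg (\<lambda>s. u' (fst z, fst (snd z), s))) (at 0)"
    by (simp add: z av)
qed

section \<open>Vanishing averages and the relaxation equation on the slab\<close>

context slab
begin

text \<open>The form in which orthogonality is used: a factor depending on (t, x) only comes out of
  the velocity average. Integrability is asked of the product alone, so the factor may be
  arbitrary.\<close>

lemma integral_zero_of_factor_avg_zero:
  assumes f: "integrable (lborel_on B) f" and c: "\<And>t x v. f (t, x, v) = c t x * h (t, x, v)"
    and h: "AE t in lborel_on {0<..<T}. AE x in lborel_on {xL<..<xR}. avg (\<lambda>v. h (t, x, v)) = 0"
  shows "integral\<^sup>L (lborel_on B) f = 0"
proof (rule integral_zero_of_avg_zero[OF f])
  show "AE t in lborel_on {0<..<T}. AE x in lborel_on {xL<..<xR}. avg (\<lambda>v. f (t, x, v)) = 0"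
    using h
  proof eventually_elim
    case (elim t)
    then show ?case by eventually_elim (simp add: c avg_cmult)
  qed
qed

text \<open>Pythagoras in the velocity variable: the average \<open>A\<close> is orthogonal to
  \<open>u - A\<close>.\<close>

lemma integral_avg_power2_le:
  assumes u: "continuous_on UNIV u"
  defines "A \<equiv> \<lambda>z::real \<times> real \<times> real. avg (\<lambda>s. u (fst z, fst (snd z), s))"
  shows "(\<integral>z. (A z)\<^sup>2 \<partial>lborel_on B) \<le> (\<integral>z. (u z)\<^sup>2 \<partial>lborel_on B)"
proof -
  have A: "continuous_on UNIV A" unfolding A_def by (rule continuous_on_avg[OF u])
  have "(\<integral>z. A z * (u z - A z) \<partial>lborel_on B) = 0"
  proof (rule integral_zero_of_avg_zero)
    show "integrable (lborel_on B) (\<lambda>z. A z * (u z - A z))"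
      by (intro integrable_cont continuous_intros A u)
    have "avg (\<lambda>v. A (t, x, v) * (u (t, x, v) - A (t, x, v))) = 0" for t x
      using avg_diff_avg[of "\<lambda>v. u (t, x, v)"] by (simp add: A_def avg_cmult)
    then show "AE t in lborel_on {0<..<T}. AE x in lborel_on {xL<..<xR}. avg (\<lambda>v. A (t, x, v) * (u (t, x, v) - A (t, x, v))) = 0"
      by simp
  qed
  moreover have "(\<integral>z. (u z)\<^sup>2 \<partial>lborel_on B) =
      (\<integral>z. (A z)\<^sup>2 + 2 * (A z * (u z - A z)) + (u z - A z)\<^sup>2 \<partial>lborel_on B)"
    by (rule Bochner_Integration.integral_cong) (auto simp: power2_eq_square algebra_simps)
  moreover have "integrable (lborel_on B) (\<lambda>z. (A z)\<^sup>2)" "integrable (lborel_on B) (\<lambda>z. A z * (u z - A z))"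
      "integrable (lborel_on B) (\<lambda>z. (u z - A z)\<^sup>2)"
    by (intro integrable_cont continuous_intros A u)+
  ultimately show ?thesis by simp
qed

text \<open>The equation is tested with \<open>\<omega> * a\<close>, and
  \<open>\<omega> T = 0\<close> leaves only the initial value. The condition
  \<open>e * \<omega>' t \<le> \<omega> t\<close> lets the weight grow, but no faster than the
  relaxation itself damps.\<close>

lemma relaxation_estimate:
  assumes e: "0 < e" and a: "C1_along (1,0,0) a a'"
    and \<omega>: "\<And>t. (\<omega> has_real_derivative \<omega>' t) (at t)" "continuous_on UNIV \<omega>'" "\<omega> T = 0"
      "\<And>t. 0 < t \<Longrightarrow> t < T \<Longrightarrow> 0 \<le> \<omega> t \<and> \<omega> t \<le> T \<and> e * \<omega>' t \<le> \<omega> t"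
    and g: "\<And>z. e * a' z + a z = g z"
  shows "(\<integral>z. \<omega> (fst z) * a z * a z \<partial>lborel_on B)
    \<le> 2 * e * \<omega> 0 * (\<integral>p. (a (\<sigma>\<^sub>0 p))\<^sup>2 \<partial>lborel_on XV) + 4 * T * (\<integral>z. (g z)\<^sup>2 \<partial>lborel_on B)"
proof -
  have ca: "continuous_on UNIV a" "continuous_on UNIV a'" using a by (auto simp: C1_along_def)
  have cg: "continuous_on UNIV g" unfolding g[symmetric] by (intro continuous_intros ca)
  have "continuous_on UNIV \<omega>" using \<omega>(1) by (meson DERIV_continuous_on has_field_derivative_at_within)
  then have c: "continuous_on UNIV (\<lambda>z::real \<times> real \<times> real. \<omega> (fst z))"
      "continuous_on UNIV (\<lambda>z::real \<times> real \<times> real. \<omega>' (fst z))"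
    by (auto intro!: continuous_on_compose2[of UNIV \<omega>] continuous_on_compose2[OF \<omega>(2)] continuous_intros)
  have tr: "H1_trace_along B XV \<sigma>\<^sub>0 (1,0,0) a a' (\<lambda>p. a (\<sigma>\<^sub>0 p))"
    by (intro H1_trace_along_C1 a borel_boxes bounded_boxes continuous_faces)
  have comm: "(\<integral>z. \<omega> (fst z) * a' z * a z \<partial>lborel_on B) = (\<integral>z. \<omega> (fst z) * a z * a' z \<partial>lborel_on B)"
    by (simp add: mult.commute mult.left_commute)
  have "(\<integral>z. \<omega> (fst z) * a z * a z \<partial>lborel_on B)
    \<le> (\<integral>z. 4 * T * (g z)\<^sup>2 - 2 * e * (\<omega>' (fst z) * a z * a z) - 4 * e * (\<omega> (fst z) * a z * a' z) \<partial>lborel_on B)"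
  proof (rule integral_mono)
    fix z assume "z \<in> space (lborel_on B)"
    then have w: "0 \<le> \<omega> (fst z)" "\<omega> (fst z) \<le> T" "e * \<omega>' (fst z) \<le> \<omega> (fst z)"
      using \<omega>(4)[of "fst z"] by (auto simp: space_restrict_space)
    \<comment> \<open>With \<open>e * a' = g - a\<close>, right side minus left side equals 4 (T -
      \<open>\<omega>\<close>) g^2 + \<open>\<omega>\<close> (2 g - a)^2 + 2
      (\<open>\<omega>\<close> - e \<open>\<omega>'\<close>) a^2, and each summand is
      nonnegative.\<close>
    have "\<omega> (fst z) * (g z)\<^sup>2 \<le> T * (g z)\<^sup>2" using w by (intro mult_right_mono) auto
    moreover have "e * \<omega>' (fst z) * (a z)\<^sup>2 \<le> \<omega> (fst z) * (a z)\<^sup>2" using w by (intro mult_right_mono) auto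
    moreover have "0 \<le> \<omega> (fst z) * (2 * g z - a z)\<^sup>2" using w by simp
    moreover have "e * (\<omega> (fst z) * a z * a' z) = \<omega> (fst z) * a z * (g z - a z)"
      using g[of z] by (simp add: algebra_simps flip: g[of z])
    ultimately show "\<omega> (fst z) * a z * a z
      \<le> 4 * T * (g z)\<^sup>2 - 2 * e * (\<omega>' (fst z) * a z * a z) - 4 * e * (\<omega> (fst z) * a z * a' z)"
      by (simp add: power2_eq_square algebra_simps)
  qed (intro integrable_cont continuous_intros c ca cg)+
  also have "\<dots> = 4 * T * (\<integral>z. (g z)\<^sup>2 \<partial>lborel_on B) - 2 * e * (\<integral>z. \<omega>' (fst z) * a z * a z \<partial>lborel_on B)
      - 4 * e * (\<integral>z. \<omega> (fst z) * a z * a' z \<partial>lborel_on B)"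
  proof -
    have "integrable (lborel_on B) (\<lambda>z. (g z)\<^sup>2)" "integrable (lborel_on B) (\<lambda>z. \<omega>' (fst z) * a z * a z)"
        "integrable (lborel_on B) (\<lambda>z. \<omega> (fst z) * a z * a' z)"
      by (intro integrable_cont continuous_intros c ca cg)+
    then show ?thesis by simp
  qed
  also have "\<dots> = 4 * T * (\<integral>z. (g z)\<^sup>2 \<partial>lborel_on B)
      - 2 * e * ((\<integral>z. \<omega>' (fst z) * a z * a z \<partial>lborel_on B) + 2 * (\<integral>z. \<omega> (fst z) * a z * a' z \<partial>lborel_on B))"
    by (simp add: algebra_simps)
  also have "(\<integral>z. \<omega>' (fst z) * a z * a z \<partial>lborel_on B) + 2 * (\<integral>z. \<omega> (fst z) * a z * a' z \<partial>lborel_on B)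
      = - \<omega> 0 * (\<integral>p. (a (\<sigma>\<^sub>0 p))\<^sup>2 \<partial>lborel_on XV)"
    using product_rule_t[OF \<omega>(1-3) tr tr] comm by (simp add: power2_eq_square)
  finally show ?thesis by (simp add: algebra_simps)
qed

end

text \<open>
  The extra factor \<open>exp (exp (- t / e) - 1)\<close>, bounded independently of \<open>e\<close>, is what lets the
  weight absorb a forcing that is of size \<open>1 / e\<close> on an initial layer of width \<open>e\<close>.
\<close>

definition layer_rate :: "real \<Rightarrow> real \<Rightarrow> real" where
  "layer_rate e t = 1 + exp (- t / e) / e"

text \<open>The factor \<open>T - t\<close> removes the trace at \<open>T\<close>, and its
  derivative leaves a strictly positive surplus. Rate 2 is one unit for the source term
  \<open>D\<close> and one for the constant part of \<open>layer_rate\<close>. The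
  \<open>- 1\<close> normalises the weight to \<open>T\<close> at time 0.\<close>

definition energy_weight :: "real \<Rightarrow> real \<Rightarrow> real \<Rightarrow> real" where
  "energy_weight T e t = (T - t) * exp (- 2 * t + exp (- t / e) - 1)"

definition energy_weight_deriv :: "real \<Rightarrow> real \<Rightarrow> real \<Rightarrow> real" where
  "energy_weight_deriv T e t =
     - exp (- 2 * t + exp (- t / e) - 1) - (1 + layer_rate e t) * energy_weight T e t"

definition layer_weight_deriv :: "real \<Rightarrow> real \<Rightarrow> real \<Rightarrow> real" where
  "layer_weight_deriv T e t = energy_weight_deriv T e t / layer_rate e t
     + energy_weight T e t * (exp (- t / e) / e\<^sup>2) / (layer_rate e t)\<^sup>2"

lemma layer_rate_pos: "0 < e \<Longrightarrow> 0 < layer_rate e t"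
  by (simp add: layer_rate_def add_pos_pos)

lemma energy_weight_has_deriv:
  assumes "0 < e"
  shows "(energy_weight T e has_real_derivative energy_weight_deriv T e t) (at t)"
  using assms unfolding energy_weight_def[abs_def] energy_weight_deriv_def layer_rate_def
  by (auto intro!: derivative_eq_intros simp: field_simps)

lemma layer_weight_has_deriv:
  assumes "0 < e"
  shows "((\<lambda>t. energy_weight T e t / layer_rate e t) has_real_derivative layer_weight_deriv T e t) (at t)"
proof -
  have "(layer_rate e has_real_derivative - (exp (- t / e) / e\<^sup>2)) (at t)"
    using assms unfolding layer_rate_def[abs_def]
    by (auto intro!: derivative_eq_intros simp: power2_eq_square)
  from DERIV_divide[OF energy_weight_has_deriv[OF assms] this] layer_rate_pos[OF assms, of t]
  show ?thesis by (simp add: layer_weight_deriv_def power2_eq_square add_divide_distrib)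
qed

lemma continuous_layer_rate: "0 < e \<Longrightarrow> continuous_on UNIV (layer_rate e)"
  unfolding layer_rate_def[abs_def] by (auto intro!: continuous_intros)

lemma continuous_energy_weight_deriv: "0 < e \<Longrightarrow> continuous_on UNIV (energy_weight_deriv T e)"
  unfolding energy_weight_deriv_def[abs_def] layer_rate_def energy_weight_def
  by (auto intro!: continuous_intros)

lemma continuous_layer_weight_deriv: "0 < e \<Longrightarrow> continuous_on UNIV (layer_weight_deriv T e)"
  unfolding layer_weight_deriv_def[abs_def] energy_weight_def
  using layer_rate_pos[of e]
  by (auto intro!: continuous_intros continuous_layer_rate continuous_energy_weight_deriv
      simp: less_imp_neq[symmetric])

lemma energy_weight_bounds:
  assumes "0 < e" "0 < t" "t < T"
  shows "0 \<le> energy_weight T e t" "energy_weight T e t \<le> T"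
proof -
  show "0 \<le> energy_weight T e t" using assms by (simp add: energy_weight_def)
  have "- t / e \<le> 0" using assms by simp
  then have "exp (- t / e) \<le> 1" by (simp only: exp_le_one_iff)
  then have "- 2 * t + exp (- t / e) - 1 \<le> 0" using assms(2) by linarith
  then have "exp (- 2 * t + exp (- t / e) - 1) \<le> 1" by (simp only: exp_le_one_iff)
  then have "energy_weight T e t \<le> T * 1"
    unfolding energy_weight_def using assms by (intro mult_mono) auto
  then show "energy_weight T e t \<le> T" by simp
qed

text \<open>The surplus is the term from differentiating \<open>T - t\<close>; before time
  \<open>T\<close> its exponent is at least \<open>- 2 * T - 1\<close>, whatever the value of
  \<open>e\<close>. This is the constant in front of the energy.\<close>

lemma energy_weight_decay:
  assumes "t < T"
  shows "exp (- 2 * T - 1) + (1 + layer_rate e t) * energy_weight T e t \<le> - energy_weight_deriv T e t"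
proof -
  have "exp (- 2 * T - 1) \<le> exp (- 2 * t + exp (- t / e) - 1)"
    unfolding exp_le_cancel_iff using assms exp_ge_zero[of "- t / e"] by linarith
  then show ?thesis by (simp add: energy_weight_deriv_def)
qed

text \<open>For the last bound: in the quotient rule the term with
  \<open>energy_weight_deriv\<close> is nonpositive, and \<open>layer_rate\<close> decays at a
  relative rate of at most 1 / e, because \<open>exp (- t / e) / e\<close> is one of its two
  summands.\<close>

lemma layer_weight_bounds:
  assumes e: "0 < e" and t: "0 < t" "t < T"
  shows "0 \<le> energy_weight T e t / layer_rate e t" "energy_weight T e t / layer_rate e t \<le> T"
    "e * layer_weight_deriv T e t \<le> energy_weight T e t / layer_rate e t"
proof -
  note w = energy_weight_bounds[OF e t] and r = layer_rate_pos[OF e, of t]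
  have r1: "1 \<le> layer_rate e t" using e by (simp add: layer_rate_def)
  show "0 \<le> energy_weight T e t / layer_rate e t" using w r by simp
  have "energy_weight T e t / layer_rate e t \<le> energy_weight T e t / 1"
    using w r1 by (intro divide_left_mono) auto
  then show "energy_weight T e t / layer_rate e t \<le> T" using w by simp
  have "energy_weight_deriv T e t \<le> 0"
    using energy_weight_decay[OF t(2), of e] w r exp_ge_zero[of "- 2 * T - 1"]
      mult_nonneg_nonneg[of "1 + layer_rate e t" "energy_weight T e t"] by linarith
  then have "e * (energy_weight_deriv T e t / layer_rate e t) \<le> 0"
    using e r by (simp add: mult_nonneg_nonpos divide_nonpos_pos)
  moreover have "e * (energy_weight T e t * (exp (- t / e) / e\<^sup>2) / (layer_rate e t)\<^sup>2)
      = (energy_weight T e t / layer_rate e t) * ((exp (- t / e) / e) / layer_rate e t)"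
    using e by (simp add: power2_eq_square)
  moreover have "(exp (- t / e) / e) / layer_rate e t \<le> 1"
    unfolding divide_le_eq_1_pos[OF r] by (simp add: layer_rate_def)
  then have "(energy_weight T e t / layer_rate e t) * ((exp (- t / e) / e) / layer_rate e t)
      \<le> (energy_weight T e t / layer_rate e t) * 1"
    using w r by (intro mult_left_mono) auto
  ultimately show "e * layer_weight_deriv T e t \<le> energy_weight T e t / layer_rate e t"
    unfolding layer_weight_deriv_def distrib_left by linarith
qed

text \<open>This is the power of \<open>e\<close> gained from the layer: in
  \<open>relaxation_estimate\<close> it turns \<open>e\<close> times the initial square into
  \<open>e^2\<close> times it, the power in the initial loss.\<close>

lemma layer_weight_initial:
  assumes "0 < e" "0 < T"
  shows "energy_weight T e 0 / layer_rate e 0 \<le> T * e"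
proof -
  have "energy_weight T e 0 / layer_rate e 0 = T * e / (e + 1)"
    using assms by (simp add: energy_weight_def layer_rate_def field_simps)
  also have "\<dots> \<le> T * e" using assms by (simp add: field_simps)
  finally show ?thesis .
qed

section \<open>Errors and residuals\<close>

lemma measure_lborel_Times:
  fixes A :: "'a::euclidean_space set" and C :: "'b::euclidean_space set"
  assumes "A \<in> sets borel" "C \<in> sets borel"
  shows "measure lborel (A \<times> C) = measure lborel A * measure lborel C"
  using assms
  by (simp add: measure_def lborel_prod[symmetric] lborel.emeasure_pair_measure_Times enn2real_mult)

lemma Basis_TD: "(1, 0) \<in> (Basis :: (real \<times> real) set)" "(0, 1) \<in> (Basis :: (real \<times> real) set)"
  by (auto simp: Basis_prod_def)

lemma Basis_TDV: "(1, 0, 0) \<in> (Basis :: (real \<times> real \<times> real) set)"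
    "(0, 1, 0) \<in> (Basis :: (real \<times> real \<times> real) set)"
  by (auto simp: Basis_prod_def zero_prod_def)

lemma H1_trace_along_error:
  assumes "has_trace U u P \<sigma> g" "u \<in> H1 U" "b \<in> Basis" "smooth u\<theta>"
    and "U \<in> sets borel" "bounded U" and "P \<in> sets borel" "bounded P" and "continuous_on UNIV \<sigma>"
  shows "H1_trace_along U P \<sigma> b (\<lambda>z. u z - u\<theta> z)
    (\<lambda>z. weak_partial U b u z - partial_deriv b u\<theta> z) (\<lambda>p. g p - u\<theta> (\<sigma> p))"
  using assms by (intro H1_trace_along_diff H1_trace_along_has_trace H1_trace_along_C1 C1_along_smooth)

section \<open>The iterated integrals of the losses as integrals over boxes\<close>

context slab
begin

lemma integral_XV_iterated:
  assumes "integrable (lborel_on XV) f"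
  shows "integral\<^sup>L (lborel_on XV) f = (LINT x:{xL<..<xR}|lborel. LINT v:{0..1}|lborel. (f (x, v) :: real))"
  using Fubini_lborel_on(1)[OF _ _ assms]
  by (simp add: set_lebesgue_integral_eq_restrict flip: avg_def) (simp add: avg_eq)

lemma integral_B_iterated':
  fixes f :: "real \<times> real \<times> real \<Rightarrow> real"
  assumes "integrable (lborel_on B) f"
  shows "integral\<^sup>L (lborel_on B) f =
    (LINT t:{0<..<T}|lborel. LINT x:{xL<..<xR}|lborel. LINT v:{0..1}|lborel. f (t, x, v))"
  using integral_B_iterated[OF assms]
  by (simp add: set_lebesgue_integral_eq_restrict flip: avg_def)

lemma boundary_sum_iterated:
  fixes F :: "real \<Rightarrow> real \<times> real \<Rightarrow> real"
  assumes "integrable (lborel_on TV) (F xL)" "integrable (lborel_on TV) (F xR)"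
  shows "(LINT t:{0<..<T}|lborel. \<Sum>x\<in>{xL,xR}. LINT v:{0..1}|lborel. F x (t, v))
    = integral\<^sup>L (lborel_on TV) (F xL) + integral\<^sup>L (lborel_on TV) (F xR)"
  using xL_less Fubini_lborel_on(4)[OF _ _ assms(1)] Fubini_lborel_on(4)[OF _ _ assms(2)]
    Fubini_lborel_on(1)[OF _ _ assms(1)] Fubini_lborel_on(1)[OF _ _ assms(2)]
  by (simp add: set_lebesgue_integral_eq_restrict avg_eq flip: avg_def)

lemma box_measures:
  "measure lborel ({0<..<T} \<times> {xL<..<xR}) = T * (xR - xL)"
  "measure lborel ({0<..<T} \<times> {xL<..<xR} \<times> {0..1::real}) = T * (xR - xL)"
  "measure lborel ({xL<..<xR} \<times> {0..1::real}) = xR - xL"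
  "measure lborel {xL<..<xR} = xR - xL" "measure lborel {0<..<T} = T"
  using T_pos xL_less by (simp_all add: measure_lborel_Times borel_Times)

end

section \<open>Errors, traces and residuals of one solution and one network at fixed
  \<open>\<epsilon>\<close>\<close>

locale parity_error = slab +
  fixes \<epsilon> :: real and \<rho> :: "real \<times> real \<Rightarrow> real" and j w :: "real \<times> real \<times> real \<Rightarrow> real"
    and \<rho>IC :: "real \<Rightarrow> real" and jIC wIC :: "real \<times> real \<Rightarrow> real"
    and \<rho>BC :: "real \<times> real \<Rightarrow> real" and jBC wBC :: "real \<times> real \<times> real \<Rightarrow> real"
    and \<rho>\<theta> :: "real \<times> real \<Rightarrow> real" and j\<theta> w\<theta> :: "real \<times> real \<times> real \<Rightarrow> real"
  assumes eps: "0 < \<epsilon>" "\<epsilon> \<le> 1"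
    and system: "solves_parity_system T xL xR \<epsilon> \<rho> j w"
    and initial: "has_initial_data T xL xR \<rho> j w \<rho>IC jIC wIC"
    and boundary: "has_boundary_data T xL xR \<rho> j w \<rho>BC jBC wBC"
    and smooth: "smooth \<rho>\<theta>" "smooth j\<theta>" "smooth w\<theta>"
begin

abbreviation "tx \<equiv> \<lambda>z::real \<times> real \<times> real. (fst z, fst (snd z))"
abbreviation "vel \<equiv> \<lambda>z::real \<times> real \<times> real. snd (snd z)"

abbreviation "\<rho>\<^sub>t \<equiv> weak_partial (TD T xL xR) (1,0) \<rho>"
abbreviation "\<rho>\<^sub>x \<equiv> weak_partial (TD T xL xR) (0,1) \<rho>"
abbreviation "j\<^sub>t \<equiv> weak_partial B (1,0,0) j"
abbreviation "j\<^sub>x \<equiv> weak_partial B (0,1,0) j"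
abbreviation "w\<^sub>t \<equiv> weak_partial B (1,0,0) w"
abbreviation "w\<^sub>x \<equiv> weak_partial B (0,1,0) w"

text \<open>All errors are functions of (t, x, v), also those constant in v, so that
  \<open>S\<close> is a sum on one domain. Derivative errors are a weak derivative minus a classical
  one.\<close>

definition "R z = \<rho> (tx z) - \<rho>\<theta> (tx z)"
definition "Rt z = \<rho>\<^sub>t (tx z) - partial_deriv (1,0) \<rho>\<theta> (tx z)"
definition "Rx z = \<rho>\<^sub>x (tx z) - partial_deriv (0,1) \<rho>\<theta> (tx z)"
definition "J z = j z - j\<theta> z"
definition "Jt z = j\<^sub>t z - partial_deriv (1,0,0) j\<theta> z"
definition "Jx z = j\<^sub>x z - partial_deriv (0,1,0) j\<theta> z"
definition "W z = w z - w\<theta> z"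
definition "Wt z = w\<^sub>t z - partial_deriv (1,0,0) w\<theta> z"
definition "Wx z = w\<^sub>x z - partial_deriv (0,1,0) w\<theta> z"
definition "S z = R z + \<epsilon>\<^sup>2 * W z"
definition "St z = Rt z + \<epsilon>\<^sup>2 * Wt z"
definition "Sx z = Rx z + \<epsilon>\<^sup>2 * Wx z"

definition "R0 p = \<rho>IC (fst p) - \<rho>\<theta> (0, fst p)" for p :: "real \<times> real"
definition "J0 p = jIC p - j\<theta> (\<sigma>\<^sub>0 p)"
definition "W0 p = wIC p - w\<theta> (\<sigma>\<^sub>0 p)"
definition "Rb c p = \<rho>BC (fst p, c) - \<rho>\<theta> (fst p, c)" for p :: "real \<times> real"
definition "Jb c p = jBC (fst p, c, snd p) - j\<theta> (fst p, c, snd p)" for p :: "real \<times> real"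
definition "Wb c p = wBC (fst p, c, snd p) - w\<theta> (fst p, c, snd p)" for p :: "real \<times> real"

definition "D1 z = d1 \<rho>\<theta> j\<theta> (fst z) (fst (snd z))" for z :: "real \<times> real \<times> real"
definition "D2 z = d2 \<epsilon> \<rho>\<theta> j\<theta> w\<theta> (fst z) (fst (snd z)) (snd (snd z))"
definition "D3 z = d3 \<epsilon> j\<theta> w\<theta> (fst z) (fst (snd z)) (snd (snd z))"

text \<open>
  The network need not satisfy \<open>avg w\<theta> = 0\<close>. Its defect is \<open>a\<close>.
\<close>

definition "a z = avg (\<lambda>s. w\<theta> (fst z, fst (snd z), s))" for z :: "real \<times> real \<times> real"
definition "a_t z = avg (\<lambda>s. partial_deriv (1,0,0) w\<theta> (fst z, fst (snd z), s))" for z :: "real \<times> real \<times> real"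
definition "g z = avg (\<lambda>s. D3 (fst z, fst (snd z), s))" for z :: "real \<times> real \<times> real"

lemma in_H1: "\<rho> \<in> H1 (TD T xL xR)" "j \<in> H1 B" "w \<in> H1 B"
  using system by (auto simp: solves_parity_system_def)

lemma continuous_tx: "continuous_on UNIV tx"
  by (intro continuous_intros)

lemma error_trace_t:
  "H1_trace_along B XV \<sigma>\<^sub>0 (1,0,0) R Rt R0"
  "H1_trace_along B XV \<sigma>\<^sub>0 (1,0,0) J Jt J0"
  "H1_trace_along B XV \<sigma>\<^sub>0 (1,0,0) W Wt W0"
proof -
  have "H1_trace_along (TD T xL xR) {xL<..<xR} (\<lambda>x. (0, x)) (1, 0) (\<lambda>z. \<rho> z - \<rho>\<theta> z)
      (\<lambda>z. \<rho>\<^sub>t z - partial_deriv (1,0) \<rho>\<theta> z) (\<lambda>x. \<rho>IC x - \<rho>\<theta> (0, x))"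
    using initial borel_boxes(2) bounded_boxes(2) unfolding has_initial_data_def
    by (intro H1_trace_along_error in_H1 Basis_TD smooth) (auto intro!: continuous_intros)
  from H1_trace_along_lift[OF measure_preserving_TD measure_preserving_X _ _ continuous_tx this, of \<sigma>\<^sub>0 "(1,0,0)"]
  show "H1_trace_along B XV \<sigma>\<^sub>0 (1,0,0) R Rt R0"
    by (auto simp: R_def[abs_def] Rt_def[abs_def] R0_def[abs_def] case_prod_unfold intro!: continuous_intros)
  show "H1_trace_along B XV \<sigma>\<^sub>0 (1,0,0) J Jt J0" "H1_trace_along B XV \<sigma>\<^sub>0 (1,0,0) W Wt W0"
    using initial unfolding has_initial_data_def J_def[abs_def] Jt_def[abs_def] J0_def[abs_def]
      W_def[abs_def] Wt_def[abs_def] W0_def[abs_def]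
    by (intro H1_trace_along_error in_H1 Basis_TDV smooth borel_boxes bounded_boxes continuous_faces; simp)+
qed

lemma error_trace_x:
  assumes c: "c \<in> {xL, xR}"
  shows "H1_trace_along B TV (\<lambda>(t,v). (t,c,v)) (0,1,0) R Rx (Rb c)"
    "H1_trace_along B TV (\<lambda>(t,v). (t,c,v)) (0,1,0) J Jx (Jb c)"
    "H1_trace_along B TV (\<lambda>(t,v). (t,c,v)) (0,1,0) W Wx (Wb c)"
proof -
  have "H1_trace_along (TD T xL xR) {0<..<T} (\<lambda>t. (t, c)) (0, 1) (\<lambda>z. \<rho> z - \<rho>\<theta> z)
      (\<lambda>z. \<rho>\<^sub>x z - partial_deriv (0,1) \<rho>\<theta> z) (\<lambda>t. \<rho>BC (t, c) - \<rho>\<theta> (t, c))"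
    using boundary c borel_boxes(2) bounded_boxes(2) unfolding has_boundary_data_def
    by (intro H1_trace_along_error in_H1 Basis_TD smooth) (auto intro!: continuous_intros)
  from H1_trace_along_lift[OF measure_preserving_TD measure_preserving_T _ _ continuous_tx this, of "\<lambda>(t,v). (t,c,v)" "(0,1,0)"]
  show "H1_trace_along B TV (\<lambda>(t,v). (t,c,v)) (0,1,0) R Rx (Rb c)"
    by (auto simp: R_def[abs_def] Rx_def[abs_def] Rb_def[abs_def] case_prod_unfold intro!: continuous_intros)
  have tr: "has_trace B j TV (\<lambda>(t,v). (t,c,v)) (\<lambda>(t,v). jBC (t,c,v))"
      "has_trace B w TV (\<lambda>(t,v). (t,c,v)) (\<lambda>(t,v). wBC (t,c,v))"
    using boundary c by (auto simp: has_boundary_data_def)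
  have cc: "continuous_on UNIV (\<lambda>(t::real, v::real). (t, c, v))"
    by (auto simp: case_prod_unfold intro!: continuous_intros)
  have "H1_trace_along B TV (\<lambda>(t,v). (t,c,v)) (0,1,0) J Jx (\<lambda>p. (\<lambda>(t,v). jBC (t,c,v)) p - j\<theta> ((\<lambda>(t,v). (t,c,v)) p))"
    "H1_trace_along B TV (\<lambda>(t,v). (t,c,v)) (0,1,0) W Wx (\<lambda>p. (\<lambda>(t,v). wBC (t,c,v)) p - w\<theta> ((\<lambda>(t,v). (t,c,v)) p))"
    unfolding J_def[abs_def] Jx_def[abs_def] W_def[abs_def] Wx_def[abs_def]
    by (rule H1_trace_along_error[OF tr(1) in_H1(2) Basis_TDV(2) smooth(2) borel_boxes(1) bounded_boxes(1)
          borel_boxes(3) bounded_boxes(3) cc],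
        rule H1_trace_along_error[OF tr(2) in_H1(3) Basis_TDV(2) smooth(3) borel_boxes(1) bounded_boxes(1)
          borel_boxes(3) bounded_boxes(3) cc])
  then show "H1_trace_along B TV (\<lambda>(t,v). (t,c,v)) (0,1,0) J Jx (Jb c)"
    "H1_trace_along B TV (\<lambda>(t,v). (t,c,v)) (0,1,0) W Wx (Wb c)"
    by (simp_all add: Jb_def[abs_def] Wb_def[abs_def] case_prod_unfold)
qed

lemma S_trace:
  "H1_trace_along B XV \<sigma>\<^sub>0 (1,0,0) S St (\<lambda>p. R0 p + \<epsilon>\<^sup>2 * W0 p)"
  "c \<in> {xL, xR} \<Longrightarrow> H1_trace_along B TV (\<lambda>(t,v). (t,c,v)) (0,1,0) S Sx (\<lambda>p. Rb c p + \<epsilon>\<^sup>2 * Wb c p)"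
  unfolding S_def[abs_def] St_def[abs_def] Sx_def[abs_def]
  by (intro H1_trace_along_add H1_trace_along_cmult error_trace_t error_trace_x; assumption)+

lemmas error_square_integrable =
  H1_trace_along_square_integrable(1,2)[OF error_trace_t(1)] H1_trace_along_square_integrable(1,2)[OF error_trace_t(2)]
  H1_trace_along_square_integrable(1,2)[OF error_trace_t(3)] H1_trace_along_square_integrable(1,2)[OF S_trace(1)]

lemma network_C1:
  "C1_along (1,0) \<rho>\<theta> (partial_deriv (1,0) \<rho>\<theta>)" "C1_along (0,1) \<rho>\<theta> (partial_deriv (0,1) \<rho>\<theta>)"
  "C1_along (1,0,0) j\<theta> (partial_deriv (1,0,0) j\<theta>)" "C1_along (0,1,0) j\<theta> (partial_deriv (0,1,0) j\<theta>)"
  "C1_along (1,0,0) w\<theta> (partial_deriv (1,0,0) w\<theta>)" "C1_along (0,1,0) w\<theta> (partial_deriv (0,1,0) w\<theta>)"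
  by (intro C1_along_smooth smooth Basis_TD Basis_TDV)+

lemma network_continuous:
  "continuous_on UNIV \<rho>\<theta>" "continuous_on UNIV (partial_deriv (1,0) \<rho>\<theta>)" "continuous_on UNIV (partial_deriv (0,1) \<rho>\<theta>)"
  "continuous_on UNIV j\<theta>" "continuous_on UNIV (partial_deriv (1,0,0) j\<theta>)" "continuous_on UNIV (partial_deriv (0,1,0) j\<theta>)"
  "continuous_on UNIV w\<theta>" "continuous_on UNIV (partial_deriv (1,0,0) w\<theta>)" "continuous_on UNIV (partial_deriv (0,1,0) w\<theta>)"
  using network_C1 by (auto simp: C1_along_def)

lemma residual_continuous: "continuous_on UNIV D1" "continuous_on UNIV D2" "continuous_on UNIV D3"
proof -
  have q: "continuous_on UNIV (\<lambda>z::real \<times> real \<times> real. avg (\<lambda>s. s * partial_deriv (0,1,0) j\<theta> (fst z, fst (snd z), s)))"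
  proof -
    have "continuous_on UNIV (\<lambda>z. vel z * partial_deriv (0,1,0) j\<theta> z)"
      by (intro continuous_intros network_continuous)
    from continuous_on_avg[OF this] show ?thesis by simp
  qed
  have r: "continuous_on UNIV (\<lambda>z::real \<times> real \<times> real. partial_deriv (1,0) \<rho>\<theta> (tx z))"
      "continuous_on UNIV (\<lambda>z::real \<times> real \<times> real. partial_deriv (0,1) \<rho>\<theta> (tx z))"
    by (auto intro!: continuous_on_compose2[OF network_continuous(2)]
        continuous_on_compose2[OF network_continuous(3)] continuous_intros)
  show "continuous_on UNIV D1"
    unfolding D1_def d1_def by (intro continuous_intros q r)
  show "continuous_on UNIV D2" "continuous_on UNIV D3"
    unfolding D2_def d2_def D3_def d3_def prod.collapse by (intro continuous_intros q r network_continuous)+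
qed

lemma a_C1: "C1_along (1,0,0) a a_t"
  unfolding a_def a_t_def by (rule C1_along_avg[OF network_C1(5)])

text \<open>In the average of \<open>d3\<close> the transport part cancels, since it is a function
  minus its own average.\<close>

lemma a_equation: "\<epsilon>\<^sup>2 * a_t z + a z = g z"
proof -
  let ?q = "\<lambda>s. s * partial_deriv (0,1,0) j\<theta> (fst z, fst (snd z), s)"
  have c: "continuous_on UNIV (\<lambda>s. w\<theta> (fst z, fst (snd z), s))"
      "continuous_on UNIV (\<lambda>s. partial_deriv (1,0,0) w\<theta> (fst z, fst (snd z), s))" "continuous_on UNIV ?q"
    by (intro continuous_intros continuous_on_compose2[OF network_continuous(7)]
        continuous_on_compose2[OF network_continuous(8)] continuous_on_compose2[OF network_continuous(6)]; simp)+
  note i = c[THEN integrable_unit_continuous]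
  have "g z = avg (\<lambda>s. (\<epsilon>\<^sup>2 * partial_deriv (1,0,0) w\<theta> (fst z, fst (snd z), s) + w\<theta> (fst z, fst (snd z), s))
      + (?q s - avg ?q))"
    by (simp add: g_def D3_def d3_def algebra_simps)
  also have "\<dots> = \<epsilon>\<^sup>2 * a_t z + a z + avg (\<lambda>s. ?q s - avg ?q)"
    using i integrable_unit_continuous[OF continuous_on_const] unfolding a_def a_t_def
    by (subst avg_add avg_cmult[symmetric]; simp)+
  finally show ?thesis by (simp add: avg_diff_avg)
qed

end

section \<open>Consequences of the parity system for the errors and for the defect
  \<open>a\<close>\<close>

context parity_error
begin

lemma system_AE:
  "AE z in lborel_on (TD T xL xR). \<rho>\<^sub>t z + avg (\<lambda>s. s * j\<^sub>x (fst z, snd z, s)) = 0"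
  "AE z in lborel_on B. \<epsilon>\<^sup>2 * j\<^sub>t z + vel z * \<rho>\<^sub>x (tx z) + \<epsilon>\<^sup>2 * vel z * w\<^sub>x z + j z = 0"
  "AE z in lborel_on B. \<epsilon>\<^sup>2 * w\<^sub>t z + w z + vel z * j\<^sub>x z - avg (\<lambda>s. s * j\<^sub>x (fst z, fst (snd z), s)) = 0"
  "AE z in lborel_on (TD T xL xR). avg (\<lambda>s. w (fst z, snd z, s)) = 0"
proof -
  have B: "B \<inter> space lborel \<in> sets lborel" and TD: "TD T xL xR \<inter> space lborel \<in> sets lborel"
    using borel_boxes by auto
  note sys = system[unfolded solves_parity_system_def Let_def]
  show "AE z in lborel_on (TD T xL xR). \<rho>\<^sub>t z + avg (\<lambda>s. s * j\<^sub>x (fst z, snd z, s)) = 0"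
    unfolding AE_restrict_space_iff[OF TD] using sys by (simp add: case_prod_unfold mem_Times_iff)
  show "AE z in lborel_on B. \<epsilon>\<^sup>2 * j\<^sub>t z + vel z * \<rho>\<^sub>x (tx z) + \<epsilon>\<^sup>2 * vel z * w\<^sub>x z + j z = 0"
    unfolding AE_restrict_space_iff[OF B] using sys by (simp add: case_prod_unfold mem_Times_iff)
  show "AE z in lborel_on B. \<epsilon>\<^sup>2 * w\<^sub>t z + w z + vel z * j\<^sub>x z - avg (\<lambda>s. s * j\<^sub>x (fst z, fst (snd z), s)) = 0"
    unfolding AE_restrict_space_iff[OF B] using sys by (simp add: case_prod_unfold mem_Times_iff)
  show "AE z in lborel_on (TD T xL xR). avg (\<lambda>s. w (fst z, snd z, s)) = 0"
    unfolding AE_restrict_space_iff[OF TD] using sys by (simp add: case_prod_unfold mem_Times_iff)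
qed

text \<open>The averages of \<open>v * j_x\<close> in the first and third equation, and those of the
  network in \<open>d1\<close> and \<open>d3\<close>, cancel pointwise on adding. The first
  equation, known on (t, x), is first lifted to the slab.\<close>

lemma S_equation: "AE z in lborel_on B. St z + vel z * Jx z + W z = - (D1 z + D3 z)"
  using measure_preserving_AE[OF measure_preserving_TD system_AE(1)] system_AE(3)
  by eventually_elim
     (simp add: St_def Rt_def Wt_def Jx_def W_def D1_def D3_def d1_def d3_def algebra_simps)

lemma J_equation: "AE z in lborel_on B. \<epsilon>\<^sup>2 * Jt z + vel z * Sx z + J z = - D2 z"
  using system_AE(2)
  by eventually_elim
     (simp add: Sx_def Rx_def Wx_def Jt_def J_def D2_def d2_def algebra_simps)

lemma exact_square_integrable:
  "square_integrable (lborel_on B) w" "square_integrable (lborel_on B) w\<^sub>t" "square_integrable (lborel_on B) j\<^sub>x"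
  using in_H1 Basis_TDV borel_boxes by (auto simp: H1_def L2_eq_square_integrable[symmetric])

lemma square_integrable_one: "square_integrable (lborel_on B) (\<lambda>_. 1)"
  by (intro square_integrable_continuous borel_boxes bounded_boxes continuous_on_const)

lemma integrable_of_square_integrable:
  assumes "square_integrable (lborel_on B) f"
  shows "integrable (lborel_on B) f"
  using square_integrable_mult[OF square_integrable_one assms] by simp

lemma avg_w: "AE t in lborel_on {0<..<T}. AE x in lborel_on {xL<..<xR}. avg (\<lambda>s. w (t, x, s)) = 0"
  using AE_lborel_on_Times[OF _ _ system_AE(4)] by simp

text \<open>Read off from the third equation: in its average \<open>w\<close> drops out by
  \<open>avg_w\<close>, and \<open>v * j_x\<close> minus its average drops out as well, leaving
  \<open>\<epsilon>^2\<close> times the claim. Thus the weak time derivative need not be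
  interchanged with the velocity average.\<close>

lemma avg_w_t: "AE t in lborel_on {0<..<T}. AE x in lborel_on {xL<..<xR}. avg (\<lambda>s. w\<^sub>t (t, x, s)) = 0"
proof -
  have "continuous_on UNIV vel" by (intro continuous_intros)
  from integrable_weighted[OF this square_integrable_one exact_square_integrable(3)]
  have i: "integrable (lborel_on B) w" "integrable (lborel_on B) w\<^sub>t" "integrable (lborel_on B) (\<lambda>z. vel z * j\<^sub>x z)"
    using exact_square_integrable by (auto intro: integrable_of_square_integrable)
  note all = AE_slice[OF system_AE(3)] avg_w i[THEN AE_integrable_slice]
  show ?thesis
    using all
  proof eventually_elim
    case (elim t)
    then show ?case
    proof eventually_elim
      case (elim x)
      let ?q = "\<lambda>s. s * j\<^sub>x (t, x, s)"
      have iq: "integrable (lborel_on {0<..<1}) (\<lambda>s. - 1 * (?q s - avg ?q))"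
        using elim(5) integrable_unit_continuous[OF continuous_on_const] by simp
      have "\<epsilon>\<^sup>2 * avg (\<lambda>s. w\<^sub>t (t, x, s)) = avg (\<lambda>s. \<epsilon>\<^sup>2 * w\<^sub>t (t, x, s))"
        by (simp add: avg_cmult)
      also have "\<dots> = avg (\<lambda>s. - 1 * w (t, x, s) + - 1 * (?q s - avg ?q))"
        unfolding avg_eq
      proof (rule integral_cong_AE)
        show "AE s in lborel_on {0<..<1}. \<epsilon>\<^sup>2 * w\<^sub>t (t, x, s)
          = - 1 * w (t, x, s) + - 1 * (?q s - integral\<^sup>L (lborel_on {0<..<1}) ?q)"
          using elim(1) by eventually_elim (simp add: avg_eq)
      qed (use elim iq in \<open>auto simp: avg_eq intro!: borel_measurable_integrable\<close>)
      also have "\<dots> = avg (\<lambda>s. - 1 * w (t, x, s)) + avg (\<lambda>s. - 1 * (?q s - avg ?q))"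
        using elim(3) iq by (intro avg_add) auto
      also have "\<dots> = 0"
        using elim(2) avg_diff_avg[of ?q] by (simp only: avg_cmult)
      finally show "avg (\<lambda>s. w\<^sub>t (t, x, s)) = 0" using eps by simp
    qed
  qed
qed

lemma a_continuous: "continuous_on UNIV a" "continuous_on UNIV a_t"
  using a_C1 by (auto simp: C1_along_def)

lemma network_slice: "continuous_on UNIV (\<lambda>s. w\<theta> (t, x, s))"
  by (intro continuous_on_compose2[OF network_continuous(7)] continuous_intros) auto

lemma avg_W_defect:
  "AE t in lborel_on {0<..<T}. AE x in lborel_on {xL<..<xR}. avg (\<lambda>s. W (t, x, s) + a (t, x, s)) = 0"
  using avg_w AE_integrable_slice[OF integrable_of_square_integrable[OF exact_square_integrable(1)]]
proof eventually_elim
  case (elim t)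
  then show ?case
  proof eventually_elim
    case (elim x)
    let ?d = "\<lambda>s. - 1 * (w\<theta> (t, x, s) - avg (\<lambda>s. w\<theta> (t, x, s)))"
    have "integrable (lborel_on {0<..<1}) ?d"
      by (intro integrable_unit_continuous continuous_intros network_slice)
    then have "avg (\<lambda>s. w (t, x, s) + ?d s) = avg (\<lambda>s. w (t, x, s)) + avg ?d"
      using elim by (intro avg_add) auto
    also have "\<dots> = 0" using elim avg_diff_avg[of "\<lambda>s. w\<theta> (t, x, s)"] by (simp only: avg_cmult)
    finally show ?case by (simp add: W_def a_def algebra_simps)
  qed
qed

text \<open>Write \<open>S\<close> as (\<open>R\<close> - \<open>\<epsilon>^2\<close>
  \<open>a\<close>) + \<open>\<epsilon>^2\<close> (\<open>W\<close> + \<open>a\<close>). The first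
  bracket does not depend on v and \<open>W\<close> + \<open>a\<close> has zero average, so the
  integral equals \<open>\<epsilon>^2\<close> times the weighted square of \<open>W\<close> +
  \<open>a\<close>.\<close>

lemma coercivity:
  assumes \<psi>: "continuous_on UNIV \<psi>" "\<And>t. 0 < t \<Longrightarrow> t < T \<Longrightarrow> 0 \<le> \<psi> t"
  shows "0 \<le> (\<integral>y. \<psi> (fst y) * (W y + a y) * S y \<partial>lborel_on B)"
proof -
  have c: "continuous_on UNIV (\<lambda>y::real \<times> real \<times> real. \<psi> (fst y))"
    by (auto intro!: continuous_on_compose2[OF \<psi>(1)] continuous_intros)
  have sqa: "square_integrable (lborel_on B) a"
    by (intro square_integrable_continuous borel_boxes bounded_boxes a_continuous)
  define P where "P = (\<lambda>y. W y + a y)"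
  have P: "square_integrable (lborel_on B) P"
    unfolding P_def by (intro square_integrable_add error_square_integrable sqa)
  have Q: "square_integrable (lborel_on B) (\<lambda>y. R y - \<epsilon>\<^sup>2 * a y)"
    by (intro square_integrable_diff square_integrable_cmult error_square_integrable sqa)
  note i = integrable_weighted[OF c P Q] integrable_weighted[OF c P P]
  have "(\<integral>y. \<psi> (fst y) * P y * (R y - \<epsilon>\<^sup>2 * a y) \<partial>lborel_on B) = 0"
  proof (rule integral_zero_of_factor_avg_zero[OF i(1)])
    show "\<psi> (fst (t, x, v)) * P (t, x, v) * (R (t, x, v) - \<epsilon>\<^sup>2 * a (t, x, v))
        = \<psi> t * (R (t, x, 0) - \<epsilon>\<^sup>2 * a (t, x, 0)) * P (t, x, v)" for t x v
      by (simp add: R_def a_def)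
  qed (use avg_W_defect in \<open>simp add: P_def\<close>)
  moreover have "(\<integral>y. \<psi> (fst y) * P y * S y \<partial>lborel_on B)
      = (\<integral>y. \<psi> (fst y) * P y * (R y - \<epsilon>\<^sup>2 * a y) + \<epsilon>\<^sup>2 * (\<psi> (fst y) * P y * P y) \<partial>lborel_on B)"
    by (rule Bochner_Integration.integral_cong) (auto simp: P_def S_def algebra_simps)
  moreover have "0 \<le> (\<integral>y. \<psi> (fst y) * P y * P y \<partial>lborel_on B)"
    using \<psi>(2) by (intro integral_nonneg_AE AE_I2) (auto simp: space_restrict_space mult.assoc)
  ultimately show ?thesis using i by (simp add: P_def)
qed

text \<open>
  The trace of \<open>w\<close> at \<open>t = 0\<close> inherits \<open>avg w = 0\<close>, here tested against \<open>a\<close> only: the product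
  rule applied to \<open>a * w\<close> has a vanishing left-hand side since \<open>a\<close> does not depend on the velocity.
\<close>

lemma a_wIC_orthogonal: "(\<integral>p. a (\<sigma>\<^sub>0 p) * wIC p \<partial>lborel_on XV) = 0"
proof -
  have ta: "H1_trace_along B XV \<sigma>\<^sub>0 (1,0,0) a a_t (\<lambda>p. a (\<sigma>\<^sub>0 p))"
    by (intro H1_trace_along_C1 a_C1 borel_boxes bounded_boxes continuous_faces)
  have tw: "H1_trace_along B XV \<sigma>\<^sub>0 (1,0,0) w w\<^sub>t wIC"
    using initial unfolding has_initial_data_def
    by (intro H1_trace_along_has_trace in_H1 Basis_TDV borel_boxes bounded_boxes continuous_faces) simp
  \<comment> \<open>This weight removes the trace at time \<open>T\<close> and leaves the factor
    \<open>T\<close> at time 0, which is positive and can be divided out.\<close>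
  have "((\<lambda>t. T - t) has_real_derivative - 1) (at t)" for t
    by (auto intro!: derivative_eq_intros)
  note rule = product_rule_t[OF this continuous_on_const _ ta tw]
  have sq: "square_integrable (lborel_on B) a" "square_integrable (lborel_on B) a_t"
    by (intro square_integrable_continuous borel_boxes bounded_boxes a_continuous)+
  have "(\<integral>y. - 1 * a y * w y \<partial>lborel_on B) = 0"
  proof (rule integral_zero_of_factor_avg_zero)
    show "integrable (lborel_on B) (\<lambda>y. - 1 * a y * w y)"
      by (intro integrable_weighted continuous_intros sq exact_square_integrable)
    show "- 1 * a (t, x, v) * w (t, x, v) = - a (t, x, 0) * w (t, x, v)" for t x v
      by (simp add: a_def)
  qed (rule avg_w)
  moreover have "(\<integral>y. (T - fst y) * a_t y * w y \<partial>lborel_on B) = 0"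
  proof (rule integral_zero_of_factor_avg_zero)
    show "integrable (lborel_on B) (\<lambda>y. (T - fst y) * a_t y * w y)"
      by (intro integrable_weighted continuous_intros sq exact_square_integrable)
    show "(T - fst (t, x, v)) * a_t (t, x, v) * w (t, x, v) = (T - t) * a_t (t, x, 0) * w (t, x, v)" for t x v
      by (simp add: a_t_def)
  qed (rule avg_w)
  moreover have "(\<integral>y. (T - fst y) * a y * w\<^sub>t y \<partial>lborel_on B) = 0"
  proof (rule integral_zero_of_factor_avg_zero)
    show "integrable (lborel_on B) (\<lambda>y. (T - fst y) * a y * w\<^sub>t y)"
      by (intro integrable_weighted continuous_intros sq exact_square_integrable)
    show "(T - fst (t, x, v)) * a (t, x, v) * w\<^sub>t (t, x, v) = (T - t) * a (t, x, 0) * w\<^sub>t (t, x, v)" for t x v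
      by (simp add: a_def)
  qed (rule avg_w_t)
  ultimately show ?thesis
    using rule T_pos by simp
qed

text \<open>Since \<open>wIC\<close> is orthogonal to the initial value of \<open>a\<close>, that
  value is minus the projection of \<open>W0\<close> in the pairing with itself: pairing it with
  \<open>W0\<close> gives minus its own square. Expanding the square of the sum then gives the
  bound.\<close>

lemma a_initial_bound: "(\<integral>p. (a (\<sigma>\<^sub>0 p))\<^sup>2 \<partial>lborel_on XV) \<le> (\<integral>p. (W0 p)\<^sup>2 \<partial>lborel_on XV)"
proof -
  let ?a = "\<lambda>p. a (\<sigma>\<^sub>0 p)" and ?w = "\<lambda>p. w\<theta> (\<sigma>\<^sub>0 p)"
  have c: "continuous_on UNIV ?a" "continuous_on UNIV ?w"
    by (intro continuous_on_compose2[OF a_continuous(1) continuous_faces(1)]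
        continuous_on_compose2[OF network_continuous(7) continuous_faces(1)] subset_UNIV)+
  note sqc = square_integrable_continuous[OF borel_boxes(4) bounded_boxes(4)]
  have wIC: "square_integrable (lborel_on XV) wIC" and W0: "square_integrable (lborel_on XV) W0"
    using initial borel_boxes error_trace_t(3)
    by (auto simp: has_initial_data_def has_trace_def L2_eq_square_integrable[symmetric]
        dest: H1_trace_along_square_integrable(3))
  have "(\<integral>p. ?a p * (?w p - ?a p) \<partial>lborel_on XV) = 0"
  proof -
    have "(\<integral>p. ?a p * (?w p - ?a p) \<partial>lborel_on XV)
      = (\<integral>x. avg (\<lambda>v. ?a (x, v) * (?w (x, v) - ?a (x, v))) \<partial>lborel_on {xL<..<xR})"
      unfolding avg_eq by (intro Fubini_lborel_on(1)[symmetric] sqc(3) continuous_intros c) auto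
    moreover have "avg (\<lambda>v. ?a (x, v) * (?w (x, v) - ?a (x, v))) = 0" for x
    proof -
      have "avg (\<lambda>v. ?a (x, v) * (?w (x, v) - ?a (x, v))) = a (0, x, 0) * avg (\<lambda>v. w\<theta> (0, x, v) - avg (\<lambda>s. w\<theta> (0, x, s)))"
        unfolding avg_cmult[symmetric] by (simp add: a_def)
      then show ?thesis by (simp only: avg_diff_avg mult_zero_right)
    qed
    ultimately show ?thesis by simp
  qed
  moreover have "(\<integral>p. ?a p * W0 p \<partial>lborel_on XV)
      = (\<integral>p. ?a p * wIC p - ?a p * (?w p - ?a p) - (?a p)\<^sup>2 \<partial>lborel_on XV)"
    by (rule Bochner_Integration.integral_cong) (auto simp: W0_def power2_eq_square algebra_simps)
  moreover have i: "integrable (lborel_on XV) (\<lambda>p. ?a p * wIC p)" "integrable (lborel_on XV) (\<lambda>p. ?a p * (?w p - ?a p))"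
      "integrable (lborel_on XV) (\<lambda>p. (?a p)\<^sup>2)" "integrable (lborel_on XV) (\<lambda>p. ?a p * W0 p)"
      "integrable (lborel_on XV) (\<lambda>p. (W0 p)\<^sup>2)"
    by (intro square_integrable_mult square_integrable_power2 wIC W0 sqc(1)[OF c(1)],
        intro sqc(3) continuous_intros c, intro square_integrable_power2 sqc(1) c,
        intro square_integrable_mult W0 sqc(1) c, intro square_integrable_power2 W0)
  ultimately have "(\<integral>p. ?a p * W0 p \<partial>lborel_on XV) = - (\<integral>p. (?a p)\<^sup>2 \<partial>lborel_on XV)"
    using a_wIC_orthogonal by simp
  moreover have "0 \<le> (\<integral>p. (?a p)\<^sup>2 + 2 * (?a p * W0 p) + (W0 p)\<^sup>2 \<partial>lborel_on XV)"
  proof (rule Bochner_Integration.integral_nonneg)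
    show "0 \<le> (?a p)\<^sup>2 + 2 * (?a p * W0 p) + (W0 p)\<^sup>2" for p
      using zero_le_power2[of "?a p + W0 p"] by (simp add: power2_sum mult_ac add_ac)
  qed
  ultimately show ?thesis using i by simp
qed

end

section \<open>The error estimate\<close>

context parity_error
begin

abbreviation sqn :: "'a::euclidean_space set \<Rightarrow> ('a \<Rightarrow> real) \<Rightarrow> real" where
  "sqn U f \<equiv> \<integral>z. (f z)\<^sup>2 \<partial>lborel_on U"

lemma trace_square_integrable:
  "square_integrable (lborel_on XV) R0" "square_integrable (lborel_on XV) J0" "square_integrable (lborel_on XV) W0"
  "c \<in> {xL, xR} \<Longrightarrow> square_integrable (lborel_on TV) (Rb c)"
  "c \<in> {xL, xR} \<Longrightarrow> square_integrable (lborel_on TV) (Jb c)"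
  "c \<in> {xL, xR} \<Longrightarrow> square_integrable (lborel_on TV) (Wb c)"
  using error_trace_t error_trace_x by (auto dest: H1_trace_along_square_integrable(3))

lemma residual_square_integrable:
  "square_integrable (lborel_on B) D1" "square_integrable (lborel_on B) D2" "square_integrable (lborel_on B) D3"
  by (intro square_integrable_continuous borel_boxes bounded_boxes residual_continuous)+

text \<open>The energy inequality and the relaxation estimate are combined with e =
  \<open>\<epsilon>^2\<close> and the ratio \<open>layer_rate\<close>. The factor 6 is the largest
  coefficient, that of \<open>D3\<close>: 2 from the square of \<open>D1\<close> + \<open>D3\<close>
  and 4 from the relaxation estimate.\<close>

lemma error_bound:
  "exp (- 2 * T - 1) * (sqn B S + \<epsilon>\<^sup>2 * sqn B J) \<le>
    6 * T * ((sqn XV R0 + \<epsilon>\<^sup>2 * sqn XV J0 + \<epsilon>^4 * sqn XV W0)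
      + (sqn TV (Rb xL) + sqn TV (Jb xL) + sqn TV (Wb xL) + sqn TV (Rb xR) + sqn TV (Jb xR) + sqn TV (Wb xR))
      + (sqn B D1 + sqn B D2 + sqn B D3))"
proof -
  let ?e = "\<epsilon>\<^sup>2"
  have e: "0 < ?e" "?e \<le> 1" using eps by (auto simp: power_le_one)
  have nn: "0 \<le> sqn U f" for U :: "'b::euclidean_space set" and f by simp
  have sqa: "square_integrable (lborel_on B) a"
    by (intro square_integrable_continuous borel_boxes bounded_boxes a_continuous)
  have cw: "continuous_on UNIV (energy_weight T ?e)"
    using energy_weight_has_deriv[OF e(1)] by (meson DERIV_continuous_on has_field_derivative_at_within)
  have "exp (- 2 * T - 1) * (sqn B S + ?e * sqn B J)
    \<le> energy_weight T ?e 0 * (sqn XV (\<lambda>p. R0 p + ?e * W0 p) + ?e * sqn XV J0)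
      + T * (sqn TV (\<lambda>p. Rb xL p + ?e * Wb xL p) + sqn TV (Jb xL)
           + sqn TV (\<lambda>p. Rb xR p + ?e * Wb xR p) + sqn TV (Jb xR))
      + (\<integral>y. energy_weight T ?e (fst y) / layer_rate ?e (fst y) * a y * a y \<partial>lborel_on B)
      + T * (sqn B (\<lambda>z. D1 z + D3 z) + 1/2 * sqn B D2)"
    by (rule weighted_energy_inequality[OF less_imp_le[OF e(1)] energy_weight_has_deriv[OF e(1)]
          continuous_energy_weight_deriv[OF e(1)] _ _ continuous_layer_rate[OF e(1)] layer_rate_pos[OF e(1)]
          energy_weight_decay S_trace(1) error_trace_t(2) S_trace(2)[OF insertI1]
          S_trace(2)[OF insertI2[OF singletonI]] error_trace_x(2)[OF insertI1]
          error_trace_x(2)[OF insertI2[OF singletonI]] error_square_integrable(5) sqa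
          square_integrable_add[OF residual_square_integrable(1,3)] residual_square_integrable(2)
          S_equation J_equation coercivity[OF cw]])
       (use energy_weight_bounds[OF e(1)] in \<open>auto simp: energy_weight_def\<close>)
  moreover have "energy_weight T ?e 0 = T" by (simp add: energy_weight_def)
  moreover have e4: "?e * (?e * x) = \<epsilon>^4 * x" for x by (simp add: power4_eq_xxxx power2_eq_square)
  have "sqn XV (\<lambda>p. R0 p + ?e * W0 p) \<le> 2 * sqn XV R0 + 2 * (\<epsilon>^4 * sqn XV W0)"
    using integral_power2_add_le[OF trace_square_integrable(1) square_integrable_cmult[OF trace_square_integrable(3)], of ?e]
    by (simp add: power_mult_distrib)
  moreover have bd: "sqn TV (\<lambda>p. Rb c p + ?e * Wb c p) \<le> 2 * sqn TV (Rb c) + 2 * sqn TV (Wb c)"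
    if c: "c \<in> {xL, xR}" for c
  proof -
    have "sqn TV (\<lambda>p. Rb c p + ?e * Wb c p) \<le> 2 * sqn TV (Rb c) + 2 * (?e\<^sup>2 * sqn TV (Wb c))"
      using integral_power2_add_le[OF trace_square_integrable(4)[OF c] square_integrable_cmult[OF trace_square_integrable(6)[OF c]], of ?e]
      by (simp add: power_mult_distrib)
    \<comment> \<open>Here \<open>\<epsilon>\<close> at most 1 enters: the boundary loss weighs the
      error of \<open>w\<close> without a power of \<open>\<epsilon>\<close>.\<close>
    moreover have "?e\<^sup>2 * sqn TV (Wb c) \<le> 1 * sqn TV (Wb c)"
      using e nn power_le_one[of ?e 2] by (intro mult_right_mono) auto
    ultimately show ?thesis by simp
  qed
  moreover have "sqn B (\<lambda>z. D1 z + D3 z) \<le> 2 * sqn B D1 + 2 * sqn B D3"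
    by (intro integral_power2_add_le residual_square_integrable)
  moreover have "(\<integral>y. energy_weight T ?e (fst y) / layer_rate ?e (fst y) * a y * a y \<partial>lborel_on B)
      \<le> 2 * T * (\<epsilon>^4 * sqn XV W0) + 4 * T * sqn B D3"
  proof -
    let ?w = "\<lambda>t. energy_weight T ?e t / layer_rate ?e t"
    have "(\<integral>y. ?w (fst y) * a y * a y \<partial>lborel_on B)
      \<le> 2 * ?e * ?w 0 * (\<integral>p. (a (\<sigma>\<^sub>0 p))\<^sup>2 \<partial>lborel_on XV) + 4 * T * sqn B g"
      by (rule relaxation_estimate[OF e(1) a_C1 layer_weight_has_deriv[OF e(1)] continuous_layer_weight_deriv[OF e(1)] _ _ a_equation])
         (use layer_weight_bounds[OF e(1)] in \<open>auto simp: energy_weight_def\<close>)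
    moreover have "?w 0 * (\<integral>p. (a (\<sigma>\<^sub>0 p))\<^sup>2 \<partial>lborel_on XV) \<le> (T * ?e) * sqn XV W0"
      using layer_weight_initial[OF e(1) T_pos] a_initial_bound T_pos e by (intro mult_mono) auto
    then have "?e * (?w 0 * (\<integral>p. (a (\<sigma>\<^sub>0 p))\<^sup>2 \<partial>lborel_on XV)) \<le> ?e * ((T * ?e) * sqn XV W0)"
      using e by (intro mult_left_mono) auto
    moreover have "T * sqn B g \<le> T * sqn B D3"
      using integral_avg_power2_le[OF residual_continuous(3)] T_pos unfolding g_def by (intro mult_left_mono) auto
    ultimately show ?thesis using e4[of "T * sqn XV W0"] by (simp add: mult_ac)
  qed
  ultimately have "exp (- 2 * T - 1) * (sqn B S + ?e * sqn B J)
    \<le> T * ((2 * sqn XV R0 + 2 * (\<epsilon>^4 * sqn XV W0)) + ?e * sqn XV J0)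
      + T * ((2 * sqn TV (Rb xL) + 2 * sqn TV (Wb xL)) + sqn TV (Jb xL)
           + (2 * sqn TV (Rb xR) + 2 * sqn TV (Wb xR)) + sqn TV (Jb xR))
      + (2 * T * (\<epsilon>^4 * sqn XV W0) + 4 * T * sqn B D3)
      + T * ((2 * sqn B D1 + 2 * sqn B D3) + 1/2 * sqn B D2)"
    using T_pos bd[of xL] bd[of xR]
    by (elim order_trans) (intro add_mono mult_left_mono order_refl; simp)
  also have "\<dots> = T * (2 * sqn XV R0 + 4 * (\<epsilon>^4 * sqn XV W0) + ?e * sqn XV J0
      + (2 * sqn TV (Rb xL) + 2 * sqn TV (Wb xL) + sqn TV (Jb xL) + 2 * sqn TV (Rb xR) + 2 * sqn TV (Wb xR) + sqn TV (Jb xR))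
      + (2 * sqn B D1 + 6 * sqn B D3 + 1/2 * sqn B D2))"
    by (simp add: algebra_simps)
  also have "\<dots> \<le> T * (6 * ((sqn XV R0 + ?e * sqn XV J0 + \<epsilon>^4 * sqn XV W0)
      + (sqn TV (Rb xL) + sqn TV (Jb xL) + sqn TV (Wb xL) + sqn TV (Rb xR) + sqn TV (Jb xR) + sqn TV (Wb xR))
      + (sqn B D1 + sqn B D2 + sqn B D3)))"
  proof (rule mult_left_mono)
    have arith: "2 * r + 4 * w' + j' + (2 * r1 + 2 * w1 + j1 + 2 * r2 + 2 * w2 + j2) + (2 * x1 + 6 * x3 + 1/2 * x2)
        \<le> 6 * ((r + j' + w') + (r1 + j1 + w1 + r2 + j2 + w2) + (x1 + x2 + x3))"
      if "0 \<le> j'" "0 \<le> w'" "0 \<le> r" "0 \<le> r1" "0 \<le> w1" "0 \<le> j1" "0 \<le> r2" "0 \<le> w2" "0 \<le> j2"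
        "0 \<le> x1" "0 \<le> x2" "0 \<le> x3" for r w' j' r1 w1 j1 r2 w2 j2 x1 x2 x3 :: real
      using that by simp
    have "0 \<le> ?e * sqn XV J0" "0 \<le> \<epsilon>^4 * sqn XV W0" using nn by auto
    from arith[OF this nn nn nn nn nn nn nn nn nn nn] show "2 * sqn XV R0 + 4 * (\<epsilon>^4 * sqn XV W0) + ?e * sqn XV J0
      + (2 * sqn TV (Rb xL) + 2 * sqn TV (Wb xL) + sqn TV (Jb xL) + 2 * sqn TV (Rb xR) + 2 * sqn TV (Wb xR) + sqn TV (Jb xR))
      + (2 * sqn B D1 + 6 * sqn B D3 + 1/2 * sqn B D2)
      \<le> 6 * ((sqn XV R0 + ?e * sqn XV J0 + \<epsilon>^4 * sqn XV W0)
      + (sqn TV (Rb xL) + sqn TV (Jb xL) + sqn TV (Wb xL) + sqn TV (Rb xR) + sqn TV (Jb xR) + sqn TV (Wb xR))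
      + (sqn B D1 + sqn B D2 + sqn B D3))"
      .
  qed (use T_pos in simp)
  finally show ?thesis by (simp only: mult.assoc mult.left_commute)
qed

lemma R_total_le: "R_total T xL xR \<epsilon> \<rho> j w \<rho>\<theta> j\<theta> w\<theta> \<le> 2 * (sqn B S + \<epsilon>\<^sup>2 * sqn B J)"
proof -
  have sq: "square_integrable (lborel_on B) (\<lambda>z. \<epsilon> * J z)"
    by (intro square_integrable_cmult error_square_integrable)
  have "kinetic_density \<epsilon> \<rho> j w t x v - kinetic_density \<epsilon> \<rho>\<theta> j\<theta> w\<theta> t x v = S (t, x, v) + \<epsilon> * J (t, x, v)" for t x v
    by (simp add: kinetic_density_def S_def R_def W_def J_def algebra_simps)
  then have "R_total T xL xR \<epsilon> \<rho> j w \<rho>\<theta> j\<theta> w\<theta> = sqn B (\<lambda>z. S z + \<epsilon> * J z)"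
    using integral_B_iterated'[OF square_integrable_power2[OF square_integrable_add[OF error_square_integrable(7) sq]]]
    by (simp add: R_total_def)
  also have "\<dots> \<le> 2 * sqn B S + 2 * sqn B (\<lambda>z. \<epsilon> * J z)"
    by (intro integral_power2_add_le error_square_integrable sq)
  finally show ?thesis by (simp add: power_mult_distrib)
qed

text \<open>As the velocity interval has length one, both normalisations coincide and
  \<open>D1\<close>, constant in v, has the same square integral over (t, x) as over (t, x,
  v).\<close>

lemma R_residual_eq: "R_residual T xL xR \<epsilon> \<rho>\<theta> j\<theta> w\<theta> = 1 / (T * (xR - xL)) * (sqn B D1 + sqn B D2 + sqn B D3)"
proof -
  note i = residual_square_integrable[THEN square_integrable_power2]
  have "sqn B D1 = (LINT t:{0<..<T}|lborel. LINT x:{xL<..<xR}|lborel. \<bar>d1 \<rho>\<theta> j\<theta> t x\<bar>\<^sup>2)"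
    using integral_B_iterated'[OF i(1)] by (simp add: D1_def avg_const flip: avg_def)
  moreover have "sqn B D2 + sqn B D3 = (LINT t:{0<..<T}|lborel. LINT x:{xL<..<xR}|lborel. LINT v:{0..1}|lborel.
        (\<bar>d2 \<epsilon> \<rho>\<theta> j\<theta> w\<theta> t x v\<bar>\<^sup>2 + \<bar>d3 \<epsilon> j\<theta> w\<theta> t x v\<bar>\<^sup>2))"
    using integral_B_iterated'[OF Bochner_Integration.integrable_add[OF i(2,3)]] i by (simp add: D2_def D3_def)
  ultimately show ?thesis
    by (simp add: R_residual_def box_measures add.assoc distrib_left)
qed

lemma R_initial_eq: "R_initial xL xR lam1 lam2 \<epsilon> \<rho>IC jIC wIC \<rho>\<theta> j\<theta> w\<theta>
    = lam1 / (xR - xL) * sqn XV R0 + lam2 / (xR - xL) * (\<epsilon>\<^sup>2 * sqn XV J0 + \<epsilon>^4 * sqn XV W0)"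
proof -
  note i = trace_square_integrable(1-3)[THEN square_integrable_power2]
  have "sqn XV R0 = (LINT x:{xL<..<xR}|lborel. \<bar>\<rho>\<theta> (0,x) - \<rho>IC x\<bar>\<^sup>2)"
    using integral_XV_iterated[OF i(1)] by (simp add: R0_def avg_const power2_commute flip: avg_def)
  moreover have "\<epsilon>\<^sup>2 * sqn XV J0 + \<epsilon>^4 * sqn XV W0 = (LINT x:{xL<..<xR}|lborel. LINT v:{0..1}|lborel.
          (\<epsilon>^2 * \<bar>j\<theta> (0,x,v) - jIC (x,v)\<bar>\<^sup>2 + \<epsilon>^4 * \<bar>w\<theta> (0,x,v) - wIC (x,v)\<bar>\<^sup>2))"
    using integral_XV_iterated[OF Bochner_Integration.integrable_add[OF integrable_mult_right[OF i(2)] integrable_mult_right[OF i(3)]], of "\<epsilon>\<^sup>2" "\<epsilon>^4"] i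
    by (simp add: J0_def W0_def power2_commute)
  ultimately show ?thesis by (simp add: R_initial_def box_measures)
qed

lemma R_boundary_eq: "R_boundary T xL xR lam3 lam4 \<rho>BC jBC wBC \<rho>\<theta> j\<theta> w\<theta>
    = lam3 / (2 * T) * (sqn TV (Rb xL) + sqn TV (Rb xR))
      + lam4 / (2 * T) * (sqn TV (Wb xL) + sqn TV (Jb xL) + sqn TV (Wb xR) + sqn TV (Jb xR))"
proof -
  have iR: "integrable (lborel_on TV) (\<lambda>p. (Rb c p)\<^sup>2)" and iW: "integrable (lborel_on TV) (\<lambda>p. (Wb c p)\<^sup>2)"
    and iJ: "integrable (lborel_on TV) (\<lambda>p. (Jb c p)\<^sup>2)" if "c \<in> {xL, xR}" for c
    using trace_square_integrable(4-6)[OF that] by (auto simp: square_integrable_power2)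
  have card: "card {xL, xR} = 2" using xL_less by simp
  have "(LINT t:{0<..<T}|lborel. \<Sum>x\<in>{xL,xR}. \<bar>\<rho>\<theta> (t,x) - \<rho>BC (t,x)\<bar>\<^sup>2) = sqn TV (Rb xL) + sqn TV (Rb xR)"
    using boundary_sum_iterated[of "\<lambda>c p. (Rb c p)\<^sup>2"] iR
    by (simp add: Rb_def avg_const power2_commute flip: avg_def)
  moreover have "(LINT t:{0<..<T}|lborel. \<Sum>x\<in>{xL,xR}. LINT v:{0..1}|lborel.
          (\<bar>w\<theta> (t,x,v) - wBC (t,x,v)\<bar>\<^sup>2 + \<bar>j\<theta> (t,x,v) - jBC (t,x,v)\<bar>\<^sup>2))
      = sqn TV (Wb xL) + sqn TV (Jb xL) + (sqn TV (Wb xR) + sqn TV (Jb xR))"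
    using boundary_sum_iterated[of "\<lambda>c p. (Wb c p)\<^sup>2 + (Jb c p)\<^sup>2"] iW iJ
    by (simp add: Wb_def Jb_def power2_commute)
  ultimately show ?thesis
    unfolding R_boundary_def card by (simp add: box_measures mult.commute add.assoc)
qed

text \<open>Each unweighted square is at most the reciprocal of its coefficient in the loss times
  the whole loss; the bracket is the sum of these reciprocals. The factor 12 is 2 from
  \<open>R_total_le\<close> times 6 from \<open>error_bound\<close>, and
  \<open>exp (2 * T + 1)\<close> inverts the energy constant.\<close>

lemma R_total_bound:
  assumes lam: "0 < lam1" "0 < lam2" "0 < lam3" "0 < lam4"
  shows "R_total T xL xR \<epsilon> \<rho> j w \<rho>\<theta> j\<theta> w\<theta>
    \<le> 12 * T * exp (2 * T + 1) * (T * (xR - xL) + (xR - xL) / lam1 + (xR - xL) / lam2 + 2 * T / lam3 + 2 * T / lam4)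
      * R_APNN T xL xR lam1 lam2 lam3 lam4 \<epsilon> \<rho>IC jIC wIC \<rho>BC jBC wBC \<rho>\<theta> j\<theta> w\<theta>"
    and "0 \<le> R_APNN T xL xR lam1 lam2 lam3 lam4 \<epsilon> \<rho>IC jIC wIC \<rho>BC jBC wBC \<rho>\<theta> j\<theta> w\<theta>"
proof -
  define L where "L = xR - xL"
  have L: "0 < L" using xL_less by (simp add: L_def)
  define A where "A = sqn B D1 + sqn B D2 + sqn B D3"
  define I where "I = \<epsilon>\<^sup>2 * sqn XV J0 + \<epsilon>^4 * sqn XV W0"
  define P where "P = sqn TV (Rb xL) + sqn TV (Rb xR)"
  define Q where "Q = sqn TV (Wb xL) + sqn TV (Jb xL) + sqn TV (Wb xR) + sqn TV (Jb xR)"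
  define N where "N = sqn XV R0"
  define X where "X = R_APNN T xL xR lam1 lam2 lam3 lam4 \<epsilon> \<rho>IC jIC wIC \<rho>BC jBC wBC \<rho>\<theta> j\<theta> w\<theta>"
  define M where "M = T * L + L / lam1 + L / lam2 + 2 * T / lam3 + 2 * T / lam4"
  have nn: "0 \<le> A" "0 \<le> I" "0 \<le> P" "0 \<le> Q" "0 \<le> N"
    by (simp_all add: A_def I_def P_def Q_def N_def)
  have X: "X = A / (T * L) + lam1 * N / L + lam2 * I / L + lam3 * P / (2 * T) + lam4 * Q / (2 * T)"
    unfolding X_def R_APNN_def R_residual_eq R_initial_eq R_boundary_eq A_def I_def P_def Q_def N_def L_def by simp
  have p: "0 \<le> A / (T * L)" "0 \<le> lam1 * N / L" "0 \<le> lam2 * I / L" "0 \<le> lam3 * P / (2 * T)" "0 \<le> lam4 * Q / (2 * T)"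
    using nn lam T_pos L by auto
  show X0: "0 \<le> R_APNN T xL xR lam1 lam2 lam3 lam4 \<epsilon> \<rho>IC jIC wIC \<rho>BC jBC wBC \<rho>\<theta> j\<theta> w\<theta>"
    using p X unfolding X_def[symmetric] by linarith
  have "A = T * L * (A / (T * L))" "N = L / lam1 * (lam1 * N / L)" "I = L / lam2 * (lam2 * I / L)"
      "P = 2 * T / lam3 * (lam3 * P / (2 * T))" "Q = 2 * T / lam4 * (lam4 * Q / (2 * T))"
    using lam T_pos L by auto
  moreover have "T * L * (A / (T * L)) \<le> T * L * X" "L / lam1 * (lam1 * N / L) \<le> L / lam1 * X"
      "L / lam2 * (lam2 * I / L) \<le> L / lam2 * X" "2 * T / lam3 * (lam3 * P / (2 * T)) \<le> 2 * T / lam3 * X"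
      "2 * T / lam4 * (lam4 * Q / (2 * T)) \<le> 2 * T / lam4 * X"
    using lam T_pos L p unfolding X by (intro mult_left_mono; simp)+
  ultimately have "A + N + I + P + Q \<le> T * L * X + L / lam1 * X + L / lam2 * X + 2 * T / lam3 * X + 2 * T / lam4 * X"
    by linarith
  also have "\<dots> = M * X" by (simp add: M_def distrib_right)
  finally have sum: "A + N + I + P + Q \<le> M * X" .
  have "exp (- 2 * T - 1) * (sqn B S + \<epsilon>\<^sup>2 * sqn B J) \<le> 6 * T * (A + N + I + P + Q)"
    using error_bound unfolding A_def N_def I_def P_def Q_def by (simp add: ac_simps)
  also have "\<dots> \<le> 6 * T * (M * X)" using sum T_pos by (intro mult_left_mono) auto
  finally have "exp (2 * T + 1) * (exp (- 2 * T - 1) * (sqn B S + \<epsilon>\<^sup>2 * sqn B J)) \<le> exp (2 * T + 1) * (6 * T * (M * X))"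
    by (intro mult_left_mono) auto
  moreover have "exp (2 * T + 1) * exp (- 2 * T - 1) = (1::real)" by (simp flip: exp_add)
  ultimately have "sqn B S + \<epsilon>\<^sup>2 * sqn B J \<le> exp (2 * T + 1) * (6 * T * (M * X))"
    by (simp only: mult.assoc[symmetric] mult_1_left)
  with R_total_le show "R_total T xL xR \<epsilon> \<rho> j w \<rho>\<theta> j\<theta> w\<theta>
    \<le> 12 * T * exp (2 * T + 1) * (T * (xR - xL) + (xR - xL) / lam1 + (xR - xL) / lam2 + 2 * T / lam3 + 2 * T / lam4)
      * R_APNN T xL xR lam1 lam2 lam3 lam4 \<epsilon> \<rho>IC jIC wIC \<rho>BC jBC wBC \<rho>\<theta> j\<theta> w\<theta>"
    unfolding X_def[symmetric] L_def[symmetric] M_def[symmetric] by (simp add: mult_ac)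
qed

end

theorem theorem2p4:
  fixes T xL xR lam1 lam2 lam3 lam4 :: real
  assumes "0 < T" and "xL < xR"
    and "0 < lam1" and "0 < lam2" and "0 < lam3" and "0 < lam4"
  shows "\<exists>C>0. \<forall>\<epsilon>\<in>{0<..1}. \<forall>\<rho> j w \<rho>IC jIC wIC \<rho>BC jBC wBC \<rho>\<theta> j\<theta> w\<theta>.
           solves_parity_system T xL xR \<epsilon> \<rho> j w \<and>
           has_initial_data T xL xR \<rho> j w \<rho>IC jIC wIC \<and>
           has_boundary_data T xL xR \<rho> j w \<rho>BC jBC wBC \<and>
           periodic_boundary_data T xL xR \<rho>BC jBC wBC \<and>
           smooth \<rho>\<theta> \<and> smooth j\<theta> \<and> smooth w\<theta> \<longrightarrow>
             R_total T xL xR \<epsilon> \<rho> j w \<rho>\<theta> j\<theta> w\<theta>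
               \<le> C * (R_APNN T xL xR lam1 lam2 lam3 lam4 \<epsilon> \<rho>IC jIC wIC \<rho>BC jBC wBC \<rho>\<theta> j\<theta> w\<theta> + \<epsilon>\<^sup>2)"
proof -
  \<comment> \<open>Built from \<open>T\<close>, the length of the interval and the penalty weights
    only, and fixed before \<open>\<epsilon>\<close>, the solution and the network are
    introduced.\<close>
  define C where "C = 12 * T * exp (2 * T + 1) *
    (T * (xR - xL) + (xR - xL) / lam1 + (xR - xL) / lam2 + 2 * T / lam3 + 2 * T / lam4)"
  have C: "0 < C"
    unfolding C_def using assms by (intro mult_pos_pos add_pos_pos divide_pos_pos) auto
  show ?thesis
  proof (intro exI[of _ C] conjI C ballI allI impI)
    fix \<epsilon> \<rho> j w \<rho>IC jIC wIC \<rho>BC jBC wBC and \<rho>\<theta> :: "real \<times> real \<Rightarrow> real"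
      and j\<theta> w\<theta> :: "real \<times> real \<times> real \<Rightarrow> real"
    assume \<epsilon>: "\<epsilon> \<in> {0<..1}" and H: "solves_parity_system T xL xR \<epsilon> \<rho> j w \<and>
           has_initial_data T xL xR \<rho> j w \<rho>IC jIC wIC \<and>
           has_boundary_data T xL xR \<rho> j w \<rho>BC jBC wBC \<and>
           periodic_boundary_data T xL xR \<rho>BC jBC wBC \<and>
           smooth \<rho>\<theta> \<and> smooth j\<theta> \<and> smooth w\<theta>"
    let ?X = "R_APNN T xL xR lam1 lam2 lam3 lam4 \<epsilon> \<rho>IC jIC wIC \<rho>BC jBC wBC \<rho>\<theta> j\<theta> w\<theta>"
    interpret parity_error T xL xR \<epsilon> \<rho> j w \<rho>IC jIC wIC \<rho>BC jBC wBC \<rho>\<theta> j\<theta> w\<theta>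
      using \<epsilon> H assms by unfold_locales auto
    have "R_total T xL xR \<epsilon> \<rho> j w \<rho>\<theta> j\<theta> w\<theta> \<le> C * ?X"
      unfolding C_def by (rule R_total_bound) (use assms in auto)
    also have "\<dots> \<le> C * (?X + \<epsilon>\<^sup>2)"
      using C by (intro mult_left_mono) auto
    finally show "R_total T xL xR \<epsilon> \<rho> j w \<rho>\<theta> j\<theta> w\<theta> \<le> C * (?X + \<epsilon>\<^sup>2)" .
  qed
qed

end
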